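(* Let $(M,g)$ be a smooth (not necessarily compact) Riemannian manifold, let $E\to M$ be a smooth complex Hermitian vector bundle of Clifford modules, and let $D$ be an operator of Dirac type acting on sections of $E$. Let $\mathfrak{P}$ be an admissible perturbation. Let $u\in C^\infty(M;E)$ be a solution of the perturbed equation $$D u+\mathfrak{P}(u)=0 \quad\text{on } M .$$ If $u$ vanishes on a non-empty open subset of a connected component of $M$, then $u$ vanishes identically on that connected component.
   Context: Setting. $\mathrm{Cl}(M)=\{\mathrm{Cl}(TM_x,g_x)\}_{x\in M}$ is the bundle of Clifford algebras of the tangent spaces. $E\to M$ is a smooth complex vector bundle of Clifford modules, i.e. there is a bundle map (Clifford multiplication) $\mathbf{c}:\mathrm{Cl}(M)\to \mathrm{Hom}(E,E)$ giving in each fibre a representation $\mathrm{Cl}(TM_x,g_x)\to \mathrm{Hom}_{\mathbb C}(E_x,E_x)$. $E$ carries a Hermitian metric for which $\langle \mathbf{c}(v)s,s'\rangle=-\langle s,\mathbf{c}(v)s'\rangle$ for $v\in TM_x$, $s,s'\in E_x$; $|\cdot|$ is the corresponding fibre norm. Operator of Dirac type. For any smooth connection $\nabla:C^\infty(M;E)\to C^\infty(M;T^*M\otimes E)$ (not required to be compatible with Clifford multiplication), the operator $D:=\mathbf{c}\circ\nabla$ (identifying $TM$ with $T^*M$ through the Riemannian metric) is called an operator of Dirac type; with respect to a local orthonormal frame, $D=\sum_j \mathbf{c}(e_j)\nabla_{e_j}$. Admissible perturbation. A (possibly non-linear and/or non-local) map $\mathfrak{P}$ from sections of $E$ to sections of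 $E$ is admissible if for every section $u$ there is a real-valued non-negative function $P(u,\cdot)$, locally bounded on $M$ (for each fixed $u$), with $$|\mathfrak{P}(u)(x)|\le P(u,x)\,|u(x)|\qquad\text{for } x\in M.$$ *)

theory Defs
  imports "HOL-Analysis.Analysis" "HOL-Algebra.QuotRing"
begin

section \<open>Smooth maps between Euclidean spaces\<close>

text \<open>For open \<open>S\<close> in a finite-dimensional space this is the usual class \<open>C\<^sup>k(S)\<close>.\<close>

primrec Ck_on :: "nat \<Rightarrow> 'a::euclidean_space set \<Rightarrow> ('a \<Rightarrow> 'b::real_normed_vector) \<Rightarrow> bool" where
  "Ck_on 0 S f \<longleftrightarrow> continuous_on S f"
| "Ck_on (Suc k) S f \<longleftrightarrow>
     (\<forall>x\<in>S. f differentiable (at x)) \<and>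
     (\<forall>v. Ck_on k S (\<lambda>x. frechet_derivative f (at x) v))"

definition smooth_on :: "'a::euclidean_space set \<Rightarrow> ('a \<Rightarrow> 'b::real_normed_vector) \<Rightarrow> bool" where
  "smooth_on S f \<longleftrightarrow> (\<forall>k. Ck_on k S f)"


section \<open>Clifford algebras\<close>

text \<open>
  The unital associative real algebra freely generated by the set \<open>V\<close>: finitely supported
  real functions on the words over \<open>V\<close>, with the product extending concatenation.
\<close>

definition free_algebra :: "'t set \<Rightarrow> ('t list \<Rightarrow> real) ring" where
  "free_algebra V =
     \<lparr>carrier = {p. finite {w. p w \<noteq> 0} \<and> (\<forall>w. p w \<noteq> 0 \<longrightarrow> set w \<subseteq> V)},
      mult = (\<lambda>p q w. \<Sum>k\<le>length w. p (take k w) * q (drop k w)),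
      one = (\<lambda>w. if w = [] then 1 else 0),
      zero = (\<lambda>w. 0),
      add = (\<lambda>p q w. p w + q w)\<rparr>"

text \<open>
  The library's generated ideal is meaningful only in a ring (otherwise it is the whole type).
\<close>

lemma free_algebra_assoc_aux: fixes p q r :: "'t list \<Rightarrow> real"
  shows "(\<Sum>k\<le>length w. (\<Sum>j\<le>length (take k w). p (take j (take k w)) * q (drop j (take k w))) * r (drop k w))
       = (\<Sum>j\<le>length w. p (take j w) * (\<Sum>i\<le>length (drop j w). q (take i (drop j w)) * r (drop i (drop j w))))" (is "?L = ?R")
proof -
  let ?F = "\<lambda>k j. p (take j w) * q (drop j (take k w)) * r (drop k w)"
  have "?L = (\<Sum>k\<le>length w. \<Sum>j\<le>k. ?F k j)"
    by (rule sum.cong[OF refl]) (auto simp: sum_distrib_right min_def intro!: sum.cong)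
  also have "\<dots> = (\<Sum>(k,j)\<in>Sigma {..length w} (\<lambda>k. {..k}). ?F k j)"
    by (simp add: sum.Sigma)
  also have "\<dots> = (\<Sum>(j,i)\<in>Sigma {..length w} (\<lambda>j. {..length w - j}). ?F (i+j) j)"
    by (rule sum.reindex_bij_witness[where i="\<lambda>(j,i). (i+j,j)" and j="\<lambda>(k,j). (j,k-j)"]) auto
  also have "\<dots> = (\<Sum>j\<le>length w. \<Sum>i\<le>length w - j. ?F (i+j) j)"
    by (simp add: sum.Sigma)
  also have "\<dots> = ?R"
    by (rule sum.cong[OF refl]) (auto simp: sum_distrib_left drop_take add.commute mult.assoc intro!: sum.cong)
  finally show ?thesis .
qed

lemma free_algebra_support_aux: fixes p q :: "'t list \<Rightarrow> real"
  assumes "(\<Sum>k\<le>length w. p (take k w) * q (drop k w)) \<noteq> 0"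
  shows "\<exists>a b. p a \<noteq> 0 \<and> q b \<noteq> 0 \<and> w = a @ b"
proof -
  obtain k where "p (take k w) * q (drop k w) \<noteq> 0" using assms by (meson sum.neutral)
  then show ?thesis by (metis append_take_drop_id mult_eq_0_iff)
qed

lemma free_algebra_one_left_aux: "(\<Sum>k\<le>length w. (if take k w = [] then 1 else 0) * q (drop k w)) = (q w::real)"
proof -
  have "(\<Sum>k\<le>length w. (if take k w = [] then 1 else 0) * q (drop k w)) = (\<Sum>k\<le>length w. if k = 0 then q w else 0)"
    by (rule sum.cong) auto
  then show ?thesis by simp
qed

lemma free_algebra_one_right_aux: "(\<Sum>k\<le>length w. q (take k w) * (if drop k w = [] then 1 else 0)) = (q w::real)"
proof -
  have "(\<Sum>k\<le>length w. q (take k w) * (if drop k w = [] then 1 else 0)) = (\<Sum>k\<le>length w. if k = length w then q w else 0)"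
    by (rule sum.cong) auto
  then show ?thesis by simp
qed

lemma ring_free_algebra: "ring (free_algebra V)"
proof (rule ringI)
  show "abelian_group (free_algebra V)"
  proof (rule abelian_groupI)
    fix p q assume a: "p \<in> carrier (free_algebra V)" "q \<in> carrier (free_algebra V)"
    then have "finite ({w. p w \<noteq> 0} \<union> {w. q w \<noteq> 0})" by (auto simp: free_algebra_def)
    then have "finite {w. p w + q w \<noteq> 0}" by (rule rev_finite_subset) auto
    then show "p \<oplus>\<^bsub>free_algebra V\<^esub> q \<in> carrier (free_algebra V)" using a
      by (auto simp: free_algebra_def) (metis add_0 subsetD)
  next
    fix p assume "p \<in> carrier (free_algebra V)"
    then show "\<exists>y\<in>carrier (free_algebra V). y \<oplus>\<^bsub>free_algebra V\<^esub> p = \<zero>\<^bsub>free_algebra V\<^esub>"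
      by (intro bexI[of _ "\<lambda>w. - p w"]) (auto simp: free_algebra_def)
  qed (auto simp: free_algebra_def algebra_simps)
  show "monoid (free_algebra V)"
  proof (rule monoidI)
    fix p q assume a: "p \<in> carrier (free_algebra V)" "q \<in> carrier (free_algebra V)"
    then have "finite ((\<lambda>(a,b). a @ b) ` ({w. p w \<noteq> 0} \<times> {w. q w \<noteq> 0}))" by (auto simp: free_algebra_def)
    then have "finite {w. (\<Sum>k\<le>length w. p (take k w) * q (drop k w)) \<noteq> 0}"
      by (rule rev_finite_subset) (auto dest!: free_algebra_support_aux simp: image_iff)
    moreover have "set w \<subseteq> V" if "(\<Sum>k\<le>length w. p (take k w) * q (drop k w)) \<noteq> 0" for w
      using free_algebra_support_aux[OF that] a by (auto simp: free_algebra_def) blast+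
    ultimately show "p \<otimes>\<^bsub>free_algebra V\<^esub> q \<in> carrier (free_algebra V)"
      by (auto simp: free_algebra_def)
  qed (simp_all only: free_algebra_def ring.simps monoid.simps partial_object.simps free_algebra_assoc_aux free_algebra_one_left_aux free_algebra_one_right_aux, auto intro: finite_subset[of _ "{[]}"])
qed (auto simp: free_algebra_def algebra_simps sum.distrib)

definition monomial :: "real \<Rightarrow> 't list \<Rightarrow> 't list \<Rightarrow> real" where
  "monomial a w = (\<lambda>w'. if w' = w then a else 0)"

text \<open>
  The Clifford algebra of a real vector space \<open>V\<close> (with operations \<open>pl\<close>, \<open>sc\<close>) carrying a
  bilinear form \<open>q\<close>: the quotient of the free algebra by the two-sided ideal generated by the
  linearity relations \<open>[v + w] = [v] + [w]\<close>, \<open>[a v] = a [v]\<close> (whose quotient alone is the tensor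
  algebra of \<open>V\<close>) and by \<open>v \<otimes> v + q(v,v) 1\<close>.  The sign is the one forced by
  Clifford multiplication with vectors being skew-Hermitian.
\<close>

definition clifford_relations ::
  "('t \<Rightarrow> 't \<Rightarrow> 't) \<Rightarrow> (real \<Rightarrow> 't \<Rightarrow> 't) \<Rightarrow> 't set \<Rightarrow> ('t \<Rightarrow> 't \<Rightarrow> real) \<Rightarrow> ('t list \<Rightarrow> real) set" where
  "clifford_relations pl sc V q =
     {\<lambda>u. monomial 1 [pl v w] u - monomial 1 [v] u - monomial 1 [w] u | v w. v \<in> V \<and> w \<in> V} \<union>
     {\<lambda>u. monomial 1 [sc a v] u - monomial a [v] u | a v. v \<in> V} \<union>
     {\<lambda>u. monomial 1 [v, v] u + monomial (q v v) [] u | v. v \<in> V}"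

definition clifford_ideal ::
  "('t \<Rightarrow> 't \<Rightarrow> 't) \<Rightarrow> (real \<Rightarrow> 't \<Rightarrow> 't) \<Rightarrow> 't set \<Rightarrow> ('t \<Rightarrow> 't \<Rightarrow> real) \<Rightarrow> ('t list \<Rightarrow> real) set" where
  "clifford_ideal pl sc V q = Idl\<^bsub>free_algebra V\<^esub> (clifford_relations pl sc V q)"

definition clifford_algebra ::
  "('t \<Rightarrow> 't \<Rightarrow> 't) \<Rightarrow> (real \<Rightarrow> 't \<Rightarrow> 't) \<Rightarrow> 't set \<Rightarrow> ('t \<Rightarrow> 't \<Rightarrow> real) \<Rightarrow> ('t list \<Rightarrow> real) set ring" where
  "clifford_algebra pl sc V q = free_algebra V Quot clifford_ideal pl sc V q"

text \<open>The class of \<open>a v\<^sub>1 \<cdots> v\<^sub>k\<close>; the empty word gives the scalar \<open>a\<close>.\<close>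

definition clifford_product ::
  "('t \<Rightarrow> 't \<Rightarrow> 't) \<Rightarrow> (real \<Rightarrow> 't \<Rightarrow> 't) \<Rightarrow> 't set \<Rightarrow> ('t \<Rightarrow> 't \<Rightarrow> real) \<Rightarrow>
   real \<Rightarrow> 't list \<Rightarrow> ('t list \<Rightarrow> real) set" where
  "clifford_product pl sc V q a w =
     clifford_ideal pl sc V q +>\<^bsub>free_algebra V\<^esub> monomial a w"


section \<open>Smooth manifolds\<close>

text \<open>
  A chart is a pair of its domain and its coordinate map; values of the coordinate map outside
  the domain are irrelevant.  The manifold is the whole type \<open>'m\<close>, its dimension is \<open>CARD('n)\<close>.
\<close>

type_synonym ('m, 'n) chart = "'m set \<times> ('m \<Rightarrow> real^'n)"

abbreviation chart_dom :: "('m, 'n::finite) chart \<Rightarrow> 'm set" where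
  "chart_dom \<equiv> fst"

abbreviation chart_map :: "('m, 'n::finite) chart \<Rightarrow> 'm \<Rightarrow> real^'n" where
  "chart_map \<equiv> snd"

definition chart_inv :: "('m, 'n::finite) chart \<Rightarrow> real^'n \<Rightarrow> 'm" where
  "chart_inv \<kappa> = inv_into (chart_dom \<kappa>) (chart_map \<kappa>)"

text \<open>
  A tangent vector at \<open>x\<close> assigns to every chart around \<open>x\<close> its components in that chart,
  and components in different charts are related by the Jacobian of the coordinate change.
  Charts not around \<open>x\<close> get the dummy value \<open>0\<close>.
\<close>

type_synonym ('m, 'n) tangent = "('m, 'n) chart \<Rightarrow> real^'n"

definition tadd :: "('m, 'n::finite) tangent \<Rightarrow> ('m, 'n) tangent \<Rightarrow> ('m, 'n) tangent" where
  "tadd v w = (\<lambda>\<kappa>. v \<kappa> + w \<kappa>)"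

definition tscale :: "real \<Rightarrow> ('m, 'n::finite) tangent \<Rightarrow> ('m, 'n) tangent" where
  "tscale a v = (\<lambda>\<kappa>. a *\<^sub>R v \<kappa>)"

definition tzero :: "('m, 'n::finite) tangent" where
  "tzero = (\<lambda>\<kappa>. 0)"

locale smooth_manifold =
  fixes \<A> :: "('m::{t2_space, second_countable_topology}, 'n::finite) chart set"
  assumes atlas_covers: "(\<Union>\<kappa>\<in>\<A>. chart_dom \<kappa>) = UNIV"
    and atlas_homeo: "\<And>\<kappa>. \<kappa> \<in> \<A> \<Longrightarrow>
          open (chart_dom \<kappa>) \<and> open (chart_map \<kappa> ` chart_dom \<kappa>) \<and>
          homeomorphism (chart_dom \<kappa>) (chart_map \<kappa> ` chart_dom \<kappa>) (chart_map \<kappa>) (chart_inv \<kappa>)"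
    and atlas_compatible: "\<And>\<kappa> \<kappa>'. \<kappa> \<in> \<A> \<Longrightarrow> \<kappa>' \<in> \<A> \<Longrightarrow>
          smooth_on (chart_map \<kappa> ` (chart_dom \<kappa> \<inter> chart_dom \<kappa>')) (chart_map \<kappa>' \<circ> chart_inv \<kappa>)"
begin

definition smooth_map_on :: "'m set \<Rightarrow> ('m \<Rightarrow> 'b::real_normed_vector) \<Rightarrow> bool" where
  "smooth_map_on U f \<longleftrightarrow>
     (\<forall>\<kappa>\<in>\<A>. smooth_on (chart_map \<kappa> ` (U \<inter> chart_dom \<kappa>)) (f \<circ> chart_inv \<kappa>))"

definition tangent_space :: "'m \<Rightarrow> ('m, 'n) tangent set" where
  "tangent_space x =
     {v. (\<forall>\<kappa>. \<not> (\<kappa> \<in> \<A> \<and> x \<in> chart_dom \<kappa>) \<longrightarrow> v \<kappa> = 0) \<and>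
         (\<forall>\<kappa>\<in>\<A>. \<forall>\<kappa>'\<in>\<A>. x \<in> chart_dom \<kappa> \<inter> chart_dom \<kappa>' \<longrightarrow>
            v \<kappa>' = frechet_derivative (chart_map \<kappa>' \<circ> chart_inv \<kappa>) (at (chart_map \<kappa> x)) (v \<kappa>))}"

definition smooth_vector_field_on :: "'m set \<Rightarrow> ('m \<Rightarrow> ('m, 'n) tangent) \<Rightarrow> bool" where
  "smooth_vector_field_on U X \<longleftrightarrow>
     (\<forall>x\<in>U. X x \<in> tangent_space x) \<and>
     (\<forall>\<kappa>\<in>\<A>. smooth_map_on (U \<inter> chart_dom \<kappa>) (\<lambda>x. X x \<kappa>))"

text \<open>
  The differential of \<open>f\<close> at \<open>x\<close> applied to \<open>v\<close>, computed in the chart \<open>\<kappa>\<close> around \<open>x\<close>; by the chain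
  rule the value is the same for all such \<open>\<kappa>\<close>.
\<close>

definition differential ::
  "('m, 'n) chart \<Rightarrow> ('m \<Rightarrow> 'b::real_normed_vector) \<Rightarrow> 'm \<Rightarrow> ('m, 'n) tangent \<Rightarrow> 'b" where
  "differential \<kappa> f x v = frechet_derivative (f \<circ> chart_inv \<kappa>) (at (chart_map \<kappa> x)) (v \<kappa>)"

end

locale riemannian_manifold = smooth_manifold \<A>
  for \<A> :: "('m::{t2_space, second_countable_topology}, 'n::finite) chart set" +
  fixes g :: "'m \<Rightarrow> ('m, 'n) tangent \<Rightarrow> ('m, 'n) tangent \<Rightarrow> real"
  assumes metric_add: "\<And>x v w z. v \<in> tangent_space x \<Longrightarrow> w \<in> tangent_space x \<Longrightarrow>
          z \<in> tangent_space x \<Longrightarrow> g x (tadd v w) z = g x v z + g x w z"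
    and metric_scale: "\<And>x a v z. v \<in> tangent_space x \<Longrightarrow> z \<in> tangent_space x \<Longrightarrow>
          g x (tscale a v) z = a * g x v z"
    and metric_sym: "\<And>x v w. v \<in> tangent_space x \<Longrightarrow> w \<in> tangent_space x \<Longrightarrow> g x v w = g x w v"
    and metric_pos: "\<And>x v. v \<in> tangent_space x \<Longrightarrow> v \<noteq> tzero \<Longrightarrow> g x v v > 0"
    and metric_smooth: "\<And>U X Y. open U \<Longrightarrow> smooth_vector_field_on U X \<Longrightarrow>
          smooth_vector_field_on U Y \<Longrightarrow> smooth_map_on U (\<lambda>x. g x (X x) (Y x))"
begin

text \<open>As many orthonormal vectors as the dimension; such a family is a basis of the tangent space.\<close>

definition orthonormal_frame_at :: "'m \<Rightarrow> ('n \<Rightarrow> ('m, 'n) tangent) \<Rightarrow> bool" where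
  "orthonormal_frame_at x e \<longleftrightarrow>
     (\<forall>i. e i \<in> tangent_space x) \<and> (\<forall>i j. g x (e i) (e j) = (if i = j then 1 else 0))"

abbreviation Cl :: "'m \<Rightarrow> (('m, 'n) tangent list \<Rightarrow> real) set ring" where
  "Cl x \<equiv> clifford_algebra tadd tscale (tangent_space x) (g x)"

abbreviation Cl_product :: "'m \<Rightarrow> real \<Rightarrow> ('m, 'n) tangent list \<Rightarrow> (('m, 'n) tangent list \<Rightarrow> real) set" where
  "Cl_product x \<equiv> clifford_product tadd tscale (tangent_space x) (g x)"

end


section \<open>Complex vector bundles\<close>

text \<open>
  The fibres \<open>E x\<close> are complex subspaces of one complex vector space \<open>'v\<close> of arbitrary dimension.
  This is only a device for having common names for the fibrewise operations (any family of
  vector spaces embeds in its direct sum): \<open>'v\<close> carries no topology, the fibres over different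
  points are unrelated, and the smooth structure of the bundle is given by the local
  trivializations alone.  A trivialization is a pair \<open>(U, \<phi>)\<close> with \<open>\<phi> x\<close> an isomorphism from
  \<open>E x\<close> onto \<open>complex^'r\<close> for \<open>x \<in> U\<close>.
\<close>

type_synonym ('m, 'v, 'r) triv = "'m set \<times> ('m \<Rightarrow> 'v \<Rightarrow> complex^'r)"

locale complex_vector_bundle = smooth_manifold \<A> + vector_space scaleC
  for \<A> :: "('m::{t2_space, second_countable_topology}, 'n::finite) chart set"
    and scaleC :: "complex \<Rightarrow> 'v::ab_group_add \<Rightarrow> 'v"  (infixr \<open>\<cdot>\<close> 75) +
  fixes E :: "'m \<Rightarrow> 'v set"
    and \<T> :: "('m, 'v, 'r::finite) triv set"
  assumes fibre_subspace: "\<And>x. subspace (E x)"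
    and triv_covers: "(\<Union>\<tau>\<in>\<T>. fst \<tau>) = UNIV"
    and triv_open: "\<And>U \<phi>. (U, \<phi>) \<in> \<T> \<Longrightarrow> open U"
    and triv_bij: "\<And>U \<phi> x. (U, \<phi>) \<in> \<T> \<Longrightarrow> x \<in> U \<Longrightarrow> bij_betw (\<phi> x) (E x) UNIV"
    and triv_linear: "\<And>U \<phi> x a b s t. (U, \<phi>) \<in> \<T> \<Longrightarrow> x \<in> U \<Longrightarrow> s \<in> E x \<Longrightarrow> t \<in> E x \<Longrightarrow>
          \<phi> x (a \<cdot> s + b \<cdot> t) = a *s \<phi> x s + b *s \<phi> x t"
    and triv_compatible: "\<And>U \<phi> V \<psi> z. (U, \<phi>) \<in> \<T> \<Longrightarrow> (V, \<psi>) \<in> \<T> \<Longrightarrow>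
          smooth_map_on (U \<inter> V) (\<lambda>x. \<psi> x (inv_into (E x) (\<phi> x) z))"
begin

definition smooth_section_on :: "'m set \<Rightarrow> ('m \<Rightarrow> 'v) \<Rightarrow> bool" where
  "smooth_section_on U s \<longleftrightarrow>
     (\<forall>x\<in>U. s x \<in> E x) \<and>
     (\<forall>(V, \<phi>)\<in>\<T>. smooth_map_on (U \<inter> V) (\<lambda>x. \<phi> x (s x)))"

abbreviation smooth_section :: "('m \<Rightarrow> 'v) \<Rightarrow> bool" where
  "smooth_section \<equiv> smooth_section_on UNIV"

text \<open>
  Connections \<open>C\<^sup>\<infinity>(M;E) \<rightarrow> C\<^sup>\<infinity>(M;T\<^sup>*M \<otimes> E)\<close>, where \<open>T\<^sup>*M \<otimes> E\<close> is the bundle of real-linear maps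
  from \<open>TM\<close> to \<open>E\<close>.  Complex linearity is the Leibniz rule for constant \<open>f\<close>.
\<close>

definition connection :: "(('m \<Rightarrow> 'v) \<Rightarrow> 'm \<Rightarrow> ('m, 'n) tangent \<Rightarrow> 'v) \<Rightarrow> bool" where
  "connection nabla \<longleftrightarrow>
     (\<forall>s. smooth_section s \<longrightarrow>
        (\<forall>x. \<forall>v\<in>tangent_space x. nabla s x v \<in> E x) \<and>
        (\<forall>x. \<forall>v\<in>tangent_space x. \<forall>w\<in>tangent_space x. nabla s x (tadd v w) = nabla s x v + nabla s x w) \<and>
        (\<forall>x a. \<forall>v\<in>tangent_space x. nabla s x (tscale a v) = complex_of_real a \<cdot> nabla s x v) \<and>
        (\<forall>U X. open U \<and> smooth_vector_field_on U X \<longrightarrow> smooth_section_on U (\<lambda>x. nabla s x (X x)))) \<and>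
     (\<forall>s t. smooth_section s \<and> smooth_section t \<longrightarrow>
        (\<forall>x. \<forall>v\<in>tangent_space x. nabla (\<lambda>y. s y + t y) x v = nabla s x v + nabla t x v)) \<and>
     (\<forall>(f :: 'm \<Rightarrow> complex) s. smooth_map_on UNIV f \<and> smooth_section s \<longrightarrow>
        (\<forall>\<kappa>\<in>\<A>. \<forall>x\<in>chart_dom \<kappa>. \<forall>v\<in>tangent_space x.
           nabla (\<lambda>y. f y \<cdot> s y) x v = differential \<kappa> f x v \<cdot> s x + f x \<cdot> nabla s x v))"

end


section \<open>Hermitian bundles of Clifford modules and operators of Dirac type\<close>

locale clifford_module_bundle =
  riemannian_manifold \<A> g + complex_vector_bundle \<A> scaleC E \<T>
  for \<A> :: "('m::{t2_space, second_countable_topology}, 'n::finite) chart set"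
    and g :: "'m \<Rightarrow> ('m, 'n) tangent \<Rightarrow> ('m, 'n) tangent \<Rightarrow> real"
    and scaleC :: "complex \<Rightarrow> 'v::ab_group_add \<Rightarrow> 'v"  (infixr \<open>\<cdot>\<close> 75)
    and E :: "'m \<Rightarrow> 'v set"
    and \<T> :: "('m, 'v, 'r::finite) triv set" +
  fixes c :: "'m \<Rightarrow> (('m, 'n) tangent list \<Rightarrow> real) set \<Rightarrow> 'v \<Rightarrow> 'v"
    and herm :: "'m \<Rightarrow> 'v \<Rightarrow> 'v \<Rightarrow> complex"
    \<comment> \<open>\<open>c x\<close> is a unital representation of the real algebra \<open>Cl x\<close> by complex-linear maps of \<open>E x\<close>\<close>
  assumes clifford_closed: "\<And>x \<xi> s. \<xi> \<in> carrier (Cl x) \<Longrightarrow> s \<in> E x \<Longrightarrow> c x \<xi> s \<in> E x"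
    and clifford_linear: "\<And>x \<xi> a b s t. \<xi> \<in> carrier (Cl x) \<Longrightarrow> s \<in> E x \<Longrightarrow> t \<in> E x \<Longrightarrow>
          c x \<xi> (a \<cdot> s + b \<cdot> t) = a \<cdot> c x \<xi> s + b \<cdot> c x \<xi> t"
    and clifford_add: "\<And>x \<xi> \<eta> s. \<xi> \<in> carrier (Cl x) \<Longrightarrow> \<eta> \<in> carrier (Cl x) \<Longrightarrow> s \<in> E x \<Longrightarrow>
          c x (\<xi> \<oplus>\<^bsub>Cl x\<^esub> \<eta>) s = c x \<xi> s + c x \<eta> s"
    and clifford_mult: "\<And>x \<xi> \<eta> s. \<xi> \<in> carrier (Cl x) \<Longrightarrow> \<eta> \<in> carrier (Cl x) \<Longrightarrow> s \<in> E x \<Longrightarrow>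
          c x (\<xi> \<otimes>\<^bsub>Cl x\<^esub> \<eta>) s = c x \<xi> (c x \<eta> s)"
    and clifford_scalar: "\<And>x a s. s \<in> E x \<Longrightarrow> c x (Cl_product x a []) s = complex_of_real a \<cdot> s"
    \<comment> \<open>products of smooth vector fields span the smooth sections of the Clifford bundle locally,
        so this is smoothness of \<open>c\<close> as a bundle map\<close>
    and clifford_smooth: "\<And>U Xs s. open U \<Longrightarrow> \<forall>X\<in>set Xs. smooth_vector_field_on U X \<Longrightarrow>
          smooth_section_on U s \<Longrightarrow>
          smooth_section_on U (\<lambda>x. c x (Cl_product x 1 (map (\<lambda>X. X x) Xs)) (s x))"
    and herm_linear: "\<And>x a b s t z. s \<in> E x \<Longrightarrow> t \<in> E x \<Longrightarrow> z \<in> E x \<Longrightarrow>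
          herm x (a \<cdot> s + b \<cdot> t) z = a * herm x s z + b * herm x t z"
    and herm_sym: "\<And>x s t. s \<in> E x \<Longrightarrow> t \<in> E x \<Longrightarrow> herm x t s = cnj (herm x s t)"
    and herm_pos: "\<And>x s. s \<in> E x \<Longrightarrow> s \<noteq> 0 \<Longrightarrow> Re (herm x s s) > 0"
    and herm_smooth: "\<And>U s t. open U \<Longrightarrow> smooth_section_on U s \<Longrightarrow> smooth_section_on U t \<Longrightarrow>
          smooth_map_on U (\<lambda>x. herm x (s x) (t x))"
    and clifford_skew: "\<And>x v s t. v \<in> tangent_space x \<Longrightarrow> s \<in> E x \<Longrightarrow> t \<in> E x \<Longrightarrow>
          herm x (c x (Cl_product x 1 [v]) s) t = - herm x s (c x (Cl_product x 1 [v]) t)"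
begin

definition fibre_norm :: "'m \<Rightarrow> 'v \<Rightarrow> real" where
  "fibre_norm x s = sqrt (Re (herm x s s))"

text \<open>
  \<open>D = c \<circ> nabla\<close>, with \<open>TM\<close> and \<open>T\<^sup>*M\<close> identified by the metric, in terms of orthonormal frames.  Every tangent space has one, and the sum does not
  depend on it, so \<open>D\<close> is determined by \<open>nabla\<close> on smooth sections.
\<close>

definition dirac_type :: "(('m \<Rightarrow> 'v) \<Rightarrow> 'm \<Rightarrow> 'v) \<Rightarrow> bool" where
  "dirac_type D \<longleftrightarrow>
     (\<exists>nabla. connection nabla \<and>
        (\<forall>s. smooth_section s \<longrightarrow>
           (\<forall>x e. orthonormal_frame_at x e \<longrightarrow>
              D s x = (\<Sum>j\<in>UNIV. c x (Cl_product x 1 [e j]) (nabla s x (e j))))))"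

definition admissible_perturbation :: "(('m \<Rightarrow> 'v) \<Rightarrow> 'm \<Rightarrow> 'v) \<Rightarrow> bool" where
  "admissible_perturbation \<PP> \<longleftrightarrow>
     (\<forall>s. smooth_section s \<longrightarrow>
        (\<forall>x. \<PP> s x \<in> E x) \<and>
        (\<exists>P :: 'm \<Rightarrow> real.
           (\<forall>x. P x \<ge> 0) \<and>
           (\<forall>x. \<exists>U. open U \<and> x \<in> U \<and> bounded (P ` U)) \<and>
           (\<forall>x. fibre_norm x (\<PP> s x) \<le> P x * fibre_norm x (s x))))"

end

end

theory Submission
  imports Defs
begin

text \<open>
  The zero set of \<open>u\<close> has an interior \<open>Z\<close>, and the theorem says that \<open>Z\<close> is closed: a connected
  component that meets \<open>Z\<close> then lies in \<open>Z\<close>. Closedness is a local question. In a chart and a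
  trivialization, the equation \<open>D u = - \<PP>(u)\<close> and the local boundedness of \<open>P\<close> turn into a
  differential inequality \<open>|\<Sum>\<^sub>j A\<^sub>j \<partial>\<^sub>j u| \<le> L |u|\<close> whose matrices satisfy the Clifford relations
  \<open>A\<^sub>j A\<^sub>k + A\<^sub>k A\<^sub>j = - 2 \<gamma>\<^sub>j\<^sub>k\<close>, with \<open>\<gamma>\<close> the inverse metric, and are skew for the fibre metric.
  All terms of order zero, those of the connection and the perturbation, are absorbed into \<open>L\<close>
  (\<open>dirac_inequality\<close>).

  The inequality is then treated in a ball of \<open>\<real>\<^sup>n\<close> around a point \<open>q\<close> near which \<open>u\<close> vanishes. The
  radius of the ball of zeros can always be enlarged (\<open>zero_ball_enlarge\<close>), so it fills the whole
  chart ball (\<open>unique_continuation_ball\<close>). The enlargement rests on a Carleman estimate: for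
  \<open>\<psi> = - |x - q|\<^sup>2 / 2\<close>, on a thin shell where \<open>0 \<le> \<psi> - s\<^sub>0 \<le> \<epsilon>\<close>, and for large \<open>\<tau>\<close>,
  \<open>c \<tau> \<integral> e\<^sup>2\<^sup>\<tau>\<^sup>\<Phi> |w|\<^sup>2 \<le> \<integral> e\<^sup>2\<^sup>\<tau>\<^sup>\<Phi> |\<Sum>\<^sub>j A\<^sub>j \<partial>\<^sub>j w|\<^sup>2\<close> with \<open>\<Phi> = (\<psi> - s\<^sub>0)\<^sup>2 / 2\<close>
  (\<open>carleman_estimate\<close>). Applied to a truncation \<open>w\<close> of \<open>u\<close>, the factor \<open>\<tau>\<close> beats \<open>L\<close>, and the error
  made by the truncation carries a smaller exponential weight than the next shell, on which \<open>u\<close>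
  is therefore zero.

  The Carleman estimate itself is an integration by parts. Put \<open>v = e\<^sup>\<tau>\<^sup>\<Phi> w\<close> and multiply the
  operator by the Clifford element \<open>d\<psi>\<close> divided by \<open>|d\<psi>|\<^sup>2\<close>. By the Clifford relations the result is
  \<open>- Y v + B v + \<tau> (\<psi> - s\<^sub>0) v\<close>, where \<open>Y\<close> is a real vector field with \<open>Y \<psi> = 1\<close> and \<open>B\<close> is tangential to the
  level sets of \<open>\<psi>\<close> with skew coefficients. Expanding the square, the mixed term of \<open>Y\<close> with
  \<open>\<tau> (\<psi> - s\<^sub>0)\<close> yields \<open>\<tau> |v|\<^sup>2\<close> because the derivative of \<open>\<psi> - s\<^sub>0\<close> along \<open>Y\<close> is 1; this is the gain. The
  mixed term of \<open>Y\<close> and \<open>B\<close> is antisymmetric in the two derivatives, hence of size \<open>|v| |\<nabla>v|\<close> after one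
  integration by parts (\<open>antisymmetric_form_null\<close>). The gradient is controlled by the same mechanism:
  \<open>|\<Sum>\<^sub>j A\<^sub>j \<partial>\<^sub>j v|\<^sup>2\<close> equals \<open>\<gamma>\<close> applied to the gradient up to an antisymmetric form (\<open>symb_norm\<close>).
\<close>

section \<open>Calculus of smooth functions on Euclidean spaces\<close>

lemma Ck_on_cong:
  assumes "open S" "\<And>x. x \<in> S \<Longrightarrow> f x = g x"
  shows "Ck_on k S f \<longleftrightarrow> Ck_on k S g"
proof -
  have "Ck_on k S g" if "Ck_on k S f" "\<And>x. x \<in> S \<Longrightarrow> f x = g x" for f g :: "'a \<Rightarrow> 'b"
    using that
  proof (induction k arbitrary: f g)
    case 0
    then show ?case by (auto cong: continuous_on_cong)
  next
    case (Suc k)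
    have der: "(g has_derivative frechet_derivative f (at x)) (at x)" if "x \<in> S" for x
      using Suc.prems that assms(1)
      by (auto intro!: has_derivative_transform_within_open[of f _ _ _ S g] simp: frechet_derivative_works)
    then have "frechet_derivative g (at x) = frechet_derivative f (at x)" if "x \<in> S" for x
      using frechet_derivative_at[OF der[OF that]] by simp
    with Suc.IH Suc.prems have "Ck_on k S (\<lambda>x. frechet_derivative g (at x) v)" for v
      by (metis (no_types, lifting) Ck_on.simps(2))
    with der show ?case by (auto simp: differentiable_def)
  qed
  with assms show ?thesis by metis
qed

text \<open>
  The derivative of \<open>Ck_on\<close> is \<open>frechet_derivative\<close>, a definite description; on an open set any
  function that is proved to be a derivative may replace it.
\<close>

lemma Ck_on_SucI:
  assumes "open S" "\<And>x. x \<in> S \<Longrightarrow> (f has_derivative f' x) (at x)" "\<And>v. Ck_on k S (\<lambda>x. f' x v)"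
  shows "Ck_on (Suc k) S f"
proof -
  have "f' x = frechet_derivative f (at x)" if "x \<in> S" for x
    using frechet_derivative_at[OF assms(2)[OF that]] .
  then have "Ck_on k S (\<lambda>x. frechet_derivative f (at x) v)" for v
    using assms(3)[of v] by (subst (asm) Ck_on_cong[OF assms(1)]) auto
  then show ?thesis using assms(2) by (auto simp: differentiable_def)
qed

lemma Ck_on_has_derivative:
  assumes "Ck_on (Suc k) S f" "x \<in> S"
  shows "(f has_derivative frechet_derivative f (at x)) (at x)"
  using assms by (auto simp: frechet_derivative_works)

lemma Ck_on_subset: "Ck_on k S f \<Longrightarrow> T \<subseteq> S \<Longrightarrow> Ck_on k T f"
  by (induction k arbitrary: f) (auto intro: continuous_on_subset)

lemma Ck_on_SucD: "Ck_on (Suc k) S f \<Longrightarrow> Ck_on k S f"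
  by (induction k arbitrary: f)
     (auto intro!: continuous_at_imp_continuous_on differentiable_imp_continuous_within)

lemma Ck_on_mono: "Ck_on k S f \<Longrightarrow> j \<le> k \<Longrightarrow> Ck_on j S f"
  by (induction k) (auto simp: le_Suc_eq intro: Ck_on_SucD simp del: Ck_on.simps(2))

lemma Ck_on_continuous: "Ck_on k S f \<Longrightarrow> continuous_on S f"
  using Ck_on_mono[of k S f 0] by simp

lemma continuous_bounded_above:
  fixes f :: "'a::topological_space \<Rightarrow> real"
  assumes "compact K" "continuous_on K f"
  shows "\<exists>B. \<forall>x\<in>K. f x \<le> B"
proof -
  have "bdd_above (f ` K)"
    by (intro bounded_imp_bdd_above compact_imp_bounded compact_continuous_image assms)
  then show ?thesis unfolding bdd_above_def by blast
qed

lemma Ck_on_local: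
  assumes "\<And>x. x \<in> S \<Longrightarrow> \<exists>T. open T \<and> x \<in> T \<and> Ck_on k T f"
  shows "Ck_on k S f"
  using assms
proof (induction k arbitrary: f)
  case 0
  have "continuous (at x) f" if "x \<in> S" for x
    using 0[OF that] by (auto simp: continuous_on_eq_continuous_at)
  then show ?case by (simp add: continuous_at_imp_continuous_on)
next
  case (Suc k)
  show ?case
    unfolding Ck_on.simps
  proof (intro conjI ballI allI)
    show "f differentiable (at x)" if "x \<in> S" for x using Suc.prems[OF that] by auto
    show "Ck_on k S (\<lambda>x. frechet_derivative f (at x) v)" for v
      by (rule Suc.IH) (metis Suc.prems Ck_on.simps(2))
  qed
qed

lemma Ck_on_Un:
  assumes "open S" "open T" "Ck_on k S f" "Ck_on k T f"
  shows "Ck_on k (S \<union> T) f"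
  by (rule Ck_on_local) (use assms in blast)

lemma Ck_on_const [simp]: "Ck_on k S (\<lambda>x. c)"
  by (induction k arbitrary: c) auto

lemma Ck_on_linear:
  assumes "open S" "bounded_linear f"
  shows "Ck_on k S f"
proof (cases k)
  case 0
  then show ?thesis using assms(2) by (simp add: linear_continuous_on)
next
  case (Suc j)
  show ?thesis unfolding Suc
    by (rule Ck_on_SucI[OF assms(1) bounded_linear_imp_has_derivative[OF assms(2)]]) simp
qed

lemma Ck_on_bounded_linear:
  assumes "open S" "bounded_linear L" "Ck_on k S f"
  shows "Ck_on k S (\<lambda>x. L (f x))"
  using assms(3)
proof (induction k arbitrary: f)
  case 0
  then show ?case using bounded_linear.continuous_on[OF assms(2)] by simp
next
  case (Suc k)
  show ?case
  proof (rule Ck_on_SucI[OF assms(1)])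
    show "((\<lambda>x. L (f x)) has_derivative (\<lambda>v. L (frechet_derivative f (at x) v))) (at x)" if "x \<in> S" for x
      by (rule bounded_linear.has_derivative[OF assms(2) Ck_on_has_derivative[OF Suc.prems that]])
  qed (use Suc in auto)
qed

lemma Ck_on_add:
  assumes "open S" "Ck_on k S f" "Ck_on k S g"
  shows "Ck_on k S (\<lambda>x. f x + g x)"
  using assms(2,3)
proof (induction k arbitrary: f g)
  case 0
  then show ?case by (auto intro: continuous_on_add)
next
  case (Suc k)
  show ?case
    by (rule Ck_on_SucI[OF assms(1)],
        rule has_derivative_add[OF Ck_on_has_derivative[OF Suc.prems(1)] Ck_on_has_derivative[OF Suc.prems(2)]])
       (use Suc in auto)
qed

lemma Ck_on_sum:
  assumes "open S" "\<And>i. i \<in> I \<Longrightarrow> Ck_on k S (f i)"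
  shows "Ck_on k S (\<lambda>x. \<Sum>i\<in>I. f i x)"
  using assms(2) by (induction I rule: infinite_finite_induct) (auto intro: Ck_on_add[OF assms(1)])

lemma Ck_on_bilinear:
  assumes "open S" "bounded_bilinear pr" "Ck_on k S f" "Ck_on k S g"
  shows "Ck_on k S (\<lambda>x. pr (f x) (g x))"
  using assms(3,4)
proof (induction k arbitrary: f g)
  case 0
  then show ?case using bounded_bilinear.continuous_on[OF assms(2)] by simp
next
  case (Suc k)
  show ?case
  proof (rule Ck_on_SucI[OF assms(1)])
    show "((\<lambda>x. pr (f x) (g x)) has_derivative
       (\<lambda>v. pr (f x) (frechet_derivative g (at x) v) + pr (frechet_derivative f (at x) v) (g x))) (at x)"
      if "x \<in> S" for x
      by (rule bounded_bilinear.FDERIV[OF assms(2) Ck_on_has_derivative[OF Suc.prems(1) that]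
             Ck_on_has_derivative[OF Suc.prems(2) that]])
    show "Ck_on k S (\<lambda>x. pr (f x) (frechet_derivative g (at x) v) + pr (frechet_derivative f (at x) v) (g x))" for v
      using Suc Ck_on_SucD[OF Suc.prems(1)] Ck_on_SucD[OF Suc.prems(2)]
      by (auto intro!: Ck_on_add[OF assms(1)])
  qed
qed

lemmas Ck_on_scaleR = Ck_on_bilinear[OF _ bounded_bilinear_scaleR]
lemmas Ck_on_mult = Ck_on_bilinear[OF _ bounded_bilinear_mult]
lemmas Ck_on_inner = Ck_on_bilinear[OF _ bounded_bilinear_inner]

lemma Ck_on_minus: "open S \<Longrightarrow> Ck_on k S f \<Longrightarrow> Ck_on k S (\<lambda>x. - f x)"
  by (rule Ck_on_bounded_linear) (auto intro: bounded_linear_minus)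

lemma Ck_on_diff:
  "open S \<Longrightarrow> Ck_on k S f \<Longrightarrow> Ck_on k S g \<Longrightarrow> Ck_on k S (\<lambda>x. f x - g x)"
  using Ck_on_add[of S k f "\<lambda>x. - g x"] Ck_on_minus by auto

lemma Ck_on_prod:
  fixes f :: "'i \<Rightarrow> 'a::euclidean_space \<Rightarrow> real"
  assumes "open S" "\<And>i. i \<in> I \<Longrightarrow> Ck_on k S (f i)"
  shows "Ck_on k S (\<lambda>x. \<Prod>i\<in>I. f i x)"
  using assms(2) by (induction I rule: infinite_finite_induct) (auto intro: Ck_on_mult[OF assms(1)])

text \<open>
  The directional derivatives of \<open>f\<close> at \<open>g x\<close> are known only for fixed directions, so the moving
  direction \<open>g' v\<close> is expanded in the basis before the induction hypothesis applies.
\<close>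

lemma Ck_on_compose:
  fixes f :: "'b::euclidean_space \<Rightarrow> 'c::real_normed_vector" and g :: "'a::euclidean_space \<Rightarrow> 'b"
  assumes "open S" "open T" "Ck_on k T f" "Ck_on k S g" "g ` S \<subseteq> T"
  shows "Ck_on k S (\<lambda>x. f (g x))"
  using assms(3,4)
proof (induction k arbitrary: f)
  case 0
  then show ?case using assms(5) by (auto intro: continuous_on_compose2)
next
  case (Suc k)
  let ?f' = "\<lambda>y. frechet_derivative f (at y)" and ?g' = "\<lambda>x. frechet_derivative g (at x)"
  show ?case
  proof (rule Ck_on_SucI[OF assms(1)])
    fix x assume x: "x \<in> S"
    have f: "(f has_derivative ?f' (g x)) (at (g x))"
      using Ck_on_has_derivative[OF Suc.prems(1)] x assms(5) by blast
    then interpret f: bounded_linear "?f' (g x)" by (rule has_derivative_bounded_linear)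
    have "?f' (g x) (?g' x v) = (\<Sum>b\<in>Basis. (?g' x v \<bullet> b) *\<^sub>R ?f' (g x) b)" for v
      by (subst euclidean_representation[symmetric, of "?g' x v"]) (simp add: f.sum f.scaleR)
    then show "((\<lambda>x. f (g x)) has_derivative (\<lambda>v. \<Sum>b\<in>Basis. (?g' x v \<bullet> b) *\<^sub>R ?f' (g x) b)) (at x)"
      using has_derivative_compose[OF Ck_on_has_derivative[OF Suc.prems(2) x] f] by simp
  next
    show "Ck_on k S (\<lambda>x. \<Sum>b\<in>Basis. (?g' x v \<bullet> b) *\<^sub>R ?f' (g x) b)" for v
    proof (intro Ck_on_sum Ck_on_scaleR Ck_on_inner assms(1) Ck_on_const)
      show "Ck_on k S (\<lambda>x. ?g' x v)" using Suc.prems(2) by simp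
      show "Ck_on k S (\<lambda>x. ?f' (g x) b)" for b
        using Suc.IH[of "\<lambda>y. ?f' y b"] Suc.prems Ck_on_SucD[OF Suc.prems(2)] by simp
    qed
  qed
qed

lemma Ck_on_real_fun_chain:
  fixes f f' :: "real \<Rightarrow> real"
  assumes "open S" "\<And>x. x \<in> S \<Longrightarrow> (f has_real_derivative f' x) (at x)" "Ck_on k S f'"
  shows "Ck_on (Suc k) S f"
proof (rule Ck_on_SucI[OF assms(1)])
  show "(f has_derivative (\<lambda>v. f' x * v)) (at x)" if "x \<in> S" for x
    using assms(2)[OF that] by (simp add: has_field_derivative_def)
  show "Ck_on k S (\<lambda>x. f' x * v)" for v
    by (intro Ck_on_mult assms Ck_on_const)
qed

lemma Ck_on_exp: "Ck_on k UNIV (exp :: real \<Rightarrow> real)"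
proof (induction k)
  case (Suc k)
  show ?case by (rule Ck_on_real_fun_chain[OF _ _ Suc]) (auto intro: DERIV_exp)
qed (simp add: continuous_on_exp)

lemma Ck_on_inverse: "Ck_on k (- {0}) (inverse :: real \<Rightarrow> real)"
proof (induction k)
  case 0
  then show ?case by (auto intro!: continuous_on_inverse)
next
  case (Suc k)
  have o: "open (- {0::real})" by auto
  show ?case
    by (rule Ck_on_real_fun_chain[OF o DERIV_inverse Ck_on_minus[OF o]])
       (auto simp: numeral_2_eq_2 intro!: Ck_on_mult o Suc)
qed

lemma Ck_on_real_inverse:
  fixes f :: "'a::euclidean_space \<Rightarrow> real"
  assumes "open S" "Ck_on k S f" "\<And>x. x \<in> S \<Longrightarrow> f x \<noteq> 0"
  shows "Ck_on k S (\<lambda>x. inverse (f x))"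
  by (rule Ck_on_compose[OF assms(1) _ Ck_on_inverse assms(2)]) (use assms in auto)

lemma Ck_on_real_divide:
  fixes f g :: "'a::euclidean_space \<Rightarrow> real"
  assumes "open S" "Ck_on k S f" "Ck_on k S g" "\<And>x. x \<in> S \<Longrightarrow> g x \<noteq> 0"
  shows "Ck_on k S (\<lambda>x. f x / g x)"
  unfolding divide_inverse by (intro Ck_on_mult Ck_on_real_inverse assms)

text \<open>
  An operator-valued map is as regular as its values on a basis, because it is the linear
  combination of the finitely many rank-one operators built from these values.
\<close>

lemma Ck_on_blinfun:
  fixes F :: "'a::euclidean_space \<Rightarrow> 'b::euclidean_space \<Rightarrow>\<^sub>L 'c::real_normed_vector"
  assumes "open S" "\<And>b. b \<in> Basis \<Longrightarrow> Ck_on k S (\<lambda>x. F x b)"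
  shows "Ck_on k S F"
proof -
  define T where "T b c = Blinfun (\<lambda>y. (y \<bullet> b) *\<^sub>R c)" for b :: 'b and c :: 'c
  have T: "blinfun_apply (T b c) y = (y \<bullet> b) *\<^sub>R c" for b c y
    unfolding T_def by (subst bounded_linear_Blinfun_apply) (auto intro: bounded_linear_intros)
  have lin: "bounded_linear (T b)" for b
  proof (rule bounded_linear_intro[where K = "norm b"])
    show "norm (T b c) \<le> norm c * norm b" for c
    proof (rule norm_blinfun_bound)
      show "norm (T b c y) \<le> norm c * norm b * norm y" for y
        using mult_right_mono[OF Cauchy_Schwarz_ineq2[of y b] norm_ge_zero[of c]]
        by (simp add: T ac_simps)
    qed simp
  qed (auto intro!: blinfun_eqI simp: T blinfun.bilinear_simps scaleR_add_right)
  have "F x = (\<Sum>b\<in>Basis. T b (F x b))" for x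
  proof (rule blinfun_eqI)
    fix y
    show "F x y = (\<Sum>b\<in>Basis. T b (F x b)) y"
      by (subst euclidean_representation[symmetric, of y])
         (simp add: blinfun.bilinear_simps T blinfun.sum_left)
  qed
  then have F: "F = (\<lambda>x. \<Sum>b\<in>Basis. T b (F x b))" by auto
  show ?thesis
    by (subst F) (intro Ck_on_sum Ck_on_bounded_linear[OF _ lin] assms)
qed

text \<open>
  The functions \<open>t\<^sup>-\<^sup>n exp (- 1 / t)\<close>, extended by zero to \<open>t \<le> 0\<close>. The family is closed under
  derivatives up to linear combinations, and each member is \<open>O(t\<^sup>2)\<close> at the origin, so all of
  them are smooth; the member \<open>n = 0\<close> supplies all cutoff functions below.
\<close>

definition flat_fun :: "nat \<Rightarrow> real \<Rightarrow> real" where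
  "flat_fun n t = (if t > 0 then exp (- inverse t) * inverse t ^ n else 0)"

lemma flat_fun_bound:
  assumes "t > 0"
  shows "flat_fun n t \<le> fact (n + 2) * t ^ 2"
proof -
  define y where "y = inverse t"
  have y: "y > 0" using assms by (simp add: y_def)
  have e: "exp y \<ge> y ^ (n + 2) / fact (n + 2)"
  proof -
    have "(\<Sum>i\<in>{n+2}. y ^ i /\<^sub>R fact i) \<le> exp y"
      unfolding exp_def using y summable_exp_generic[of y]
      by (intro sum_le_suminf) auto
    then show ?thesis by (simp add: field_simps)
  qed
  have "y ^ (n + 2) \<le> fact (n + 2) * exp y"
    using e by (subst (asm) pos_divide_le_eq) (simp_all add: mult.commute del: fact_Suc)
  then have "exp (- y) * y ^ n * y ^ 2 \<le> fact (n + 2)"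
    by (simp add: exp_minus divide_simps power_add power2_eq_square ac_simps del: fact_Suc)
  then show ?thesis using assms
    by (simp add: flat_fun_def y_def field_simps)
qed

lemma flat_fun_nonneg: "flat_fun n t \<ge> 0"
  by (simp add: flat_fun_def)

lemma flat_fun_deriv:
  "(flat_fun n has_real_derivative flat_fun (n + 2) t - n * flat_fun (n + 1) t) (at t)"
proof -
  consider "t > 0" | "t < 0" | "t = 0" by linarith
  then show ?thesis
  proof cases
    case 1
    have "((\<lambda>t. exp (- inverse t) * inverse t ^ n) has_real_derivative
            flat_fun (n + 2) t - n * flat_fun (n + 1) t) (at t)"
      using 1 by (auto intro!: derivative_eq_intros simp: flat_fun_def power2_eq_square power_add field_simps)
         (cases n; simp add: field_simps)+
    then show ?thesis
      by (rule has_field_derivative_transform_within_open[where S = "{0<..}"])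
         (use 1 in \<open>auto simp: flat_fun_def\<close>)
  next
    case 2
    have "((\<lambda>t. 0) has_real_derivative flat_fun (n + 2) t - n * flat_fun (n + 1) t) (at t)"
      using 2 by (auto simp: flat_fun_def)
    then show ?thesis
      by (rule has_field_derivative_transform_within_open[where S = "{..<0}"])
         (use 2 in \<open>auto simp: flat_fun_def\<close>)
  next
    case 3
    have "((\<lambda>h. flat_fun n h / h) \<longlongrightarrow> 0) (at 0)"
    proof (rule Lim_null_comparison)
      show "((\<lambda>h. fact (n + 2) * \<bar>h\<bar>) \<longlongrightarrow> 0) (at (0::real))"
        by (auto intro!: tendsto_eq_intros)
      have "norm (flat_fun n h / h) \<le> fact (n + 2) * \<bar>h\<bar>" if "h \<noteq> 0" for h
      proof (cases "h > 0")
        case True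
        with flat_fun_bound[OF True, of n] flat_fun_nonneg[of n h] show ?thesis
          by (simp add: field_simps power2_eq_square)
      qed (simp add: flat_fun_def mult_nonneg_nonpos del: fact_Suc)
      then show "\<forall>\<^sub>F h in at 0. norm (flat_fun n h / h) \<le> fact (n + 2) * \<bar>h\<bar>"
        by (auto simp: eventually_at_filter)
    qed
    then show ?thesis using 3 by (simp add: DERIV_def flat_fun_def)
  qed
qed

lemma Ck_on_flat_fun: "Ck_on k UNIV (flat_fun n)"
proof (induction k arbitrary: n)
  case 0
  have "continuous (at t) (flat_fun n)" for t
    by (rule DERIV_isCont[OF flat_fun_deriv])
  then show ?case by (simp add: continuous_at_imp_continuous_on)
next
  case (Suc k)
  show ?case
    by (rule Ck_on_real_fun_chain[OF _ flat_fun_deriv]) (auto intro!: Ck_on_diff Ck_on_mult Suc)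
qed

section \<open>Integration by parts\<close>

abbreviation pd :: "('a::euclidean_space \<Rightarrow> 'b::real_normed_vector) \<Rightarrow> 'a \<Rightarrow> 'a \<Rightarrow> 'b" where
  "pd f j x \<equiv> frechet_derivative f (at x) j"

lemma Ck_on_pd: "Ck_on (Suc k) S f \<Longrightarrow> Ck_on k S (pd f j)"
  by simp

lemma pd_eqI: "(f has_derivative f') (at x) \<Longrightarrow> pd f j x = f' j"
  using frechet_derivative_at by metis

lemma has_real_derivative_along_line:
  fixes f :: "'a::real_normed_vector \<Rightarrow> real"
  assumes "(f has_derivative f') (at (x + t *\<^sub>R j))"
  shows "((\<lambda>t. f (x + t *\<^sub>R j)) has_real_derivative f' j) (at t)"
proof -
  interpret bounded_linear f' using assms by (rule has_derivative_bounded_linear)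
  have "((\<lambda>t. x + t *\<^sub>R j) has_derivative (\<lambda>t. t *\<^sub>R j)) (at t)"
    by (auto intro!: derivative_eq_intros)
  from has_derivative_compose[OF this assms]
  show ?thesis by (simp add: scaleR has_field_derivative_def mult_commute_abs)
qed

text \<open>
  The mean value theorem, first in direction \<open>j\<close> and then in direction \<open>k\<close>.
\<close>

lemma second_difference:
  fixes f :: "'a::euclidean_space \<Rightarrow> real"
  assumes f: "Ck_on 2 UNIV f" and h: "h > 0"
  shows "\<exists>y. norm (y - x) \<le> h * (norm j + norm k) \<and>
    f (x + h *\<^sub>R j + h *\<^sub>R k) - f (x + h *\<^sub>R j) - f (x + h *\<^sub>R k) + f x = h * h * pd (pd f j) k y"
proof -
  have f2: "Ck_on (Suc (Suc 0)) UNIV f" using f by (simp add: numeral_2_eq_2)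
  have d1: "(f has_derivative frechet_derivative f (at y)) (at y)" for y
    by (rule Ck_on_has_derivative[OF f2]) simp
  have d2: "(pd f j has_derivative frechet_derivative (pd f j) (at y)) (at y)" for y
    by (rule Ck_on_has_derivative[OF Ck_on_pd[OF f2]]) simp
  let ?p = "\<lambda>s. f ((x + h *\<^sub>R k) + s *\<^sub>R j) - f (x + s *\<^sub>R j)"
  have "\<exists>s. 0 < s \<and> s < h \<and> ?p h - ?p 0 = (h - 0) *
          (pd f j ((x + h *\<^sub>R k) + s *\<^sub>R j) - pd f j (x + s *\<^sub>R j))"
    by (rule MVT2[OF h]) (intro DERIV_diff has_real_derivative_along_line d1)
  then obtain s where s: "0 < s" "s < h" and
    e1: "?p h - ?p 0 = h * (pd f j ((x + h *\<^sub>R k) + s *\<^sub>R j) - pd f j (x + s *\<^sub>R j))" by auto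
  let ?q = "\<lambda>t. pd f j ((x + s *\<^sub>R j) + t *\<^sub>R k)"
  have "\<exists>t. 0 < t \<and> t < h \<and> ?q h - ?q 0 = (h - 0) * pd (pd f j) k ((x + s *\<^sub>R j) + t *\<^sub>R k)"
    by (rule MVT2[OF h]) (intro has_real_derivative_along_line d2)
  then obtain t where t: "0 < t" "t < h" and
    e2: "?q h - ?q 0 = h * pd (pd f j) k ((x + s *\<^sub>R j) + t *\<^sub>R k)" by auto
  have "norm (s *\<^sub>R j + t *\<^sub>R k) \<le> s * norm j + t * norm k"
    using norm_triangle_ineq[of "s *\<^sub>R j" "t *\<^sub>R k"] s t by simp
  also have "\<dots> \<le> h * (norm j + norm k)"
    using s t by (simp add: distrib_left add_mono mult_right_mono)
  finally show ?thesis using e1 e2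
    by (intro exI[of _ "(x + s *\<^sub>R j) + t *\<^sub>R k"]) (simp add: algebra_simps)
qed

text \<open>
  Both mixed derivatives are the limit of the same second difference quotient.
\<close>

lemma pd_commute_real:
  fixes f :: "'a::euclidean_space \<Rightarrow> real"
  assumes f: "Ck_on 2 UNIV f"
  shows "pd (pd f j) k x = pd (pd f k) j x"
proof (rule ccontr)
  assume ne: "pd (pd f j) k x \<noteq> pd (pd f k) j x"
  define e where "e = \<bar>pd (pd f j) k x - pd (pd f k) j x\<bar> / 2"
  have e: "e > 0" using ne by (simp add: e_def)
  have "Ck_on 0 UNIV (pd (pd f j) k)" for j k
    using f by (simp add: numeral_2_eq_2)
  then have c: "isCont (pd (pd f j) k) x" for j k
    by (simp add: continuous_on_eq_continuous_at)
  obtain d1 where d1: "d1 > 0" "\<And>y. norm (y - x) < d1 \<Longrightarrow> \<bar>pd (pd f j) k y - pd (pd f j) k x\<bar> < e"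
    using c[of j k] e unfolding continuous_at_eps_delta dist_norm by (metis real_norm_def)
  obtain d2 where d2: "d2 > 0" "\<And>y. norm (y - x) < d2 \<Longrightarrow> \<bar>pd (pd f k) j y - pd (pd f k) j x\<bar> < e"
    using c[of k j] e unfolding continuous_at_eps_delta dist_norm by (metis real_norm_def)
  define h where "h = min d1 d2 / (2 * (norm j + norm k + 1))"
  have h: "h > 0" using d1 d2 unfolding h_def by (auto intro!: divide_pos_pos add_nonneg_pos)
  have "h * (norm j + norm k) \<le> h * (norm j + norm k + 1)" using h by simp
  also have "\<dots> = min d1 d2 / 2"
  proof -
    have "m > 0 \<Longrightarrow> a / (2 * m) * m = a / 2" for m a :: real by (simp add: field_simps)
    from this[of "norm j + norm k + 1"] show ?thesis unfolding h_def by (simp only: add_nonneg_pos norm_ge_zero add_nonneg_nonneg zero_less_one)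
  qed
  finally have hd: "h * (norm j + norm k) < d1" "h * (norm k + norm j) < d2" using d1 d2
    by (auto simp: min_def add.commute split: if_splits)
  obtain y where y: "norm (y - x) \<le> h * (norm j + norm k)" and
    ey: "f (x + h *\<^sub>R j + h *\<^sub>R k) - f (x + h *\<^sub>R j) - f (x + h *\<^sub>R k) + f x = h * h * pd (pd f j) k y"
    using second_difference[OF f h, of x j k] by blast
  obtain z where z: "norm (z - x) \<le> h * (norm k + norm j)" and
    ez: "f (x + h *\<^sub>R k + h *\<^sub>R j) - f (x + h *\<^sub>R k) - f (x + h *\<^sub>R j) + f x = h * h * pd (pd f k) j z"
    using second_difference[OF f h, of x k j] by blast
  have "h * h * pd (pd f j) k y = h * h * pd (pd f k) j z"
    using ey ez by (simp add: algebra_simps)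
  then have "pd (pd f j) k y = pd (pd f k) j z" using h by simp
  moreover have "\<bar>pd (pd f j) k y - pd (pd f j) k x\<bar> < e" using d1(2) y hd by simp
  moreover have "\<bar>pd (pd f k) j z - pd (pd f k) j x\<bar> < e" using d2(2) z hd by simp
  ultimately show False unfolding e_def by argo
qed

lemma pd_commute:
  fixes f :: "'a::euclidean_space \<Rightarrow> 'b::euclidean_space"
  assumes f: "Ck_on 2 UNIV f"
  shows "pd (pd f j) k x = pd (pd f k) j x"
proof (rule euclidean_eqI)
  fix b :: 'b
  have f2: "Ck_on (Suc (Suc 0)) UNIV f" using f by (simp add: numeral_2_eq_2)
  have p: "pd (\<lambda>x. g x \<bullet> b) j y = pd g j y \<bullet> b" if "Ck_on (Suc n) UNIV g" for g :: "'a \<Rightarrow> 'b" and n j y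
    by (rule pd_eqI) (rule bounded_linear.has_derivative[OF bounded_linear_inner_left
        Ck_on_has_derivative[OF that]], simp)
  have "pd (pd f j) k x \<bullet> b = pd (\<lambda>y. pd f j y \<bullet> b) k x" for j k
    by (rule p[OF Ck_on_pd[OF f2], symmetric])
  also have "(\<lambda>y. pd f j y \<bullet> b) = pd (\<lambda>y. f y \<bullet> b) j" for j
    by (rule ext) (rule p[OF f2, symmetric])
  finally have "pd (pd f j) k x \<bullet> b = pd (pd (\<lambda>y. f y \<bullet> b) j) k x" for j k .
  then show "pd (pd f j) k x \<bullet> b = pd (pd f k) j x \<bullet> b"
    using pd_commute_real[of "\<lambda>y. f y \<bullet> b" j x k] f by (simp add: Ck_on_inner)
qed

lemma Ck_on_extend_zero:
  assumes "open \<Omega>" "compact K" "K \<subseteq> \<Omega>" "Ck_on k \<Omega> f" "\<And>x. x \<notin> K \<Longrightarrow> f x = 0"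
  shows "Ck_on k UNIV f"
proof -
  have o: "open (- K)" using assms(2) by (simp add: compact_imp_closed open_Compl)
  have "Ck_on k (- K) f"
    by (subst Ck_on_cong[OF o, where g = "\<lambda>_. 0"]) (use assms(5) in auto)
  from Ck_on_Un[OF assms(1) o assms(4) this] assms(3) show ?thesis
    by (metis Compl_partition Un_mono sup.absorb_iff2 sup_commute top_greatest Compl_subset_Compl_iff sup_top_right Un_upper2 compl_le_swap1 top.extremum_unique)
qed

lemma pd_zero_outside:
  assumes "closed K" "\<And>x. x \<notin> K \<Longrightarrow> f x = 0" "x \<notin> K"
  shows "pd f j x = 0"
proof -
  have "(f has_derivative (\<lambda>_. 0)) (at x)"
    by (rule has_derivative_transform_within_open[of "\<lambda>_. 0" _ _ _ "- K"]) (use assms in auto)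
  then show ?thesis by (rule pd_eqI)
qed

lemma integrable_compact_support:
  fixes f :: "'a::euclidean_space \<Rightarrow> real"
  assumes "compact K" "continuous_on K f" "\<And>x. x \<notin> K \<Longrightarrow> f x = 0"
  shows "integrable lborel f"
proof -
  have "f = (\<lambda>x. indicator K x *\<^sub>R f x)" using assms(3) by (force simp: indicator_def)
  with borel_integrable_compact[OF assms(1,2)] show ?thesis by simp
qed

text \<open>
  Translation invariance of Lebesgue measure makes the integral of every difference quotient
  vanish, and dominated convergence passes to the limit.
\<close>

lemma integral_pd_zero:
  fixes f :: "'a::euclidean_space \<Rightarrow> real"
  assumes "Ck_on (Suc 0) UNIV f" "compact K" "\<And>x. x \<notin> K \<Longrightarrow> f x = 0"
  shows "has_bochner_integral lborel (pd f j) 0"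
proof -
  have f: "(f has_derivative frechet_derivative f (at x)) (at x)" for x
    by (rule Ck_on_has_derivative[OF assms(1)]) simp
  have cf: "continuous_on UNIV f" and cp: "continuous_on UNIV (pd f j)"
    using assms(1) Ck_on_continuous by (blast, simp)
  have mf [measurable]: "f \<in> borel_measurable borel" "pd f j \<in> borel_measurable borel"
    using cf cp by (auto intro: borel_measurable_continuous_onI)
  have i: "integrable lborel f" "integrable lborel (pd f j)"
    using pd_zero_outside[OF compact_imp_closed[OF assms(2)] assms(3)] assms(3)
    by (auto intro!: integrable_compact_support[OF assms(2)] continuous_on_subset[OF cf] continuous_on_subset[OF cp])
  have "bounded (pd f j ` K)"
    using assms(2) cp by (meson compact_continuous_image compact_imp_bounded continuous_on_subset subset_UNIV)
  then obtain B where B0: "\<And>x. x \<in> K \<Longrightarrow> \<bar>pd f j x\<bar> \<le> B" by (auto simp: bounded_iff)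
  have B: "\<bar>pd f j x\<bar> \<le> max B 0" for x
    using B0[of x] pd_zero_outside[where x = x and j = j, OF compact_imp_closed[OF assms(2)] assms(3)]
    by (cases "x \<in> K") auto
  define h where "h n = inverse (real (Suc n))" for n
  have h: "0 < h n" "h n \<le> 1" for n by (auto simp: h_def field_simps)
  define q where "q n x = (f (h n *\<^sub>R j + x) - f x) / h n" for n x
  obtain R where R: "\<And>x. x \<in> K \<Longrightarrow> norm x \<le> R" using compact_imp_bounded[OF assms(2)] by (auto simp: bounded_iff)
  let ?C = "cball (0::'a) (R + norm j)"
  \<comment> \<open>Both bounds are uniform in \<open>n\<close>: the mean value theorem gives the height, the steps \<open>h n \<le> 1\<close> the support.\<close>
  have qb: "\<bar>q n x\<bar> \<le> max B 0 * indicator ?C x" for n x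
  proof (cases "x \<in> ?C")
    case True
    have "\<exists>s. 0 < s \<and> s < h n \<and> f (x + h n *\<^sub>R j) - f (x + 0 *\<^sub>R j) = (h n - 0) * pd f j (x + s *\<^sub>R j)"
      by (rule MVT2[OF h(1)]) (rule has_real_derivative_along_line[OF f])
    then obtain s where "f (x + h n *\<^sub>R j) - f x = h n * pd f j (x + s *\<^sub>R j)" by auto
    then have "q n x = pd f j (x + s *\<^sub>R j)" using h(1)[of n] by (simp add: q_def add.commute)
    then show ?thesis using B True by simp
  next
    case False
    then have n: "norm x > R + norm j" by simp
    have "norm (h n *\<^sub>R j + x) \<ge> norm x - norm (h n *\<^sub>R j)"
      by (metis add.commute norm_diff_ineq)
    moreover have "norm (h n *\<^sub>R j) \<le> norm j" using h[of n] by (simp add: mult_left_le_one_le)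
    ultimately have "x \<notin> K \<and> h n *\<^sub>R j + x \<notin> K"
      using n R[of x] R[of "h n *\<^sub>R j + x"] norm_ge_zero[of j] by argo
    then show ?thesis using False assms(3) by (simp add: q_def)
  qed
  have "(\<lambda>n. integral\<^sup>L lborel (q n)) \<longlonglongrightarrow> integral\<^sup>L lborel (pd f j)"
  proof (rule integral_dominated_convergence[where w = "\<lambda>x. max B 0 * indicator ?C x"])
    show "integrable lborel (\<lambda>x. max B 0 * indicator ?C x)"
      using emeasure_lborel_cball_finite by (intro integrable_mult_right integrable_real_indicator) auto
    show "AE x in lborel. (\<lambda>n. q n x) \<longlonglongrightarrow> pd f j x"
    proof (rule AE_I2)
      fix x
      have "((\<lambda>t. f (x + t *\<^sub>R j)) has_real_derivative pd f j x) (at 0)"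
        by (rule has_real_derivative_along_line) (simp add: f)
      then have "((\<lambda>t. (f (x + t *\<^sub>R j) - f x) / t) \<longlongrightarrow> pd f j x) (at 0)"
        by (simp add: DERIV_def)
      moreover have "filterlim h (at 0) sequentially"
        unfolding h_def filterlim_at using LIMSEQ_inverse_real_of_nat by auto
      ultimately have "(\<lambda>n. (f (x + h n *\<^sub>R j) - f x) / h n) \<longlonglongrightarrow> pd f j x"
        by (rule filterlim_compose)
      then show "(\<lambda>n. q n x) \<longlonglongrightarrow> pd f j x" by (simp add: q_def add.commute)
    qed
  qed (use qb in \<open>auto simp: q_def[abs_def]\<close>)
  moreover have "integral\<^sup>L lborel (q n) = 0" for n
  proof -
    have d: "distr lborel borel ((+) (h n *\<^sub>R j)) = (lborel :: 'a measure)" by (rule lborel_distr_plus)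
    have "integrable (distr lborel borel ((+) (h n *\<^sub>R j))) f" using i(1) by (simp only: d)
    then have 1: "integrable lborel (\<lambda>x. f (h n *\<^sub>R j + x))" by (simp add: integrable_distr_eq)
    have "integral\<^sup>L lborel f = integral\<^sup>L (distr lborel borel ((+) (h n *\<^sub>R j))) f" by (simp only: d)
    also have "\<dots> = integral\<^sup>L lborel (\<lambda>x. f (h n *\<^sub>R j + x))" by (simp add: integral_distr)
    finally show ?thesis using 1 i(1) by (simp add: q_def[abs_def])
  qed
  ultimately have "integral\<^sup>L lborel (pd f j) = 0" by (simp add: LIMSEQ_const_iff)
  with i(2) show ?thesis by (simp add: has_bochner_integral_iff)
qed

text \<open>
  A first order quadratic form with coefficients antisymmetric in the two derivatives is, up to
  a divergence, of lower order: the second derivatives produced by the product rule are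
  symmetric and cancel.
\<close>

lemma antisymmetric_form_null:
  fixes v :: "'a::euclidean_space \<Rightarrow> 'b::euclidean_space" and M :: "'a \<Rightarrow> 'a \<Rightarrow> 'a \<Rightarrow> 'b \<Rightarrow>\<^sub>L 'b"
  assumes v: "Ck_on 2 UNIV v" and K: "compact K" "K \<subseteq> \<Omega>" "open \<Omega>" "\<And>x. x \<notin> K \<Longrightarrow> v x = 0"
    and M: "\<And>j k. j \<in> Basis \<Longrightarrow> k \<in> Basis \<Longrightarrow> Ck_on (Suc 0) \<Omega> (M j k)"
    and anti: "\<And>j k x. x \<in> \<Omega> \<Longrightarrow> j \<in> Basis \<Longrightarrow> k \<in> Basis \<Longrightarrow> M j k x = - M k j x"
  shows "has_bochner_integral lborel (\<lambda>x. \<Sum>j\<in>Basis. \<Sum>k\<in>Basis.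
     M j k x (pd v j x) \<bullet> pd v k x + pd (M j k) j x (v x) \<bullet> pd v k x) 0"
proof -
  have v2: "Ck_on (Suc (Suc 0)) UNIV v" using v by (simp add: numeral_2_eq_2)
  have v1: "Ck_on (Suc 0) \<Omega> v" "Ck_on (Suc 0) \<Omega> (pd v k)" for k
    using v2 Ck_on_subset Ck_on_SucD by (blast, metis Ck_on_pd Ck_on_subset subset_UNIV)
  define F where "F j x = (\<Sum>k\<in>Basis. M j k x (v x) \<bullet> pd v k x)" for j x
  have F0: "F j x = 0" if "x \<notin> K" for j x using K(4)[OF that] by (simp add: F_def)
  have CF: "Ck_on (Suc 0) \<Omega> (F j)" if "j \<in> Basis" for j
    unfolding F_def[abs_def]
    by (intro Ck_on_sum Ck_on_inner K(3) Ck_on_bilinear[OF _ bounded_bilinear_blinfun_apply] v1 M that)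
  have "has_bochner_integral lborel (pd (F j) j) 0" if "j \<in> Basis" for j
    by (rule integral_pd_zero[OF Ck_on_extend_zero[OF K(3,1,2) CF[OF that]] K(1)]) (simp_all add: F0)
  from has_bochner_integral_sum[of Basis lborel "\<lambda>j. pd (F j) j", OF this]
  have "has_bochner_integral lborel (\<lambda>x. \<Sum>j\<in>Basis. pd (F j) j x) 0" by simp
  moreover have "(\<Sum>j\<in>Basis. pd (F j) j x) = (\<Sum>j\<in>Basis. \<Sum>k\<in>Basis.
     M j k x (pd v j x) \<bullet> pd v k x + pd (M j k) j x (v x) \<bullet> pd v k x)" (is "?l = ?r") for x
  proof (cases "x \<in> K")
    case True
    then have x: "x \<in> \<Omega>" using K by auto
    have pF: "pd (F j) j x = (\<Sum>k\<in>Basis. M j k x (v x) \<bullet> pd (pd v k) j x +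
        (M j k x (pd v j x) + pd (M j k) j x (v x)) \<bullet> pd v k x)" if j: "j \<in> Basis" for j
    proof -
      have "(F j has_derivative (\<lambda>j'. \<Sum>k\<in>Basis. M j k x (v x) \<bullet> pd (pd v k) j' x +
          (M j k x (pd v j' x) + pd (M j k) j' x (v x)) \<bullet> pd v k x)) (at x)"
        unfolding F_def[abs_def]
        by (intro has_derivative_sum bounded_bilinear.FDERIV[OF bounded_bilinear_inner]
            bounded_bilinear.FDERIV[OF bounded_bilinear_blinfun_apply]
            Ck_on_has_derivative[OF v1(1) x] Ck_on_has_derivative[OF v1(2) x] Ck_on_has_derivative[OF M[OF j] x])
      from pd_eqI[OF this, where j = j] show ?thesis .
    qed
    \<comment> \<open>The terms with second derivatives cancel in pairs, by symmetry of the Hessian.\<close>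
    let ?T = "\<Sum>j\<in>Basis. \<Sum>k\<in>Basis. M j k x (v x) \<bullet> pd (pd v k) j x"
    have "?T = (\<Sum>k\<in>Basis. \<Sum>j\<in>Basis. M j k x (v x) \<bullet> pd (pd v k) j x)" by (rule sum.swap)
    also have "\<dots> = (\<Sum>k\<in>Basis. \<Sum>j\<in>Basis. - (M k j x (v x) \<bullet> pd (pd v j) k x))"
      by (intro sum.cong refl) (subst anti[OF x], simp_all add: blinfun.minus_left pd_commute[OF v])
    also have "\<dots> = - ?T" by (simp add: sum_negf)
    finally have T: "?T = 0" by simp
    have "?l = (\<Sum>j\<in>Basis. \<Sum>k\<in>Basis. M j k x (v x) \<bullet> pd (pd v k) j x +
        (M j k x (pd v j x) + pd (M j k) j x (v x)) \<bullet> pd v k x)"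
      by (intro sum.cong refl pF)
    also have "\<dots> = ?T + ?r" by (simp add: sum.distrib inner_add_left algebra_simps)
    finally show ?thesis using T by simp
  next
    case False
    then show ?thesis
      using pd_zero_outside[OF compact_imp_closed[OF K(1)] F0] pd_zero_outside[OF compact_imp_closed[OF K(1)] K(4)] K(4)
      by simp
  qed
  ultimately show ?thesis by simp
qed

text \<open>
  The divergence of the field with components \<open>M j v \<bullet> v\<close>: a derivative hitting \<open>v\<close> may be traded
  for one hitting the coefficients.
\<close>

lemma transport_form_null:
  fixes v :: "'a::euclidean_space \<Rightarrow> 'b::euclidean_space" and M :: "'a \<Rightarrow> 'a \<Rightarrow> 'b \<Rightarrow>\<^sub>L 'b"
  assumes v: "Ck_on (Suc 0) UNIV v" and K: "compact K" "K \<subseteq> \<Omega>" "open \<Omega>" "\<And>x. x \<notin> K \<Longrightarrow> v x = 0"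
    and M: "\<And>j. j \<in> Basis \<Longrightarrow> Ck_on (Suc 0) \<Omega> (M j)"
  shows "has_bochner_integral lborel (\<lambda>x. \<Sum>j\<in>Basis.
     M j x (v x) \<bullet> pd v j x + M j x (pd v j x) \<bullet> v x + pd (M j) j x (v x) \<bullet> v x) 0"
proof -
  have v1: "Ck_on (Suc 0) \<Omega> v" using v Ck_on_subset by blast
  define F where "F j x = M j x (v x) \<bullet> v x" for j x
  have F0: "F j x = 0" if "x \<notin> K" for j x using K(4)[OF that] by (simp add: F_def)
  have CF: "Ck_on (Suc 0) \<Omega> (F j)" if "j \<in> Basis" for j
    unfolding F_def[abs_def]
    by (intro Ck_on_inner K(3) Ck_on_bilinear[OF _ bounded_bilinear_blinfun_apply] v1 M that)
  have "has_bochner_integral lborel (pd (F j) j) 0" if "j \<in> Basis" for j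
    by (rule integral_pd_zero[OF Ck_on_extend_zero[OF K(3,1,2) CF[OF that]] K(1)]) (simp_all add: F0)
  from has_bochner_integral_sum[of Basis lborel "\<lambda>j. pd (F j) j", OF this]
  have "has_bochner_integral lborel (\<lambda>x. \<Sum>j\<in>Basis. pd (F j) j x) 0" by simp
  moreover have "pd (F j) j x =
     M j x (v x) \<bullet> pd v j x + M j x (pd v j x) \<bullet> v x + pd (M j) j x (v x) \<bullet> v x" if j: "j \<in> Basis" for j x
  proof (cases "x \<in> K")
    case True
    then have x: "x \<in> \<Omega>" using K by auto
    have "(F j has_derivative (\<lambda>j'. M j x (v x) \<bullet> pd v j' x + (M j x (pd v j' x) + pd (M j) j' x (v x)) \<bullet> v x)) (at x)"
      unfolding F_def[abs_def]
        by (intro bounded_bilinear.FDERIV[OF bounded_bilinear_inner]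
            bounded_bilinear.FDERIV[OF bounded_bilinear_blinfun_apply]
            Ck_on_has_derivative[OF v1 x] Ck_on_has_derivative[OF M[OF j] x])
    from pd_eqI[OF this, where j = j] show ?thesis by (simp add: inner_add_left)
  next
    case False
    then show ?thesis
      using pd_zero_outside[OF compact_imp_closed[OF K(1)] F0] K(4) by simp
  qed
  ultimately show ?thesis by simp
qed

section \<open>The Carleman estimate\<close>

text \<open>
  A first order operator \<open>\<Sum>\<^sub>j A\<^sub>j \<partial>\<^sub>j\<close> on an open set with coefficients subject to the Clifford relations.
  The indices \<open>j\<close>, \<open>k\<close> run through the standard basis; \<open>H x\<close> represents the fibre metric
  \<open>h\<^sub>x(a, b) = H x a \<bullet> b\<close>, and \<open>\<gamma>\<close> the cotangent metric. Keeping \<open>H\<close> variable replaces the choice of an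
  orthonormal frame of the bundle. The values \<open>w j\<close> in \<open>elliptic\<close> stand for the partial derivatives
  of a section at one point.
\<close>

locale clifford_symbol =
  fixes \<Omega> :: "'a::euclidean_space set"
    and A :: "'a \<Rightarrow> 'a \<Rightarrow> 'b::euclidean_space \<Rightarrow>\<^sub>L 'b"
    and H :: "'a \<Rightarrow> 'b \<Rightarrow>\<^sub>L 'b"
    and \<gamma> :: "'a \<Rightarrow> 'a \<Rightarrow> 'a \<Rightarrow> real"
    and c0 :: real
  assumes open_dom: "open \<Omega>"
    and A_C1: "\<And>j. j \<in> Basis \<Longrightarrow> Ck_on (Suc 0) \<Omega> (A j)"
    and H_C1: "Ck_on (Suc 0) \<Omega> H"
    and \<gamma>_C1: "\<And>j k. j \<in> Basis \<Longrightarrow> k \<in> Basis \<Longrightarrow> Ck_on (Suc 0) \<Omega> (\<gamma> j k)"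
    and \<gamma>_sym: "\<And>j k x. x \<in> \<Omega> \<Longrightarrow> j \<in> Basis \<Longrightarrow> k \<in> Basis \<Longrightarrow> \<gamma> j k x = \<gamma> k j x"
    and clifford: "\<And>j k x a. x \<in> \<Omega> \<Longrightarrow> j \<in> Basis \<Longrightarrow> k \<in> Basis \<Longrightarrow>
          A j x (A k x a) + A k x (A j x a) = (- 2 * \<gamma> j k x) *\<^sub>R a"
    and H_sym: "\<And>x a b. x \<in> \<Omega> \<Longrightarrow> H x a \<bullet> b = H x b \<bullet> a"
    and skew: "\<And>j x a b. x \<in> \<Omega> \<Longrightarrow> j \<in> Basis \<Longrightarrow> H x (A j x a) \<bullet> b = - (H x a \<bullet> A j x b)"
    and c0_pos: "c0 > 0"
    and H_pos: "\<And>x a. x \<in> \<Omega> \<Longrightarrow> H x a \<bullet> a \<ge> c0 * (norm a)\<^sup>2"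
    and elliptic: "\<And>x w. x \<in> \<Omega> \<Longrightarrow>
          (\<Sum>j\<in>Basis. \<Sum>k\<in>Basis. \<gamma> j k x * (H x (w j) \<bullet> w k)) \<ge> c0 * (\<Sum>j\<in>Basis. (norm (w j))\<^sup>2)"
begin

definition symb :: "'a \<Rightarrow> ('a \<Rightarrow> 'b) \<Rightarrow> 'b" where
  "symb x w = (\<Sum>j\<in>Basis. A j x (w j))"

end

locale carleman_weight = clifford_symbol \<Omega> A H \<gamma> c0
  for \<Omega> :: "'a::euclidean_space set" and A :: "'a \<Rightarrow> 'a \<Rightarrow> 'b::euclidean_space \<Rightarrow>\<^sub>L 'b" and H \<gamma> c0 +
  fixes \<psi> :: "'a \<Rightarrow> real"
  assumes \<psi>_C2: "Ck_on (Suc (Suc 0)) \<Omega> \<psi>"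
    and \<psi>_noncritical: "\<And>x. x \<in> \<Omega> \<Longrightarrow> \<exists>j\<in>Basis. pd \<psi> j x \<noteq> 0"
begin

text \<open>
  Clifford multiplication by \<open>d\<psi>\<close> (\<open>nrm\<close>), the square length of \<open>d\<psi>\<close> (\<open>\<rho>\<close>), and the decomposition
  \<open>nrm A\<^sub>j = \<rho> (Kc\<^sub>j - yc\<^sub>j)\<close> into a commutator, which is skew, and an anticommutator, which is scalar:
  \<open>yc\<close> is the gradient of \<open>\<psi>\<close> divided by its square length.
\<close>

definition nrm :: "'a \<Rightarrow> 'b \<Rightarrow>\<^sub>L 'b" where
  "nrm x = (\<Sum>k\<in>Basis. pd \<psi> k x *\<^sub>R A k x)"

definition \<rho> :: "'a \<Rightarrow> real" where
  "\<rho> x = (\<Sum>j\<in>Basis. \<Sum>k\<in>Basis. \<gamma> j k x * (pd \<psi> j x * pd \<psi> k x))"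

definition yc :: "'a \<Rightarrow> 'a \<Rightarrow> real" where
  "yc j x = (\<Sum>k\<in>Basis. \<gamma> j k x * pd \<psi> k x) / \<rho> x"

definition Kc :: "'a \<Rightarrow> 'a \<Rightarrow> 'b \<Rightarrow>\<^sub>L 'b" where
  "Kc j x = (1 / (2 * \<rho> x)) *\<^sub>R ((nrm x o\<^sub>L A j x) - (A j x o\<^sub>L nrm x))"

definition Yop :: "'a \<Rightarrow> ('a \<Rightarrow> 'b) \<Rightarrow> 'b" where
  "Yop x w = (\<Sum>j\<in>Basis. yc j x *\<^sub>R w j)"

definition Bop :: "'a \<Rightarrow> ('a \<Rightarrow> 'b) \<Rightarrow> 'b" where
  "Bop x w = (\<Sum>j\<in>Basis. Kc j x (w j))"

lemma nrm_apply: "nrm x a = (\<Sum>k\<in>Basis. pd \<psi> k x *\<^sub>R A k x a)"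
  by (simp add: nrm_def blinfun.sum_left blinfun.scaleR_left)

text \<open>
  Ellipticity, tested on the multiples \<open>\<partial>\<^sub>j\<psi> b\<close> of one vector \<open>b\<close>.
\<close>

lemma \<rho>_pos: assumes x: "x \<in> \<Omega>" shows "\<rho> x > 0"
proof -
  obtain b :: 'b where b: "b \<in> Basis" using nonempty_Basis by blast
  obtain i where i: "i \<in> Basis" "pd \<psi> i x \<noteq> 0" using \<psi>_noncritical[OF x] by blast
  have "0 < (\<Sum>j\<in>Basis. (pd \<psi> j x)\<^sup>2)"
    using i by (intro sum_pos2[of _ i]) auto
  then have "0 < c0 * (\<Sum>j\<in>Basis. (norm (pd \<psi> j x *\<^sub>R b))\<^sup>2)"
    using c0_pos b by simp
  also have "\<dots> \<le> (\<Sum>j\<in>Basis. \<Sum>k\<in>Basis. \<gamma> j k x * (H x (pd \<psi> j x *\<^sub>R b) \<bullet> (pd \<psi> k x *\<^sub>R b)))"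
    by (rule elliptic[OF x])
  also have "\<dots> = \<rho> x * (H x b \<bullet> b)"
    by (simp add: \<rho>_def sum_distrib_right sum_distrib_left blinfun.scaleR_right mult_ac)
  finally show ?thesis using H_pos[OF x, of b] c0_pos b
    by (auto simp: zero_less_mult_iff)
qed

lemma nrm_anticommute:
  assumes x: "x \<in> \<Omega>" and j: "j \<in> Basis"
  shows "nrm x (A j x a) + A j x (nrm x a) = (- 2 * \<rho> x * yc j x) *\<^sub>R a"
proof -
  have "nrm x (A j x a) + A j x (nrm x a) =
      (\<Sum>k\<in>Basis. pd \<psi> k x *\<^sub>R (A j x (A k x a) + A k x (A j x a)))"
    by (simp add: nrm_apply blinfun.sum_right blinfun.scaleR_right sum.distrib scaleR_add_right add.commute)
  also have "\<dots> = (\<Sum>k\<in>Basis. (- 2 * (\<gamma> j k x * pd \<psi> k x)) *\<^sub>R a)"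
    by (intro sum.cong refl) (simp add: clifford[OF x j] mult_ac)
  also have "\<dots> = (- 2 * (\<Sum>k\<in>Basis. \<gamma> j k x * pd \<psi> k x)) *\<^sub>R a"
    by (simp add: sum_distrib_left scaleR_left.sum)
  finally show ?thesis using \<rho>_pos[OF x] by (simp add: yc_def)
qed

text \<open>
  The vector field \<open>Yop\<close> differentiates \<open>\<psi>\<close> to 1. This normalization is what makes the Carleman
  weight produce exactly one factor \<open>\<tau>\<close>.
\<close>

lemma yc_normalized: assumes x: "x \<in> \<Omega>" shows "(\<Sum>j\<in>Basis. pd \<psi> j x * yc j x) = 1"
proof -
  have "(\<Sum>j\<in>Basis. pd \<psi> j x * yc j x) = (\<Sum>j\<in>Basis. pd \<psi> j x * (\<Sum>k\<in>Basis. \<gamma> j k x * pd \<psi> k x)) / \<rho> x"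
    unfolding yc_def by (simp flip: sum_divide_distrib)
  also have "(\<Sum>j\<in>Basis. pd \<psi> j x * (\<Sum>k\<in>Basis. \<gamma> j k x * pd \<psi> k x)) = \<rho> x"
    unfolding \<rho>_def by (simp add: sum_distrib_left mult_ac)
  finally have "(\<Sum>j\<in>Basis. pd \<psi> j x * yc j x) = \<rho> x / \<rho> x" .
  then show ?thesis using \<rho>_pos[OF x] by simp
qed

lemma nrm_nrm: "(\<Sum>j\<in>Basis. pd \<psi> j x *\<^sub>R nrm x (A j x a)) = nrm x (nrm x a)"
proof -
  have "nrm x (nrm x a) = nrm x (\<Sum>j\<in>Basis. pd \<psi> j x *\<^sub>R A j x a)"
    by (simp only: nrm_apply[of x a])
  then show ?thesis by (simp add: blinfun.sum_right blinfun.scaleR_right)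
qed

lemma nrm_square: assumes x: "x \<in> \<Omega>" shows "nrm x (nrm x a) = - \<rho> x *\<^sub>R a"
proof -
  have "2 *\<^sub>R nrm x (nrm x a) = (\<Sum>j\<in>Basis. pd \<psi> j x *\<^sub>R (nrm x (A j x a) + A j x (nrm x a)))"
    by (simp add: sum.distrib scaleR_add_right nrm_nrm scaleR_2 flip: nrm_apply)
  also have "\<dots> = (\<Sum>j\<in>Basis. (- 2 * \<rho> x * (pd \<psi> j x * yc j x)) *\<^sub>R a)"
    by (intro sum.cong refl) (simp add: nrm_anticommute[OF x] mult_ac)
  also have "\<dots> = (- 2 * \<rho> x * (\<Sum>j\<in>Basis. pd \<psi> j x * yc j x)) *\<^sub>R a"
    by (simp add: sum_distrib_left scaleR_left.sum)
  finally have "2 *\<^sub>R nrm x (nrm x a) = 2 *\<^sub>R (- \<rho> x *\<^sub>R a)"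
    by (simp add: yc_normalized[OF x])
  then show ?thesis by (metis scaleR_cancel_left zero_neq_numeral)
qed

lemma nrm_A: 
  assumes x: "x \<in> \<Omega>" and j: "j \<in> Basis"
  shows "nrm x (A j x a) = \<rho> x *\<^sub>R (Kc j x a - yc j x *\<^sub>R a)"
proof -
  have "\<rho> x *\<^sub>R Kc j x a = (1/2) *\<^sub>R (nrm x (A j x a) - A j x (nrm x a))"
    using \<rho>_pos[OF x] by (simp add: Kc_def blinfun.scaleR_left blinfun.diff_left)
  moreover have "(\<rho> x * yc j x) *\<^sub>R a = - ((1/2) *\<^sub>R (nrm x (A j x a) + A j x (nrm x a)))"
    by (simp add: nrm_anticommute[OF x j, of a])
  moreover have "(1/2) *\<^sub>R (p - q) + (1/2) *\<^sub>R (p + q) = p" for p q :: 'b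
    by (simp flip: scaleR_add_right)
  moreover have "\<rho> x *\<^sub>R (Kc j x a - yc j x *\<^sub>R a) = \<rho> x *\<^sub>R Kc j x a - (\<rho> x * yc j x) *\<^sub>R a"
    by (simp add: scaleR_diff_right)
  ultimately show ?thesis by (simp only: diff_minus_eq_add)
qed

lemma nrm_skew: assumes x: "x \<in> \<Omega>" shows "H x (nrm x a) \<bullet> b = - (H x a \<bullet> nrm x b)"
  by (simp add: nrm_apply blinfun.sum_right blinfun.scaleR_right inner_sum_left inner_sum_right
      skew[OF x] sum_negf)

lemma Kc_skew:
  assumes x: "x \<in> \<Omega>" and j: "j \<in> Basis"
  shows "H x (Kc j x a) \<bullet> b = - (H x a \<bullet> Kc j x b)"
  by (simp add: Kc_def blinfun.scaleR_left blinfun.diff_left blinfun.scaleR_right blinfun.diff_right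
      inner_diff_left inner_diff_right skew[OF x j] nrm_skew[OF x] algebra_simps)

lemma nrm_isometry:
  assumes x: "x \<in> \<Omega>" shows "H x (nrm x a) \<bullet> nrm x b = \<rho> x * (H x a \<bullet> b)"
  using nrm_skew[OF x, of a "nrm x b"] nrm_square[OF x] by simp

lemma nrm_symb:
  assumes x: "x \<in> \<Omega>" shows "nrm x (symb x w) = \<rho> x *\<^sub>R (Bop x w - Yop x w)"
  by (simp add: symb_def Bop_def Yop_def blinfun.sum_right nrm_A[OF x] scaleR_sum_right
      scaleR_diff_right sum_subtractf)

text \<open>
  Clifford multiplication by \<open>d\<psi>\<close> is an isometry up to the factor \<open>\<rho>\<close> and turns the symbol into
  \<open>\<rho> (Bop - Yop)\<close>, so the conjugated operator may be measured in this split form. The scalar \<open>t\<close> is the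
  contribution of the weight.
\<close>

lemma conjugated_norm:
  fixes w :: "'a \<Rightarrow> 'b" and a :: 'b and t :: real
  assumes x: "x \<in> \<Omega>"
  defines "W \<equiv> Bop x w - Yop x w + t *\<^sub>R a"
  shows "H x W \<bullet> W = (H x (symb x w - t *\<^sub>R nrm x a) \<bullet> (symb x w - t *\<^sub>R nrm x a)) / \<rho> x"
proof -
  let ?X = "symb x w - t *\<^sub>R nrm x a"
  have "nrm x ?X = \<rho> x *\<^sub>R W"
    by (simp add: blinfun.diff_right blinfun.scaleR_right nrm_symb[OF x] nrm_square[OF x] W_def algebra_simps)
  then have "\<rho> x * (\<rho> x * (H x W \<bullet> W)) = \<rho> x * (H x ?X \<bullet> ?X)"
    using nrm_isometry[OF x, of ?X ?X] by (simp add: blinfun.scaleR_right)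
  then show ?thesis using \<rho>_pos[OF x] by (simp add: field_simps)
qed

text \<open>
  The coefficients of the three quadratic forms to be integrated by parts: the mixed term of
  \<open>Yop\<close> and \<open>Bop\<close>, the commutator part of the square of the symbol, and the mixed term of \<open>Yop\<close> with
  a scalar.
\<close>

definition M1 :: "'a \<Rightarrow> 'a \<Rightarrow> 'a \<Rightarrow> 'b \<Rightarrow>\<^sub>L 'b" where
  "M1 j k x = H x o\<^sub>L (yc k x *\<^sub>R Kc j x - yc j x *\<^sub>R Kc k x)"

definition M2 :: "'a \<Rightarrow> 'a \<Rightarrow> 'a \<Rightarrow> 'b \<Rightarrow>\<^sub>L 'b" where
  "M2 j k x = inverse (\<rho> x) *\<^sub>R (H x o\<^sub>L ((A k x o\<^sub>L A j x) - (A j x o\<^sub>L A k x)))"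

definition M3 :: "'a \<Rightarrow> 'a \<Rightarrow> 'b \<Rightarrow>\<^sub>L 'b" where
  "M3 j x = yc j x *\<^sub>R H x"

lemma M1_anti: "M1 j k x = - M1 k j x"
  by (rule blinfun_eqI) (simp add: M1_def blinfun.bilinear_simps)

lemma M2_anti: "M2 j k x = - M2 k j x"
  by (rule blinfun_eqI) (simp add: M2_def blinfun.bilinear_simps algebra_simps)

text \<open>
  Skewness of \<open>Kc\<close> makes the mixed term antisymmetric in the two derivatives, so that
  \<open>antisymmetric_form_null\<close> reduces it to lower order.
\<close>

lemma cross_term:
  assumes x: "x \<in> \<Omega>"
  shows "2 * (H x (Yop x w) \<bullet> Bop x w) = (\<Sum>j\<in>Basis. \<Sum>k\<in>Basis. M1 j k x (w j) \<bullet> w k)"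
proof -
  let ?S = "\<Sum>j\<in>Basis. \<Sum>k\<in>Basis. yc k x * (H x (Kc j x (w j)) \<bullet> w k)"
  have 1: "H x (Yop x w) \<bullet> Bop x w = ?S"
    by (subst H_sym[OF x]) (simp add: Yop_def Bop_def blinfun.sum_right inner_sum_left inner_sum_right sum_distrib_left,
        rule sum.swap)
  have "(\<Sum>j\<in>Basis. \<Sum>k\<in>Basis. yc j x * (H x (Kc k x (w j)) \<bullet> w k)) =
        (\<Sum>j\<in>Basis. \<Sum>k\<in>Basis. - (yc j x * (H x (Kc k x (w k)) \<bullet> w j)))"
  proof (intro sum.cong refl)
    fix j k :: 'a assume "k \<in> Basis"
    then show "yc j x * (H x (Kc k x (w j)) \<bullet> w k) = - (yc j x * (H x (Kc k x (w k)) \<bullet> w j))"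
      using Kc_skew[OF x, of k "w j" "w k"] H_sym[OF x, of "w j" "Kc k x (w k)"] by simp
  qed
  also have "\<dots> = - ?S"
    by (subst sum.swap) (simp add: sum_negf)
  finally have 2: "(\<Sum>j\<in>Basis. \<Sum>k\<in>Basis. yc j x * (H x (Kc k x (w j)) \<bullet> w k)) = - ?S" .
  have "(\<Sum>j\<in>Basis. \<Sum>k\<in>Basis. M1 j k x (w j) \<bullet> w k) =
    ?S - (\<Sum>j\<in>Basis. \<Sum>k\<in>Basis. yc j x * (H x (Kc k x (w j)) \<bullet> w k))"
    by (simp add: M1_def blinfun.bilinear_simps inner_diff_left sum_subtractf)
  then show ?thesis using 1 2 by simp
qed

text \<open>
  The Lichnerowicz computation on the level of symbols: skewness moves \<open>A\<^sub>k\<close> to the other side, and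
  \<open>A\<^sub>k A\<^sub>j\<close> splits into its scalar part \<open>- \<gamma>\<^sub>j\<^sub>k\<close> and half a commutator, antisymmetric in \<open>j\<close> and \<open>k\<close>. With
  \<open>elliptic\<close> and an integration by parts, the symbol controls the full gradient.
\<close>

lemma symb_norm:
  assumes x: "x \<in> \<Omega>"
  shows "H x (symb x w) \<bullet> symb x w / \<rho> x =
    (\<Sum>j\<in>Basis. \<Sum>k\<in>Basis. \<gamma> j k x * (H x (w j) \<bullet> w k)) / \<rho> x -
    (\<Sum>j\<in>Basis. \<Sum>k\<in>Basis. M2 j k x (w j) \<bullet> w k) / 2"
proof -
  have "H x (A j x (w j)) \<bullet> A k x (w k) = \<gamma> j k x * (H x (w j) \<bullet> w k) -
      \<rho> x * (M2 j k x (w j) \<bullet> w k) / 2" if j: "j \<in> Basis" and k: "k \<in> Basis" for j k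
  proof -
    have "A k x (A j x (w j)) = (1/2) *\<^sub>R ((A j x (A k x (w j)) + A k x (A j x (w j))) +
       (A k x (A j x (w j)) - A j x (A k x (w j))))" by (simp flip: scaleR_2)
    also have "\<dots> = (1/2) *\<^sub>R ((- 2 * \<gamma> j k x) *\<^sub>R w j + (A k x (A j x (w j)) - A j x (A k x (w j))))"
      by (simp only: clifford[OF x j k])
    also have "\<dots> = - \<gamma> j k x *\<^sub>R w j + (1/2) *\<^sub>R (A k x (A j x (w j)) - A j x (A k x (w j)))"
      by (subst scaleR_add_right) simp
    finally have e: "A k x (A j x (w j)) = - \<gamma> j k x *\<^sub>R w j + (1/2) *\<^sub>R (A k x (A j x (w j)) - A j x (A k x (w j)))" .
    have "H x (A j x (w j)) \<bullet> A k x (w k) = - (H x (A k x (A j x (w j))) \<bullet> w k)"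
      using skew[OF x k, of "A j x (w j)" "w k"] by simp
    also have "\<dots> = \<gamma> j k x * (H x (w j) \<bullet> w k) - (1/2) * (H x (A k x (A j x (w j)) - A j x (A k x (w j))) \<bullet> w k)"
      by (subst e) (simp add: blinfun.add_right blinfun.diff_right blinfun.scaleR_right inner_add_left inner_diff_left)
    finally show ?thesis using \<rho>_pos[OF x] by (simp add: M2_def blinfun.bilinear_simps)
  qed
  then have "H x (symb x w) \<bullet> symb x w = (\<Sum>j\<in>Basis. \<Sum>k\<in>Basis. \<gamma> j k x * (H x (w j) \<bullet> w k) -
      \<rho> x * (M2 j k x (w j) \<bullet> w k) / 2)"
    by (simp add: symb_def blinfun.sum_right inner_sum_left inner_sum_right)
       (subst sum.swap, simp)
  then have "H x (symb x w) \<bullet> symb x w = (\<Sum>j\<in>Basis. \<Sum>k\<in>Basis. \<gamma> j k x * (H x (w j) \<bullet> w k)) -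
      \<rho> x * ((\<Sum>j\<in>Basis. \<Sum>k\<in>Basis. M2 j k x (w j) \<bullet> w k) / 2)"
    by (simp add: sum_subtractf sum_distrib_left sum_divide_distrib)
  then show ?thesis using \<rho>_pos[OF x] by (simp add: diff_divide_distrib)
qed

lemma three_squares:
  assumes x: "x \<in> \<Omega>"
  shows "H x (a + b + c) \<bullet> (a + b + c) \<le> 3 * (H x a \<bullet> a + H x b \<bullet> b + H x c \<bullet> c)"
proof -
  have p: "H x d \<bullet> d \<ge> 0" for d
    using H_pos[OF x, of d] c0_pos by (meson order_trans mult_nonneg_nonneg less_imp_le zero_le_power2)
  have "2 * (H x d \<bullet> e) \<le> H x d \<bullet> d + H x e \<bullet> e" for d e
    using p[of "d - e"] H_sym[OF x, of d e] by (simp add: blinfun.diff_right inner_diff_left inner_diff_right)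
  from this[of a b] this[of a c] this[of b c] show ?thesis
    using H_sym[OF x, of a b] H_sym[OF x, of a c] H_sym[OF x, of b c]
    by (simp add: blinfun.add_right inner_add_left inner_add_right)
qed

lemma pd_\<psi>_C1: "Ck_on (Suc 0) \<Omega> (pd \<psi> k)"
  by (rule Ck_on_pd[OF \<psi>_C2])

lemma \<rho>_C1: "Ck_on (Suc 0) \<Omega> \<rho>"
  unfolding \<rho>_def[abs_def] by (intro Ck_on_sum Ck_on_mult open_dom \<gamma>_C1 pd_\<psi>_C1)

lemma yc_C1: "j \<in> Basis \<Longrightarrow> Ck_on (Suc 0) \<Omega> (yc j)"
  unfolding yc_def[abs_def]
  by (intro Ck_on_sum Ck_on_mult Ck_on_real_divide open_dom \<gamma>_C1 pd_\<psi>_C1 \<rho>_C1) (use \<rho>_pos in force)+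

lemma nrm_C1: "Ck_on (Suc 0) \<Omega> nrm"
  unfolding nrm_def[abs_def] by (intro Ck_on_sum Ck_on_scaleR open_dom A_C1 pd_\<psi>_C1)

lemma Kc_C1: "j \<in> Basis \<Longrightarrow> Ck_on (Suc 0) \<Omega> (Kc j)"
  unfolding Kc_def[abs_def]
  by (intro Ck_on_scaleR Ck_on_diff Ck_on_bilinear[OF _ bounded_bilinear_blinfun_compose] Ck_on_mult
      Ck_on_const Ck_on_real_divide open_dom A_C1 nrm_C1 \<rho>_C1) (use \<rho>_pos in force)+

lemma M1_C1: "j \<in> Basis \<Longrightarrow> k \<in> Basis \<Longrightarrow> Ck_on (Suc 0) \<Omega> (M1 j k)"
  unfolding M1_def[abs_def]
  by (intro Ck_on_scaleR Ck_on_diff Ck_on_bilinear[OF _ bounded_bilinear_blinfun_compose] open_dom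
      H_C1 yc_C1 Kc_C1)

lemma M2_C1: "j \<in> Basis \<Longrightarrow> k \<in> Basis \<Longrightarrow> Ck_on (Suc 0) \<Omega> (M2 j k)"
  unfolding M2_def[abs_def]
  by (intro Ck_on_scaleR Ck_on_diff Ck_on_bilinear[OF _ bounded_bilinear_blinfun_compose] open_dom
      H_C1 Ck_on_real_inverse \<rho>_C1 A_C1) (use \<rho>_pos in force)+

lemma M3_C1: "j \<in> Basis \<Longrightarrow> Ck_on (Suc 0) \<Omega> (M3 j)"
  unfolding M3_def[abs_def] by (intro Ck_on_scaleR open_dom H_C1 yc_C1)

end

context carleman_weight
begin

text \<open>
  A single continuous majorant of everything that enters the constants of the Carleman estimate.
\<close>

definition coef_size :: "'a \<Rightarrow> real" where
  "coef_size x = \<rho> x + inverse (\<rho> x) + norm (H x) + (\<Sum>j\<in>Basis. \<Sum>k\<in>Basis. norm (pd (M1 j k) j x))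
     + (\<Sum>j\<in>Basis. \<Sum>k\<in>Basis. norm (pd (M2 j k) j x)) + (\<Sum>j\<in>Basis. norm (pd (M3 j) j x))"

lemma coef_size_bounds:
  assumes "x \<in> \<Omega>" "coef_size x \<le> C"
  shows "\<rho> x \<le> C" "inverse (\<rho> x) \<le> C" "norm (H x) \<le> C"
    "(\<Sum>j\<in>Basis. \<Sum>k\<in>Basis. norm (pd (M1 j k) j x)) \<le> C" (is "?a \<le> C")
    "(\<Sum>j\<in>Basis. \<Sum>k\<in>Basis. norm (pd (M2 j k) j x)) \<le> C" (is "?b \<le> C")
    "(\<Sum>j\<in>Basis. norm (pd (M3 j) j x)) \<le> C" (is "?c \<le> C")
proof -
  have "0 < \<rho> x" "0 < inverse (\<rho> x)" "0 \<le> norm (H x)" "0 \<le> ?a" "0 \<le> ?b" "0 \<le> ?c"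
    using \<rho>_pos[OF assms(1)] by (auto intro!: sum_nonneg)
  then show "\<rho> x \<le> C" "inverse (\<rho> x) \<le> C" "norm (H x) \<le> C" "?a \<le> C" "?b \<le> C" "?c \<le> C"
    using assms(2) unfolding coef_size_def by linarith+
qed

lemma coef_size_bounded:
  assumes K: "compact K" "K \<subseteq> \<Omega>"
  shows "\<exists>C\<ge>1. \<forall>x\<in>K. coef_size x \<le> C"
proof -
  have c: "continuous_on \<Omega> (pd (M1 j k) j)" "continuous_on \<Omega> (pd (M2 j k) j)"
     "continuous_on \<Omega> (pd (M3 j) j)" if "j \<in> Basis" "k \<in> Basis" for j k
    using M1_C1[OF that] M2_C1[OF that] M3_C1[OF that(1)] by simp_all
  have "continuous_on \<Omega> coef_size"
    unfolding coef_size_def using Ck_on_continuous[OF \<rho>_C1] Ck_on_continuous[OF H_C1] \<rho>_pos c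
    by (intro continuous_intros) (auto simp: less_imp_neq[symmetric])
  then have "continuous_on K coef_size" using K(2) by (rule continuous_on_subset)
  from continuous_bounded_above[OF K(1) this] obtain B where "\<forall>x\<in>K. coef_size x \<le> B" by blast
  then show ?thesis by (intro exI[of _ "max 1 B"]) force
qed

text \<open>
  The Carleman estimate before integration. Here \<open>a\<close> and \<open>w\<close> stand for the value and the partial
  derivatives of \<open>v\<close> at \<open>x\<close>, \<open>s\<close> for \<open>\<psi> x - s\<^sub>0\<close>, and \<open>D1\<close>, \<open>D2\<close>, \<open>D3\<close> for the divergences to be integrated
  away. In the expansion of the square, the \<open>D\<close>-terms absorb all products of two derivatives, the
  term \<open>H x a \<bullet> a\<close> of \<open>D3\<close> gives the gain \<open>c\<^sub>0 \<tau> |a|\<^sup>2\<close>, and errors of size \<open>C |a| |w|\<close> and \<open>\<epsilon> C \<tau> |a|\<^sup>2\<close>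
  remain. The gradient needed against the first error is bought with the multiple \<open>\<mu> / \<tau>\<close> of the
  identity for the symbol. Its cost, \<open>3 \<mu> \<tau> s\<^sup>2 |a|\<^sup>2\<close> up to the metric, has the order of the gain and is made
  small by \<open>\<epsilon>\<close>; the value of \<open>\<mu>\<close> is the one for which the first error consumes a quarter of the gain.
\<close>

lemma carleman_pointwise:
  fixes w :: "'a \<Rightarrow> 'b" and a :: 'b and s \<tau> \<epsilon> C :: real
  assumes x: "x \<in> \<Omega>" and C: "C > 0"
    and size: "coef_size x \<le> C"
    and \<mu>: "\<mu> = 4 * C ^ 3 / c0\<^sup>2" and \<tau>: "\<tau> > 0" "\<tau> \<ge> 3 * \<mu>"
    and \<epsilon>: "\<bar>s\<bar> \<le> \<epsilon>" "\<epsilon> * C + 3 * \<mu> * \<epsilon>\<^sup>2 * C \<le> c0 / 2"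
  defines "W \<equiv> Bop x w - Yop x w + (\<tau> * s) *\<^sub>R a"
  defines "D1 \<equiv> \<Sum>j\<in>Basis. \<Sum>k\<in>Basis. M1 j k x (w j) \<bullet> w k + pd (M1 j k) j x a \<bullet> w k"
  defines "D2 \<equiv> \<Sum>j\<in>Basis. \<Sum>k\<in>Basis. M2 j k x (w j) \<bullet> w k + pd (M2 j k) j x a \<bullet> w k"
  defines "D3 \<equiv> 2 * s * (H x (Yop x w) \<bullet> a) + H x a \<bullet> a + s * (\<Sum>j\<in>Basis. pd (M3 j) j x a \<bullet> a)"
  shows "c0 / 4 * \<tau> * (norm a)\<^sup>2 \<le> H x W \<bullet> W + D1 + \<tau> * D3 + \<mu> / \<tau> / 2 * D2"
proof -
  note bounds = coef_size_bounds[OF x size]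
  define g where "g = L2_set (\<lambda>j. norm (w j)) Basis"
  have g2: "g\<^sup>2 = (\<Sum>j\<in>Basis. (norm (w j))\<^sup>2)" by (simp add: g_def L2_set_def sum_nonneg)
  have g0: "g \<ge> 0" by (simp add: g_def L2_set_nonneg)
  have wg: "norm (w k) \<le> g" if "k \<in> Basis" for k
    unfolding g_def by (rule member_le_L2_set[OF finite_Basis that])
  define n where "n = norm a"
  have n0: "n \<ge> 0" by (simp add: n_def)
  define F1 where "F1 = (\<Sum>j\<in>Basis. \<Sum>k\<in>Basis. M1 j k x (w j) \<bullet> w k)"
  define F2 where "F2 = (\<Sum>j\<in>Basis. \<Sum>k\<in>Basis. M2 j k x (w j) \<bullet> w k)"
  define E1 where "E1 = (\<Sum>j\<in>Basis. \<Sum>k\<in>Basis. pd (M1 j k) j x a \<bullet> w k)"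
  define E2 where "E2 = (\<Sum>j\<in>Basis. \<Sum>k\<in>Basis. pd (M2 j k) j x a \<bullet> w k)"
  define E3 where "E3 = (\<Sum>j\<in>Basis. pd (M3 j) j x a \<bullet> a)"
  have Eb: "\<bar>\<Sum>j\<in>Basis. \<Sum>k\<in>Basis. pd (M j k) j x a \<bullet> w k\<bar> \<le> C * (n * g)"
    if "(\<Sum>j\<in>Basis. \<Sum>k\<in>Basis. norm (pd (M j k) j x)) \<le> C" for M :: "'a \<Rightarrow> 'a \<Rightarrow> 'a \<Rightarrow> 'b \<Rightarrow>\<^sub>L 'b"
  proof -
    have "\<bar>\<Sum>j\<in>Basis. \<Sum>k\<in>Basis. pd (M j k) j x a \<bullet> w k\<bar> \<le>
      (\<Sum>j\<in>Basis. \<Sum>k\<in>Basis. \<bar>pd (M j k) j x a \<bullet> w k\<bar>)"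
      by (rule order_trans[OF sum_abs]) (intro sum_mono sum_abs)
    also have "\<dots> \<le> (\<Sum>j\<in>Basis. \<Sum>k\<in>Basis. norm (pd (M j k) j x) * (n * g))"
    proof (intro sum_mono)
      fix j k :: 'a assume k: "k \<in> Basis"
      have "\<bar>pd (M j k) j x a \<bullet> w k\<bar> \<le> norm (pd (M j k) j x a) * norm (w k)"
        by (rule Cauchy_Schwarz_ineq2)
      also have "\<dots> \<le> (norm (pd (M j k) j x) * n) * g"
        unfolding n_def by (intro mult_mono norm_blinfun wg k) (auto intro!: mult_nonneg_nonneg)
      finally show "\<bar>pd (M j k) j x a \<bullet> w k\<bar> \<le> norm (pd (M j k) j x) * (n * g)" by (simp add: mult_ac)
    qed
    also have "\<dots> = (\<Sum>j\<in>Basis. \<Sum>k\<in>Basis. norm (pd (M j k) j x)) * (n * g)"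
      by (simp add: sum_distrib_right)
    also have "\<dots> \<le> C * (n * g)" using that n0 g0 by (intro mult_right_mono) auto
    finally show ?thesis .
  qed
  have E1: "\<bar>E1\<bar> \<le> C * (n * g)" and E2: "\<bar>E2\<bar> \<le> C * (n * g)"
    unfolding E1_def E2_def by (intro Eb bounds)+
  have E3: "\<bar>E3\<bar> \<le> C * n\<^sup>2"
  proof -
    have "\<bar>E3\<bar> \<le> (\<Sum>j\<in>Basis. \<bar>pd (M3 j) j x a \<bullet> a\<bar>)" unfolding E3_def by (rule sum_abs)
    also have "\<dots> \<le> (\<Sum>j\<in>Basis. norm (pd (M3 j) j x) * n\<^sup>2)"
    proof (intro sum_mono)
      fix j :: 'a
      have "\<bar>pd (M3 j) j x a \<bullet> a\<bar> \<le> norm (pd (M3 j) j x a) * norm a" by (rule Cauchy_Schwarz_ineq2)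
      also have "\<dots> \<le> (norm (pd (M3 j) j x) * n) * n"
        unfolding n_def by (intro mult_mono norm_blinfun) auto
      finally show "\<bar>pd (M3 j) j x a \<bullet> a\<bar> \<le> norm (pd (M3 j) j x) * n\<^sup>2"
        by (simp add: power2_eq_square mult_ac)
    qed
    also have "\<dots> \<le> C * n\<^sup>2" by (simp add: bounds(6) mult_right_mono flip: sum_distrib_right)
    finally show ?thesis .
  qed
  define hv where "hv = H x a \<bullet> a"
  have hv: "c0 * n\<^sup>2 \<le> hv" using H_pos[OF x, of a] by (simp add: hv_def n_def)
  have hvC: "hv \<le> C * n\<^sup>2"
  proof -
    have "hv \<le> norm (H x a) * norm a" unfolding hv_def by (rule norm_cauchy_schwarz)
    also have "\<dots> \<le> (C * n) * n" unfolding n_def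
      by (intro mult_right_mono order_trans[OF norm_blinfun] bounds) auto
    finally show ?thesis by (simp add: power2_eq_square mult_ac)
  qed
  have pos: "H x d \<bullet> d \<ge> 0" for d
    using H_pos[OF x, of d] c0_pos by (meson order_trans mult_nonneg_nonneg less_imp_le zero_le_power2)
  define Y where "Y = H x (Yop x w) \<bullet> Yop x w"
  define Sv where "Sv = Bop x w + (\<tau> * s) *\<^sub>R a"
  define S where "S = H x Sv \<bullet> Sv"
  define T where "T = H x (Yop x w) \<bullet> a"
  define G where "G = (\<Sum>j\<in>Basis. \<Sum>k\<in>Basis. \<gamma> j k x * (H x (w j) \<bullet> w k))"
  have YS: "Y \<ge> 0" "S \<ge> 0" by (auto simp: Y_def S_def pos)
  have 1: "H x W \<bullet> W = Y + S - F1 - 2 * \<tau> * s * T"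
  proof -
    have W: "W = Sv - Yop x w" by (simp add: W_def Sv_def)
    have "H x W \<bullet> W = Y + S - 2 * (H x (Yop x w) \<bullet> Sv)"
      using H_sym[OF x, of Sv "Yop x w"]
      by (simp add: W Y_def S_def blinfun.diff_right inner_diff_left inner_diff_right)
    also have "H x (Yop x w) \<bullet> Sv = H x (Yop x w) \<bullet> Bop x w + \<tau> * s * T"
      by (simp add: Sv_def T_def inner_add_right)
    finally show ?thesis using cross_term[OF x, of w] by (simp add: F1_def)
  qed
  define Q where "Q = H x (Bop x w - Yop x w) \<bullet> (Bop x w - Yop x w)"
  have 2: "Q = G / \<rho> x - F2 / 2"
    using conjugated_norm[OF x, of w 0 a] symb_norm[OF x, of w] by (simp add: G_def F2_def Q_def)
  have 3: "Q \<le> 3 * (Y + S + \<tau>\<^sup>2 * s\<^sup>2 * hv)"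
    using three_squares[OF x, of "- Yop x w" Sv "- (\<tau> * s) *\<^sub>R a"]
    by (simp add: Sv_def Q_def Y_def S_def hv_def blinfun.minus_right blinfun.scaleR_right power2_eq_square mult_ac)
  have 4: "G / \<rho> x \<ge> c0 * g\<^sup>2 / C"
  proof -
    have "c0 * g\<^sup>2 \<le> G" unfolding G_def g2 by (rule elliptic[OF x])
    moreover have "0 \<le> c0 * g\<^sup>2" using c0_pos by simp
    ultimately show ?thesis using bounds(1) \<rho>_pos[OF x] by (intro frac_le) auto
  qed
  define \<theta> where "\<theta> = \<mu> / \<tau>"
  have \<mu>0: "\<mu> > 0" using C c0_pos by (simp add: \<mu>)
  have \<theta>: "\<theta> > 0" "3 * \<theta> \<le> 1" "\<theta> * \<tau> = \<mu>" using \<mu>0 \<tau> by (auto simp: \<theta>_def)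
  \<comment> \<open>The multiple \<open>\<theta>\<close> of the gradient identity; \<open>3 \<theta> \<le> 1\<close> keeps its cost within \<open>Y + S\<close>.\<close>
  have 5: "\<theta> / 2 * F2 \<ge> \<theta> * (c0 * g\<^sup>2 / C) - (Y + S) - 3 * \<mu> * \<tau> * s\<^sup>2 * hv"
  proof -
    have "\<theta> * Q \<le> \<theta> * (3 * (Y + S + \<tau>\<^sup>2 * s\<^sup>2 * hv))" using 3 \<theta> by (intro mult_left_mono) auto
    also have "\<dots> = (3 * \<theta>) * (Y + S) + 3 * (\<theta> * \<tau>) * \<tau> * s\<^sup>2 * hv"
      by (simp add: algebra_simps power2_eq_square)
    also have "\<dots> \<le> (Y + S) + 3 * \<mu> * \<tau> * s\<^sup>2 * hv"
      using \<theta> YS by (simp add: mult_left_le_one_le)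
    finally have "\<theta> * Q \<le> (Y + S) + 3 * \<mu> * \<tau> * s\<^sup>2 * hv" .
    moreover have "\<theta> * (c0 * g\<^sup>2 / C) \<le> \<theta> * (G / \<rho> x)" using 4 \<theta> by (intro mult_left_mono) auto
    moreover have "\<theta> / 2 * F2 = \<theta> * (G / \<rho> x) - \<theta> * Q" by (simp add: 2 algebra_simps)
    ultimately show ?thesis by linarith
  qed
  \<comment> \<open>Completing the square in \<open>g\<close>.\<close>
  have 6: "\<theta> * (c0 * g\<^sup>2 / C) - 2 * C * (n * g) \<ge> - (c0 / 4 * \<tau> * n\<^sup>2)"
  proof -
    define p where "p = \<theta> * c0 / C"
    have p: "p > 0" using \<theta> c0_pos C by (simp add: p_def)
    have "0 \<le> (p * g - C * n)\<^sup>2 / p" using p by simp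
    also have "\<dots> = p * g\<^sup>2 - 2 * C * (n * g) + C\<^sup>2 / p * n\<^sup>2"
      using p by (simp add: power2_diff field_simps power2_eq_square)
    also have "C\<^sup>2 / p = c0 / 4 * \<tau>"
      using C c0_pos \<tau>(1) by (simp add: p_def \<theta>_def \<mu> field_simps power2_eq_square power3_eq_cube)
    finally show ?thesis by (simp add: p_def mult_ac)
  qed
  have 7: "\<theta> / 2 * E2 \<ge> - (C * (n * g))"
  proof -
    have "\<bar>\<theta> / 2 * E2\<bar> \<le> 1 * \<bar>E2\<bar>"
      unfolding abs_mult using \<theta> by (intro mult_right_mono) auto
    then show ?thesis using E2 by linarith
  qed
  have sq: "s\<^sup>2 \<le> \<epsilon>\<^sup>2" using \<epsilon>(1) by (metis abs_ge_zero power2_abs power_mono)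
  have 8: "\<tau> * s * E3 \<ge> - (\<tau> * \<epsilon> * C * n\<^sup>2)"
  proof -
    have "\<bar>\<tau> * s * E3\<bar> \<le> \<tau> * \<epsilon> * (C * n\<^sup>2)"
      unfolding abs_mult using \<tau>(1) \<epsilon>(1) E3 by (intro mult_mono) auto
    then show ?thesis by (simp add: mult_ac)
  qed
  have 9: "3 * \<mu> * \<tau> * s\<^sup>2 * hv \<le> 3 * \<mu> * \<tau> * \<epsilon>\<^sup>2 * (C * n\<^sup>2)"
    using hvC sq \<mu>0 \<tau>(1) pos[of a] by (intro mult_mono) (auto simp: hv_def)
  have 10: "\<tau> * hv \<ge> \<tau> * c0 * n\<^sup>2" using hv \<tau>(1) by simp
  have "(\<epsilon> * C + 3 * \<mu> * \<epsilon>\<^sup>2 * C) * (\<tau> * n\<^sup>2) \<le> c0 / 2 * (\<tau> * n\<^sup>2)"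
    using \<epsilon>(2) \<tau>(1) by (intro mult_right_mono) auto
  then have 11: "\<tau> * \<epsilon> * C * n\<^sup>2 + 3 * \<mu> * \<tau> * \<epsilon>\<^sup>2 * (C * n\<^sup>2) \<le> c0 / 2 * \<tau> * n\<^sup>2"
    by (simp add: algebra_simps)
  have D1: "D1 = F1 + E1" and D2: "D2 = F2 + E2"
    by (simp_all add: D1_def D2_def F1_def F2_def E1_def E2_def sum.distrib)
  have "\<tau> * D3 = 2 * \<tau> * s * T + \<tau> * hv + \<tau> * s * E3"
    by (simp add: D3_def T_def hv_def E3_def algebra_simps)
  moreover have "\<mu> / \<tau> / 2 * D2 = \<theta> / 2 * F2 + \<theta> / 2 * E2"
    by (simp add: D2 \<theta>_def algebra_simps add_divide_distrib)
  ultimately have "H x W \<bullet> W + D1 + \<tau> * D3 + \<mu> / \<tau> / 2 * D2 =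
      Y + S + E1 + \<tau> * hv + \<tau> * s * E3 + \<theta> / 2 * F2 + \<theta> / 2 * E2"
    using 1 D1 by simp
  moreover have "E1 \<ge> - (C * (n * g))" using E1 by linarith
  moreover have "2 * C * (n * g) = C * (n * g) + C * (n * g)" by simp
  moreover have "c0 / 2 * \<tau> * n\<^sup>2 = c0 / 4 * \<tau> * n\<^sup>2 + c0 / 4 * \<tau> * n\<^sup>2"
    "\<tau> * c0 * n\<^sup>2 = 4 * (c0 / 4 * \<tau> * n\<^sup>2)" by simp_all
  ultimately show ?thesis using 5 6 7 8 9 10 11 unfolding n_def[symmetric] by linarith
qed

text \<open>
  The estimate is stated for \<open>v\<close>, the function already multiplied by the weight
  \<open>exp (\<tau> (\<psi> - s\<^sub>0)\<^sup>2 / 2)\<close>; this turns \<open>symb\<close> into its conjugate and leaves integrals without weights. The right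
  hand side is an arbitrary integrable majorant \<open>f\<close>, since the coefficients make sense in \<open>\<Omega>\<close> only.
  The constants depend on \<open>K\<close>, but not on the position \<open>s\<^sub>0\<close> of the shell.
\<close>

definition carleman_bound :: "'a set \<Rightarrow> real \<Rightarrow> real \<Rightarrow> real \<Rightarrow> bool" where
  "carleman_bound K \<epsilon> \<tau>0 c \<longleftrightarrow> (\<forall>s0 K' v \<tau> f.
    compact K' \<and> K' \<subseteq> K \<and> (\<forall>x\<in>K'. \<bar>\<psi> x - s0\<bar> \<le> \<epsilon>) \<and> Ck_on 2 UNIV v \<and> (\<forall>x. x \<notin> K' \<longrightarrow> v x = 0) \<and>
    \<tau> \<ge> \<tau>0 \<and> integrable lborel f \<and> (\<forall>x. f x \<ge> 0) \<and>
    (\<forall>x\<in>K'. (norm (symb x (\<lambda>j. pd v j x) - (\<tau> * (\<psi> x - s0)) *\<^sub>R nrm x (v x)))\<^sup>2 \<le> f x)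
    \<longrightarrow> c * \<tau> * integral\<^sup>L lborel (\<lambda>x. (norm (v x))\<^sup>2) \<le> integral\<^sup>L lborel f)"

text \<open>
  Integrating \<open>carleman_pointwise\<close>. The exponent \<open>(\<psi> - s\<^sub>0)\<^sup>2 / 2\<close> is convex in \<open>\<psi>\<close> with second derivative 1,
  whereas its first derivative \<open>\<psi> - s\<^sub>0\<close> is at most \<open>\<epsilon>\<close> on the support: this smallness keeps the terms with
  \<open>\<tau> (\<psi> - s\<^sub>0)\<close> below the gain.
\<close>

theorem carleman_estimate:
  assumes K: "compact K" "K \<subseteq> \<Omega>"
  shows "\<exists>\<epsilon>>0. \<exists>\<tau>0>0. \<exists>c>0. carleman_bound K \<epsilon> \<tau>0 c"
proof -
  obtain C where C1: "C \<ge> 1" and Cb: "\<And>x. x \<in> K \<Longrightarrow> coef_size x \<le> C"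
    using coef_size_bounded[OF K] by blast
  have C: "C > 0" using C1 by simp
  define \<mu> where "\<mu> = 4 * C ^ 3 / c0\<^sup>2"
  have \<mu>0: "\<mu> > 0" using C c0_pos by (simp add: \<mu>_def)
  define \<epsilon> where "\<epsilon> = min 1 (c0 / (2 * C * (1 + 3 * \<mu>)))"
  have e0: "\<epsilon> > 0" "\<epsilon> \<le> 1" using C c0_pos \<mu>0 by (auto simp: \<epsilon>_def)
  have "\<epsilon> * (C * (1 + 3 * \<mu>)) \<le> c0 / (2 * C * (1 + 3 * \<mu>)) * (C * (1 + 3 * \<mu>))"
    using C \<mu>0 by (intro mult_right_mono) (auto simp: \<epsilon>_def)
  also have "\<dots> = c0 / 2"
  proof -
    have "m > 0 \<Longrightarrow> c0 / (2 * C * m) * (C * m) = c0 / 2" for m using C by (simp add: field_simps)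
    from this[of "1 + 3 * \<mu>"] show ?thesis using \<mu>0 by argo
  qed
  finally have e1: "\<epsilon> * (C * (1 + 3 * \<mu>)) \<le> c0 / 2" .
  have "\<epsilon>\<^sup>2 \<le> \<epsilon>" using e0 by (simp add: power2_eq_square mult_left_le_one_le)
  then have "3 * \<mu> * C * \<epsilon>\<^sup>2 \<le> 3 * \<mu> * C * \<epsilon>" using C \<mu>0 by (intro mult_left_mono) auto
  with e1 have e2: "\<epsilon> * C + 3 * \<mu> * \<epsilon>\<^sup>2 * C \<le> c0 / 2" by (simp add: algebra_simps)
  define c where "c = c0 / (4 * C\<^sup>2)"
  have c: "c > 0" "c0 / 4 = c * C\<^sup>2" using C c0_pos by (auto simp: c_def)
  show ?thesis
    unfolding carleman_bound_def
  proof (intro exI conjI allI impI)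
    show "\<epsilon> > 0" "3 * \<mu> > 0" "c > 0" using e0 \<mu>0 c by auto
    fix s0 K' v \<tau> and f :: "'a \<Rightarrow> real"
    assume "compact K' \<and> K' \<subseteq> K \<and> (\<forall>x\<in>K'. \<bar>\<psi> x - s0\<bar> \<le> \<epsilon>) \<and> Ck_on 2 UNIV v \<and> (\<forall>x. x \<notin> K' \<longrightarrow> v x = 0) \<and>
    3 * \<mu> \<le> \<tau> \<and> integrable lborel f \<and> (\<forall>x. f x \<ge> 0) \<and>
    (\<forall>x\<in>K'. (norm (symb x (\<lambda>j. pd v j x) - (\<tau> * (\<psi> x - s0)) *\<^sub>R nrm x (v x)))\<^sup>2 \<le> f x)"
    then have K': "compact K'" "K' \<subseteq> K" and s: "\<And>x. x \<in> K' \<Longrightarrow> \<bar>\<psi> x - s0\<bar> \<le> \<epsilon>" and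
      v: "Ck_on 2 UNIV v" "\<And>x. x \<notin> K' \<Longrightarrow> v x = 0" and \<tau>: "\<tau> \<ge> 3 * \<mu>" and f: "integrable lborel f" "\<And>x. f x \<ge> 0" and
      Xf: "\<And>x. x \<in> K' \<Longrightarrow> (norm (symb x (\<lambda>j. pd v j x) - (\<tau> * (\<psi> x - s0)) *\<^sub>R nrm x (v x)))\<^sup>2 \<le> f x"
      by auto
    have \<tau>0: "\<tau> > 0" using \<tau> \<mu>0 by simp
    have K'\<Omega>: "K' \<subseteq> \<Omega>" using K K' by auto
    have v1: "Ck_on (Suc 0) UNIV v" using v(1) Ck_on_SucD by (simp add: numeral_2_eq_2 del: Ck_on.simps)
    define D1 where "D1 x = (\<Sum>j\<in>Basis. \<Sum>k\<in>Basis. M1 j k x (pd v j x) \<bullet> pd v k x + pd (M1 j k) j x (v x) \<bullet> pd v k x)" for x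
    define D2 where "D2 x = (\<Sum>j\<in>Basis. \<Sum>k\<in>Basis. M2 j k x (pd v j x) \<bullet> pd v k x + pd (M2 j k) j x (v x) \<bullet> pd v k x)" for x
    define Z where "Z j x = (\<psi> x - s0) *\<^sub>R M3 j x" for j x
    define D3 where "D3 x = (\<Sum>j\<in>Basis. Z j x (v x) \<bullet> pd v j x + Z j x (pd v j x) \<bullet> v x + pd (Z j) j x (v x) \<bullet> v x)" for x
    have \<psi>1: "Ck_on (Suc 0) \<Omega> \<psi>" using \<psi>_C2 Ck_on_SucD by blast
    have Z_C1: "Ck_on (Suc 0) \<Omega> (Z j)" if "j \<in> Basis" for j
      unfolding Z_def[abs_def] by (intro Ck_on_scaleR Ck_on_diff Ck_on_const \<psi>1 M3_C1 open_dom that)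
    have D1: "has_bochner_integral lborel D1 0" unfolding D1_def[abs_def]
      by (rule antisymmetric_form_null[OF v(1) K'(1) K'\<Omega> open_dom v(2) M1_C1 M1_anti])
    have D2: "has_bochner_integral lborel D2 0" unfolding D2_def[abs_def]
      by (rule antisymmetric_form_null[OF v(1) K'(1) K'\<Omega> open_dom v(2) M2_C1 M2_anti])
    have D3: "has_bochner_integral lborel D3 0" unfolding D3_def[abs_def]
      by (rule transport_form_null[OF v1 K'(1) K'\<Omega> open_dom v(2) Z_C1])
    have D3_eq: "D3 x = 2 * (\<psi> x - s0) * (H x (Yop x (\<lambda>j. pd v j x)) \<bullet> v x) + H x (v x) \<bullet> v x
        + (\<psi> x - s0) * (\<Sum>j\<in>Basis. pd (M3 j) j x (v x) \<bullet> v x)" if x: "x \<in> \<Omega>" for x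
    proof -
      have pZ: "pd (Z j) j x = (\<psi> x - s0) *\<^sub>R pd (M3 j) j x + pd \<psi> j x *\<^sub>R M3 j x" if j: "j \<in> Basis" for j
      proof -
        have "(Z j has_derivative (\<lambda>i. (\<psi> x - s0) *\<^sub>R pd (M3 j) i x + pd \<psi> i x *\<^sub>R M3 j x)) (at x)"
          unfolding Z_def[abs_def]
          using has_derivative_diff[OF Ck_on_has_derivative[OF \<psi>1 x] has_derivative_const, of s0]
            by (intro has_derivative_scaleR Ck_on_has_derivative[OF M3_C1[OF j] x]) simp
        from pd_eqI[OF this, where j = j] show ?thesis .
      qed
      have "D3 x = (\<Sum>j\<in>Basis. 2 * (\<psi> x - s0) * (yc j x * (H x (pd v j x) \<bullet> v x))
         + (pd \<psi> j x * yc j x) * (H x (v x) \<bullet> v x) + (\<psi> x - s0) * (pd (M3 j) j x (v x) \<bullet> v x))"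
        unfolding D3_def
        by (intro sum.cong refl)
          (simp add: pZ Z_def M3_def blinfun.bilinear_simps inner_add_left H_sym[OF x, of "v x" "pd v _ x"] algebra_simps)
      also have "\<dots> = 2 * (\<psi> x - s0) * (\<Sum>j\<in>Basis. yc j x * (H x (pd v j x) \<bullet> v x))
         + (\<Sum>j\<in>Basis. pd \<psi> j x * yc j x) * (H x (v x) \<bullet> v x) + (\<psi> x - s0) * (\<Sum>j\<in>Basis. pd (M3 j) j x (v x) \<bullet> v x)"
        by (simp add: sum.distrib sum_distrib_left sum_distrib_right)
      also have "(\<Sum>j\<in>Basis. yc j x * (H x (pd v j x) \<bullet> v x)) = H x (Yop x (\<lambda>j. pd v j x)) \<bullet> v x"
        by (simp add: Yop_def blinfun.sum_right blinfun.scaleR_right inner_sum_left)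
      finally show ?thesis by (simp add: yc_normalized[OF x])
    qed
    have main: "c0 / 4 * \<tau> * (norm (v x))\<^sup>2 \<le> C\<^sup>2 * f x + (D1 x + \<tau> * D3 x + \<mu> / \<tau> / 2 * D2 x)" for x
    proof (cases "x \<in> K'")
      case True
      then have x: "x \<in> \<Omega>" "x \<in> K" using K K' by auto
      let ?w = "\<lambda>j. pd v j x"
      let ?W = "Bop x ?w - Yop x ?w + (\<tau> * (\<psi> x - s0)) *\<^sub>R v x"
      let ?X = "symb x ?w - (\<tau> * (\<psi> x - s0)) *\<^sub>R nrm x (v x)"
      have 1: "c0 / 4 * \<tau> * (norm (v x))\<^sup>2 \<le> H x ?W \<bullet> ?W + D1 x + \<tau> * D3 x + \<mu> / \<tau> / 2 * D2 x"
        using carleman_pointwise[OF x(1) C Cb[OF x(2)] \<mu>_def \<tau>0 \<tau> s[OF True] e2, where w = ?w and a = "v x"]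
        unfolding D1_def D2_def D3_eq[OF x(1)] by simp
      note b = coef_size_bounds[OF x(1) Cb[OF x(2)]]
      have "H x ?W \<bullet> ?W = (H x ?X \<bullet> ?X) * inverse (\<rho> x)"
        by (subst conjugated_norm[OF x(1)]) (simp add: divide_inverse)
      also have "\<dots> \<le> (C * (norm ?X)\<^sup>2) * C"
      proof (rule mult_mono)
        have "H x ?X \<bullet> ?X \<le> norm (H x ?X) * norm ?X" by (rule norm_cauchy_schwarz)
        also have "\<dots> \<le> (C * norm ?X) * norm ?X"
          using b(3) by (intro mult_right_mono order_trans[OF norm_blinfun]) auto
        finally show "H x ?X \<bullet> ?X \<le> C * (norm ?X)\<^sup>2" by (simp add: power2_eq_square mult_ac)
      qed (use b(2) \<rho>_pos[OF x(1)] C in auto)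
      also have "\<dots> = C\<^sup>2 * (norm ?X)\<^sup>2" by (simp add: power2_eq_square)
      also have "\<dots> \<le> C\<^sup>2 * f x" using Xf[OF True] by (intro mult_left_mono) auto
      finally show ?thesis using 1 by linarith
    next
      case False
      have "pd v j x = 0" for j by (rule pd_zero_outside[OF compact_imp_closed[OF K'(1)] v(2) False])
      then have "D1 x = 0" "D2 x = 0" "D3 x = 0" using v(2)[OF False] by (simp_all add: D1_def D2_def D3_def)
      then show ?thesis using v(2)[OF False] f(2)[of x] by simp
    qed
    have D: "has_bochner_integral lborel (\<lambda>x. D1 x + \<tau> * D3 x + \<mu> / \<tau> / 2 * D2 x) 0"
      using has_bochner_integral_add[OF has_bochner_integral_add[OF D1 has_bochner_integral_mult_right[OF D3, of \<tau>]]
          has_bochner_integral_mult_right[OF D2, of "\<mu> / \<tau> / 2"]] by simp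
    have vi: "integrable lborel (\<lambda>x. (norm (v x))\<^sup>2)"
      by (rule integrable_compact_support[OF K'(1)])
        (use v Ck_on_continuous[OF v(1)] in \<open>auto intro!: continuous_intros intro: continuous_on_subset\<close>)
    have "integral\<^sup>L lborel (\<lambda>x. c0 / 4 * \<tau> * (norm (v x))\<^sup>2) \<le>
      integral\<^sup>L lborel (\<lambda>x. C\<^sup>2 * f x + (D1 x + \<tau> * D3 x + \<mu> / \<tau> / 2 * D2 x))"
      using D f vi main by (intro integral_mono) (auto simp: has_bochner_integral_iff)
    also have "\<dots> = C\<^sup>2 * integral\<^sup>L lborel f"
      using D f by (subst Bochner_Integration.integral_add) (auto simp: has_bochner_integral_iff)
    finally have "C\<^sup>2 * (c * \<tau> * integral\<^sup>L lborel (\<lambda>x. (norm (v x))\<^sup>2)) \<le> C\<^sup>2 * integral\<^sup>L lborel f"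
      by (simp add: c(2) mult_ac)
    then show "c * \<tau> * integral\<^sup>L lborel (\<lambda>x. (norm (v x))\<^sup>2) \<le> integral\<^sup>L lborel f"
      using C by simp
  qed
qed

end

section \<open>Unique continuation across spheres\<close>

lemma flat_fun_le_1: "flat_fun 0 t \<le> 1"
  by (simp add: flat_fun_def)

lemma flat_fun_mono: "t \<le> t' \<Longrightarrow> flat_fun 0 t \<le> flat_fun 0 t'"
  by (auto simp: flat_fun_def le_imp_inverse_le)

context clifford_symbol
begin

lemma symb_add: "symb x (\<lambda>j. w j + w' j) = symb x w + symb x w'"
  by (simp add: symb_def blinfun.add_right sum.distrib)

lemma symb_scaleR: "symb x (\<lambda>j. t *\<^sub>R w j) = t *\<^sub>R symb x w"
  by (simp add: symb_def blinfun.scaleR_right scaleR_sum_right)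

lemma clifford_symbol_subset:
  assumes "open \<Omega>'" "\<Omega>' \<subseteq> \<Omega>"
  shows "clifford_symbol \<Omega>' A H \<gamma> c0"
proof -
  note sub = Ck_on_subset[OF _ assms(2)]
  show ?thesis
  proof
    show "open \<Omega>'" "c0 > 0" by (fact assms(1), fact c0_pos)
    show "Ck_on (Suc 0) \<Omega>' H" by (rule sub[OF H_C1])
    show "Ck_on (Suc 0) \<Omega>' (A j)" if "j \<in> Basis" for j by (rule sub[OF A_C1[OF that]])
    show "Ck_on (Suc 0) \<Omega>' (\<gamma> j k)" if "j \<in> Basis" "k \<in> Basis" for j k by (rule sub[OF \<gamma>_C1[OF that]])
    fix x assume "x \<in> \<Omega>'"
    with assms(2) have x: "x \<in> \<Omega>" by auto
    show "H x a \<bullet> b = H x b \<bullet> a" "c0 * (norm a)\<^sup>2 \<le> H x a \<bullet> a" for a b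
      by (rule H_sym[OF x], rule H_pos[OF x])
    show "c0 * (\<Sum>j\<in>Basis. (norm (w j))\<^sup>2) \<le> (\<Sum>j\<in>Basis. \<Sum>k\<in>Basis. \<gamma> j k x * (H x (w j) \<bullet> w k))" for w
      by (rule elliptic[OF x])
    fix j :: 'a assume j: "j \<in> Basis"
    show "H x (A j x a) \<bullet> b = - (H x a \<bullet> A j x b)" for a b by (rule skew[OF x j])
    fix k :: 'a assume k: "k \<in> Basis"
    show "\<gamma> j k x = \<gamma> k j x" by (rule \<gamma>_sym[OF x j k])
    show "A j x (A k x a) + A k x (A j x a) = (- 2 * \<gamma> j k x) *\<^sub>R a" for a by (rule clifford[OF x j k])
  qed
qed

text \<open>
  With \<open>\<psi> = - |x - q|\<^sup>2 / 2\<close> the function \<open>s = \<psi> - s\<^sub>0\<close> equals \<open>3 \<delta>\<close> on the sphere of radius \<open>r\<close> and decreases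
  outwards, so \<open>u\<close> lives where \<open>s \<le> 3 \<delta>\<close>. It is cut off near \<open>s = \<delta> / 2\<close>. Where \<open>s \<ge> \<delta>\<close> the cutoff function
  \<open>b\<close> satisfies \<open>|b'| \<le> const b\<close>, so there the commutator with the cutoff is one more multiple
  of \<open>v\<close>; where \<open>s < \<delta>\<close> the square of the weight is at most \<open>exp (\<tau> \<delta>\<^sup>2)\<close>. On the region
  \<open>s > 2 \<delta>\<close> it is at least \<open>exp (4 \<tau> \<delta>\<^sup>2)\<close>, and letting \<open>\<tau>\<close> grow forces \<open>u = 0\<close> there.
\<close>

lemma zero_ball_enlarge:
  assumes R: "cball q R \<subseteq> \<Omega>" and r: "0 < r" "r < R"
    and u: "Ck_on 2 \<Omega> u" and L: "L \<ge> 0" "\<And>x. x \<in> \<Omega> \<Longrightarrow> norm (symb x (\<lambda>j. pd u j x)) \<le> L * norm (u x)"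
    and zero: "\<And>x. x \<in> ball q r \<Longrightarrow> u x = 0"
  shows "\<exists>r'>r. r' \<le> R \<and> (\<forall>x\<in>ball q r'. u x = 0)"
proof -
  define \<psi> where "\<psi> x = - ((x - q) \<bullet> (x - q)) / 2" for x
  have \<psi>_norm: "\<psi> x = - (norm (x - q))\<^sup>2 / 2" for x by (simp add: \<psi>_def power2_norm_eq_inner)
  have \<psi>_Ck: "Ck_on k S \<psi>" if "open S" for k S
  proof -
    have "Ck_on k S (\<lambda>x. (x - q) \<bullet> (x - q) * (- 1 / 2))"
      by (intro Ck_on_mult Ck_on_inner Ck_on_diff Ck_on_linear[OF _ bounded_linear_ident] Ck_on_const that)
    then show ?thesis by (simp add: \<psi>_def[abs_def])
  qed
  have \<psi>_der: "(\<psi> has_derivative (\<lambda>j. (q - x) \<bullet> j)) (at x)" for x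
    unfolding \<psi>_def[abs_def] by (auto intro!: derivative_eq_intros simp: inner_diff_left inner_commute algebra_simps diff_divide_distrib)
  have pd\<psi>: "pd \<psi> j x = (q - x) \<bullet> j" for j x by (rule pd_eqI[OF \<psi>_der])
  let ?\<Omega> = "\<Omega> - {q}"
  have o: "open ?\<Omega>" using open_dom by (simp add: open_delete)
  \<comment> \<open>The centre is the only critical point of \<open>\<psi>\<close>.\<close>
  interpret S: clifford_symbol ?\<Omega> A H \<gamma> c0 by (rule clifford_symbol_subset[OF o]) auto
  interpret W: carleman_weight ?\<Omega> A H \<gamma> c0 \<psi>
  proof
    show "Ck_on (Suc (Suc 0)) ?\<Omega> \<psi>" by (rule \<psi>_Ck[OF o])
    show "\<exists>j\<in>Basis. pd \<psi> j x \<noteq> 0" if "x \<in> ?\<Omega>" for x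
      using that euclidean_eqI[of "q - x" 0] by (auto simp: pd\<psi>)
  qed
  define K where "K = cball q R - ball q r"
  have K: "compact K" "K \<subseteq> ?\<Omega>" using R r by (auto simp: K_def intro: compact_diff)
  obtain \<epsilon> \<tau>0 c where e: "\<epsilon> > 0" "\<tau>0 > 0" "c > 0" and carleman: "W.carleman_bound K \<epsilon> \<tau>0 c"
    using W.carleman_estimate[OF K] by blast
  have "r\<^sup>2 < R\<^sup>2" using r by (simp add: power_strict_mono)
  define \<delta> where "\<delta> = min (\<epsilon> / 3) ((R\<^sup>2 - r\<^sup>2) / 6)"
  have \<delta>: "\<delta> > 0" "3 * \<delta> \<le> \<epsilon>" "r\<^sup>2 + 6 * \<delta> \<le> R\<^sup>2"
    using e \<open>r\<^sup>2 < R\<^sup>2\<close> by (auto simp: \<delta>_def min_def field_simps)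
  define s0 where "s0 = - r\<^sup>2 / 2 - 3 * \<delta>"
  define s where "s x = \<psi> x - s0" for x
  have s_eq: "s x = 3 * \<delta> + (r\<^sup>2 - (norm (x - q))\<^sup>2) / 2" for x by (simp add: s_def s0_def \<psi>_norm field_simps)
  define K' where "K' = {x. r\<^sup>2 \<le> (norm (x - q))\<^sup>2 \<and> (norm (x - q))\<^sup>2 \<le> r\<^sup>2 + 5 * \<delta>}"
  have K'K: "K' \<subseteq> K"
  proof
    fix x assume "x \<in> K'"
    then have "r\<^sup>2 \<le> (norm (x - q))\<^sup>2" "(norm (x - q))\<^sup>2 \<le> R\<^sup>2" using \<delta> by (auto simp: K'_def)
    then have "r \<le> norm (x - q)" "norm (x - q) \<le> R"
      using r by (auto intro: power2_le_imp_le)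
    then show "x \<in> K" by (auto simp: K_def dist_norm norm_minus_commute)
  qed
  have "closed K'" unfolding K'_def
    by (intro closed_Collect_conj closed_Collect_le continuous_intros)
  with K'K K have K': "compact K'"
    by (metis compact_Int_closed inf.absorb_iff2)
  have s_K': "\<delta> / 2 \<le> s x" "s x \<le> 3 * \<delta>" if "x \<in> K'" for x
  proof -
    have "r\<^sup>2 \<le> (norm (x - q))\<^sup>2" "(norm (x - q))\<^sup>2 \<le> r\<^sup>2 + 5 * \<delta>" using that by (auto simp: K'_def)
    then have "\<delta> / 2 \<le> s x \<and> s x \<le> 3 * \<delta>" unfolding s_eq by argo
    then show "\<delta> / 2 \<le> s x" "s x \<le> 3 * \<delta>" by auto
  qed
  \<comment> \<open>The weight times the cutoff, as a function of \<open>\<psi>\<close>, and its derivative.\<close>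
  define G where "G \<tau> p = exp (\<tau> * (p - s0)\<^sup>2 / 2) * flat_fun 0 (p - s0 - \<delta> / 2)" for \<tau> p
  define G' where "G' \<tau> p = exp (\<tau> * (p - s0)\<^sup>2 / 2) *
      (\<tau> * (p - s0) * flat_fun 0 (p - s0 - \<delta> / 2) + flat_fun 2 (p - s0 - \<delta> / 2))" for \<tau> p
  have G_der: "(G \<tau> has_real_derivative G' \<tau> p) (at p)" for \<tau> p
  proof -
    have b: "((\<lambda>p. flat_fun 0 (p - s0 - \<delta> / 2)) has_real_derivative flat_fun 2 (p - s0 - \<delta> / 2) * 1) (at p)"
      by (rule DERIV_chain2[where f = "flat_fun 0"])
        (use flat_fun_deriv[of 0] in \<open>auto intro!: derivative_eq_intros simp: numeral_2_eq_2\<close>)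
    have e: "((\<lambda>p. exp (\<tau> * (p - s0)\<^sup>2 / 2)) has_real_derivative exp (\<tau> * (p - s0)\<^sup>2 / 2) * (\<tau> * (p - s0))) (at p)"
      by (auto intro!: derivative_eq_intros)
    show ?thesis unfolding G_def[abs_def] G'_def
      by (rule DERIV_cong[OF DERIV_mult[OF e b]]) (simp add: algebra_simps)
  qed
  have G_Ck: "Ck_on 2 UNIV (G \<tau>)" for \<tau>
  proof -
    have id: "Ck_on 2 UNIV (\<lambda>p::real. p)" by (rule Ck_on_linear) (auto simp: bounded_linear_ident)
    have 1: "Ck_on 2 UNIV (\<lambda>p. \<tau> / 2 * ((p - s0) * (p - s0)))"
      by (intro Ck_on_mult Ck_on_diff Ck_on_const id) auto
    have 2: "Ck_on 2 UNIV (\<lambda>p. p - s0 - \<delta> / 2)"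
      by (intro Ck_on_diff Ck_on_const id) auto
    have "Ck_on 2 UNIV (\<lambda>p. exp (\<tau> / 2 * ((p - s0) * (p - s0))) * flat_fun 0 (p - s0 - \<delta> / 2))"
      by (intro Ck_on_mult Ck_on_compose[OF _ _ Ck_on_exp 1] Ck_on_compose[OF _ _ Ck_on_flat_fun 2]) auto
    then show ?thesis by (simp add: G_def[abs_def] power2_eq_square)
  qed
  define v where "v \<tau> x = (if x \<in> \<Omega> then G \<tau> (\<psi> x) *\<^sub>R u x else 0)" for \<tau> x
  have K'\<Omega>: "K' \<subseteq> \<Omega>" using K K'K by auto
  have v0: "v \<tau> x = 0" if "x \<notin> K'" for \<tau> x
  proof (cases "x \<in> \<Omega>")
    case True
    from that consider "(norm (x - q))\<^sup>2 < r\<^sup>2" | "(norm (x - q))\<^sup>2 > r\<^sup>2 + 5 * \<delta>" by (auto simp: K'_def)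
    then show ?thesis
    proof cases
      case 1
      then have "norm (x - q) < r" using r(1) power_less_imp_less_base by fastforce
      then have "u x = 0" by (intro zero) (auto simp: dist_norm norm_minus_commute)
      then show ?thesis by (simp add: v_def)
    next
      case 2
      then have "\<psi> x - s0 - \<delta> / 2 \<le> 0" using s_eq[of x] unfolding s_def by argo
      then show ?thesis by (simp add: v_def G_def flat_fun_def)
    qed
  qed (simp add: v_def)
  have v_Ck: "Ck_on 2 UNIV (v \<tau>)" for \<tau>
  proof (rule Ck_on_extend_zero[OF open_dom K' K'\<Omega> _ v0])
    have "Ck_on 2 \<Omega> (\<lambda>x. G \<tau> (\<psi> x) *\<^sub>R u x)"
      by (intro Ck_on_scaleR Ck_on_compose[OF _ _ G_Ck \<psi>_Ck] open_dom u) auto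
    then show "Ck_on 2 \<Omega> (v \<tau>)" by (subst Ck_on_cong[OF open_dom]) (auto simp: v_def)
  qed
  have pdv: "pd (v \<tau>) j x = G \<tau> (\<psi> x) *\<^sub>R pd u j x + (G' \<tau> (\<psi> x) * pd \<psi> j x) *\<^sub>R u x" if x: "x \<in> \<Omega>" for \<tau> j x
  proof -
    have "((\<lambda>x. G \<tau> (\<psi> x)) has_derivative (\<lambda>j. G' \<tau> (\<psi> x) * pd \<psi> j x)) (at x)"
      unfolding pd\<psi> using has_derivative_compose[OF \<psi>_der, of "G \<tau>"] G_der[of \<tau> "\<psi> x"]
      by (auto simp: has_field_derivative_def)
    moreover have "(u has_derivative (\<lambda>j. pd u j x)) (at x)"
      by (rule Ck_on_has_derivative[OF u[unfolded numeral_2_eq_2] x])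
    ultimately have "((\<lambda>x. G \<tau> (\<psi> x) *\<^sub>R u x) has_derivative
        (\<lambda>j. G \<tau> (\<psi> x) *\<^sub>R pd u j x + (G' \<tau> (\<psi> x) * pd \<psi> j x) *\<^sub>R u x)) (at x)"
      by (rule has_derivative_scaleR)
    then have "(v \<tau> has_derivative
        (\<lambda>j. G \<tau> (\<psi> x) *\<^sub>R pd u j x + (G' \<tau> (\<psi> x) * pd \<psi> j x) *\<^sub>R u x)) (at x)"
      by (rule has_derivative_transform_within_open[OF _ open_dom x]) (simp add: v_def)
    then show ?thesis by (rule pd_eqI)
  qed
  define b where "b x = flat_fun 0 (s x - \<delta> / 2)" for x
  define b' where "b' x = flat_fun 2 (s x - \<delta> / 2)" for x
  have conj: "symb x (\<lambda>j. pd (v \<tau>) j x) - (\<tau> * (\<psi> x - s0)) *\<^sub>R W.nrm x (v \<tau> x) =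
      exp (\<tau> * (s x)\<^sup>2 / 2) *\<^sub>R (b x *\<^sub>R symb x (\<lambda>j. pd u j x) + b' x *\<^sub>R W.nrm x (u x))" if x: "x \<in> \<Omega>" for \<tau> x
  proof -
    have n: "symb x (\<lambda>j. pd \<psi> j x *\<^sub>R u x) = W.nrm x (u x)"
      by (simp add: symb_def W.nrm_apply blinfun.scaleR_right)
    have "symb x (\<lambda>j. pd (v \<tau>) j x) = G \<tau> (\<psi> x) *\<^sub>R symb x (\<lambda>j. pd u j x) + G' \<tau> (\<psi> x) *\<^sub>R W.nrm x (u x)"
      by (simp add: pdv[OF x] symb_add symb_scaleR n flip: scaleR_scaleR)
    then show ?thesis using x
      by (simp add: v_def blinfun.scaleR_right G_def G'_def b_def b'_def s_def algebra_simps)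
  qed
  have b0: "b x \<ge> 0" "b x \<le> 1" "b' x \<ge> 0" for x
    by (auto simp: b_def b'_def flat_fun_nonneg flat_fun_le_1)
  have "compact (W.nrm ` K)" "compact (u ` K)"
    using Ck_on_continuous[OF W.nrm_C1] Ck_on_continuous[OF u] K
    by (auto intro!: compact_continuous_image K(1) intro: continuous_on_subset)
  then obtain C2 U where C2: "\<And>x. x \<in> K \<Longrightarrow> norm (W.nrm x) \<le> C2" and U: "\<And>x. x \<in> K \<Longrightarrow> norm (u x) \<le> U"
    using that by (fastforce dest!: compact_imp_bounded simp: bounded_iff)
  have nu: "norm (W.nrm x (u x)) \<le> \<bar>C2\<bar> * norm (u x)" if "x \<in> K" for x
    using C2[OF that] by (intro order_trans[OF norm_blinfun] mult_right_mono) auto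
  define B where "B = fact 4 * (\<delta> / 2)\<^sup>2"
  define Q where "Q = L + 4 / \<delta>\<^sup>2 * \<bar>C2\<bar>"
  define Q2 where "Q2 = (L + B * \<bar>C2\<bar>) * \<bar>U\<bar>"
  \<comment> \<open>The first summand is absorbed for large \<open>\<tau>\<close>; the second is the error of the truncation.\<close>
  define f where "f \<tau> x = Q\<^sup>2 * (norm (v \<tau> x))\<^sup>2 + exp (\<tau> * \<delta>\<^sup>2) * Q2\<^sup>2 * indicator K' x" for \<tau> x
  have Xf: "(norm (symb x (\<lambda>j. pd (v \<tau>) j x) - (\<tau> * (\<psi> x - s0)) *\<^sub>R W.nrm x (v \<tau> x)))\<^sup>2 \<le> f \<tau> x"
    if x: "x \<in> K'" and \<tau>: "\<tau> > 0" for x \<tau>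
  proof -
    let ?X = "symb x (\<lambda>j. pd (v \<tau>) j x) - (\<tau> * (\<psi> x - s0)) *\<^sub>R W.nrm x (v \<tau> x)"
    let ?e = "exp (\<tau> * (s x)\<^sup>2 / 2)"
    have xK: "x \<in> K" "x \<in> \<Omega>" using x K'K K by auto
    have "norm ?X \<le> ?e * (b x * norm (symb x (\<lambda>j. pd u j x)) + b' x * norm (W.nrm x (u x)))"
      unfolding conj[OF xK(2)] using b0 by (auto intro!: norm_triangle_le)
    also have "\<dots> \<le> ?e * (b x * (L * norm (u x)) + b' x * (\<bar>C2\<bar> * norm (u x)))"
      using b0 L(2)[OF xK(2)] nu[OF xK(1)] by (intro mult_left_mono add_mono) auto
    finally have X: "norm ?X \<le> ?e * (b x * (L * norm (u x)) + b' x * (\<bar>C2\<bar> * norm (u x)))" .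
    show ?thesis
    proof (cases "s x \<ge> \<delta>")
      case True
      have "b' x \<le> 4 / \<delta>\<^sup>2 * b x"
      proof -
        have t: "s x - \<delta> / 2 \<ge> \<delta> / 2" using True by simp
        then have "inverse (s x - \<delta> / 2) \<le> inverse (\<delta> / 2)" using \<delta>(1) by (intro le_imp_inverse_le) auto
        then have "(inverse (s x - \<delta> / 2))\<^sup>2 \<le> (inverse (\<delta> / 2))\<^sup>2" using t \<delta>(1) by (intro power_mono) auto
        also have "\<dots> = 4 / \<delta>\<^sup>2" by (simp add: field_simps)
        finally have "exp (- inverse (s x - \<delta> / 2)) * (inverse (s x - \<delta> / 2))\<^sup>2 \<le> exp (- inverse (s x - \<delta> / 2)) * (4 / \<delta>\<^sup>2)"
          by (intro mult_left_mono) auto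
        then show ?thesis using t \<delta>(1) by (simp add: b_def b'_def flat_fun_def mult.commute)
      qed
      then have "b' x * (\<bar>C2\<bar> * norm (u x)) \<le> 4 / \<delta>\<^sup>2 * b x * (\<bar>C2\<bar> * norm (u x))"
        by (intro mult_right_mono) auto
      then have "b x * (L * norm (u x)) + b' x * (\<bar>C2\<bar> * norm (u x)) \<le> Q * (b x * norm (u x))"
        by (simp add: Q_def algebra_simps)
      then have "?e * (b x * (L * norm (u x)) + b' x * (\<bar>C2\<bar> * norm (u x))) \<le> ?e * (Q * (b x * norm (u x)))"
        by (intro mult_left_mono) auto
      with X have "norm ?X \<le> ?e * (Q * (b x * norm (u x)))" by (rule order_trans)
      also have "\<dots> = Q * norm (v \<tau> x)"
        using xK(2) b0 by (simp add: v_def G_def b_def s_def flat_fun_nonneg)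
      finally have "(norm ?X)\<^sup>2 \<le> (Q * norm (v \<tau> x))\<^sup>2" by (intro power_mono) auto
      then show ?thesis by (simp add: f_def power_mult_distrib add_increasing2)
    next
      case False
      have b'B: "b' x \<le> B"
      proof (cases "s x > \<delta> / 2")
        case True
        then have "b' x \<le> fact 4 * (s x - \<delta> / 2)\<^sup>2"
          using flat_fun_bound[of "s x - \<delta> / 2" 2] by (simp add: b'_def)
        also have "\<dots> \<le> B" unfolding B_def using True False by (intro mult_left_mono power_mono) auto
        finally show ?thesis .
      qed (simp add: b'_def B_def flat_fun_def)
      have "b x * (L * norm (u x)) + b' x * (\<bar>C2\<bar> * norm (u x)) \<le> 1 * (L * \<bar>U\<bar>) + B * (\<bar>C2\<bar> * \<bar>U\<bar>)"
        using b0 b'B U[OF xK(1)] L(1) by (intro add_mono mult_mono) (auto simp: B_def)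
      also have "\<dots> = Q2" by (simp add: Q2_def algebra_simps)
      finally have 1: "b x * (L * norm (u x)) + b' x * (\<bar>C2\<bar> * norm (u x)) \<le> Q2" .
      have "s x \<ge> 0" using s_K'(1)[OF x] \<delta>(1) by simp
      then have "(s x)\<^sup>2 \<le> \<delta>\<^sup>2" using False by (intro power_mono) auto
      then have "?e \<le> exp (\<tau> * \<delta>\<^sup>2 / 2)" using \<tau> by simp
      with 1 X have "norm ?X \<le> exp (\<tau> * \<delta>\<^sup>2 / 2) * Q2"
        by (elim order_trans, intro mult_mono) (auto intro!: add_nonneg_nonneg mult_nonneg_nonneg b0 L(1))
      then have "(norm ?X)\<^sup>2 \<le> (exp (\<tau> * \<delta>\<^sup>2 / 2) * Q2)\<^sup>2" by (intro power_mono) auto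
      also have "\<dots> = exp (\<tau> * \<delta>\<^sup>2) * Q2\<^sup>2"
        by (simp add: power_mult_distrib flip: exp_double)
      finally show ?thesis using x by (simp add: f_def add_increasing)
    qed
  qed
  have vi: "integrable lborel (\<lambda>x. (norm (v \<tau> x))\<^sup>2)" for \<tau>
    by (rule integrable_compact_support[OF K'])
      (use v0 Ck_on_continuous[OF v_Ck] in \<open>auto intro!: continuous_intros intro: continuous_on_subset\<close>)
  have Ki: "integrable lborel (indicator K' :: 'a \<Rightarrow> real)"
    using emeasure_compact_finite[OF K'] K' by (intro integrable_real_indicator) (auto simp: borel_compact)
  define I where "I \<tau> = integral\<^sup>L lborel (\<lambda>x. (norm (v \<tau> x))\<^sup>2)" for \<tau>
  have I0: "I \<tau> \<ge> 0" for \<tau> unfolding I_def by simp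
  define M where "M = Q2\<^sup>2 * integral\<^sup>L lborel (indicator K' :: 'a \<Rightarrow> real)"
  have upper: "I \<tau> \<le> exp (\<tau> * \<delta>\<^sup>2) * M" if \<tau>: "\<tau> \<ge> \<tau>0" "c * \<tau> \<ge> Q\<^sup>2 + 1" for \<tau>
  proof -
    have fi: "integrable lborel (f \<tau>)" unfolding f_def[abs_def]
      by (intro Bochner_Integration.integrable_add integrable_mult_right vi Ki)
    have "c * \<tau> * I \<tau> \<le> integral\<^sup>L lborel (f \<tau>)"
      unfolding I_def
    proof (rule carleman[unfolded W.carleman_bound_def, rule_format, of K' s0 "v \<tau>" \<tau> "f \<tau>"], intro conjI ballI allI impI)
      show "\<bar>\<psi> x - s0\<bar> \<le> \<epsilon>" if "x \<in> K'" for x using s_K'[OF that] \<delta> by (simp add: s_def)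
      show "f \<tau> x \<ge> 0" for x by (simp add: f_def)
      show "(norm (symb x (\<lambda>j. pd (v \<tau>) j x) - (\<tau> * (\<psi> x - s0)) *\<^sub>R W.nrm x (v \<tau> x)))\<^sup>2 \<le> f \<tau> x"
        if "x \<in> K'" for x using Xf[OF that] e(2) \<tau>(1) by simp
    qed (use K' K'K v_Ck v0 \<tau> fi in auto)
    also have "\<dots> = Q\<^sup>2 * I \<tau> + exp (\<tau> * \<delta>\<^sup>2) * M"
      unfolding f_def[abs_def] I_def M_def using vi Ki by simp
    finally have "(c * \<tau> - Q\<^sup>2) * I \<tau> \<le> exp (\<tau> * \<delta>\<^sup>2) * M" by (simp add: algebra_simps)
    moreover have "1 * I \<tau> \<le> (c * \<tau> - Q\<^sup>2) * I \<tau>" using \<tau>(2) I0 by (intro mult_right_mono) auto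
    ultimately show ?thesis by simp
  qed
  have zero': "u x1 = 0" if x1: "x1 \<in> \<Omega>" "s x1 > 2 * \<delta>" for x1
  proof (rule ccontr)
    assume "u x1 \<noteq> 0"
    define m where "m = norm (u x1) / 2"
    have m: "m > 0" using \<open>u x1 \<noteq> 0\<close> by (simp add: m_def)
    have cs: "continuous_on UNIV s" unfolding s_def[abs_def] using Ck_on_continuous[OF \<psi>_Ck[of UNIV 0]]
      by (intro continuous_intros) auto
    have "open (\<Omega> \<inter> (\<lambda>x. norm (u x)) -` {m<..})"
      using Ck_on_continuous[OF u] open_dom by (intro continuous_open_preimage continuous_intros) auto
    moreover have "open {x. s x > 2 * \<delta>}" using cs by (intro open_Collect_less continuous_intros)
    ultimately have "open (\<Omega> \<inter> (\<lambda>x. norm (u x)) -` {m<..} \<inter> {x. s x > 2 * \<delta>})" by (rule open_Int)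
    moreover have "x1 \<in> \<Omega> \<inter> (\<lambda>x. norm (u x)) -` {m<..} \<inter> {x. s x > 2 * \<delta>}"
      using x1 \<open>u x1 \<noteq> 0\<close> by (simp add: m_def)
    ultimately obtain \<eta> where \<eta>: "\<eta> > 0" and ball: "ball x1 \<eta> \<subseteq> \<Omega> \<inter> (\<lambda>x. norm (u x)) -` {m<..} \<inter> {x. s x > 2 * \<delta>}"
      by (meson open_contains_ball)
    define b1 where "b1 = flat_fun 0 (3 * \<delta> / 2)"
    have b1: "b1 > 0" using \<delta>(1) by (simp add: b1_def flat_fun_def)
    define V where "V = measure lborel (ball x1 \<eta>)"
    have V: "V > 0" using \<eta> by (simp add: V_def content_ball_pos)
    have lower: "exp (\<tau> * (2 * \<delta>)\<^sup>2) * (b1 * m)\<^sup>2 * V \<le> I \<tau>" if \<tau>: "\<tau> > 0" for \<tau>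
    proof -
      have "exp (\<tau> * (2 * \<delta>)\<^sup>2) * (b1 * m)\<^sup>2 * indicator (ball x1 \<eta>) x \<le> (norm (v \<tau> x))\<^sup>2" for x
      proof (cases "x \<in> ball x1 \<eta>")
        case True
        then have x: "x \<in> \<Omega>" "norm (u x) > m" "s x > 2 * \<delta>" using ball by auto
        have "b1 \<le> b x" unfolding b1_def b_def using x(3) by (intro flat_fun_mono) simp
        then have 1: "(b1 * m)\<^sup>2 \<le> (b x * norm (u x))\<^sup>2"
          using b1 m x(2) by (intro power_mono mult_mono) auto
        have "(2 * \<delta>)\<^sup>2 \<le> (s x)\<^sup>2" using x(3) \<delta>(1) by (intro power_mono) auto
        then have 2: "exp (\<tau> * (2 * \<delta>)\<^sup>2) \<le> exp (\<tau> * (s x)\<^sup>2)" using \<tau> by simp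
        have "(norm (v \<tau> x))\<^sup>2 = exp (\<tau> * (s x)\<^sup>2) * (b x * norm (u x))\<^sup>2"
          using x(1) by (simp add: v_def G_def b_def s_def power_mult_distrib flip: exp_double)
        then show ?thesis using True mult_mono[OF 2 1] by simp
      qed simp
      then have "integral\<^sup>L lborel (\<lambda>x. exp (\<tau> * (2 * \<delta>)\<^sup>2) * (b1 * m)\<^sup>2 * indicator (ball x1 \<eta>) x) \<le> I \<tau>"
        unfolding I_def using emeasure_lborel_ball_finite
        by (intro integral_mono integrable_mult_right integrable_real_indicator vi) auto
      then show ?thesis by (simp add: V_def)
    qed
    define P where "P = (b1 * m)\<^sup>2 * V"
    have P: "P > 0" using b1 m V by (simp add: P_def)
    \<comment> \<open>Beyond the last threshold, \<open>exp (3 \<delta>\<^sup>2 \<tau>) P \<le> M\<close> fails already by \<open>1 + t \<le> exp t\<close>.\<close>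
    define \<tau> where "\<tau> = max (max \<tau>0 ((Q\<^sup>2 + 1) / c)) (\<bar>M\<bar> / (3 * \<delta>\<^sup>2 * P))"
    have \<tau>: "\<tau> \<ge> \<tau>0" "\<tau> > 0" "c * \<tau> \<ge> Q\<^sup>2 + 1" "3 * \<delta>\<^sup>2 * P * \<tau> \<ge> \<bar>M\<bar>"
    proof -
      have "\<tau> \<ge> (Q\<^sup>2 + 1) / c" "\<tau> \<ge> \<bar>M\<bar> / (3 * \<delta>\<^sup>2 * P)" by (auto simp: \<tau>_def)
      then show "c * \<tau> \<ge> Q\<^sup>2 + 1" "3 * \<delta>\<^sup>2 * P * \<tau> \<ge> \<bar>M\<bar>" using e(3) P \<delta>(1)
        by (simp_all add: divide_le_eq mult.commute)
    qed (use e(2) in \<open>auto simp: \<tau>_def\<close>)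
    have "exp (\<tau> * \<delta>\<^sup>2) * (exp (3 * \<delta>\<^sup>2 * \<tau>) * P) \<le> exp (\<tau> * \<delta>\<^sup>2) * M"
      using lower[OF \<tau>(2)] upper[OF \<tau>(1,3)] by (simp add: P_def power_mult_distrib mult_ac flip: exp_add)
    then have "exp (3 * \<delta>\<^sup>2 * \<tau>) * P \<le> M" by simp
    moreover have "(1 + 3 * \<delta>\<^sup>2 * \<tau>) * P \<le> exp (3 * \<delta>\<^sup>2 * \<tau>) * P"
      using P exp_ge_add_one_self by (intro mult_right_mono) auto
    ultimately show False using \<tau>(4) P by (simp add: algebra_simps)
  qed
  define r' where "r' = sqrt (r\<^sup>2 + 2 * \<delta>)"
  have "r < r'" unfolding r'_def using r \<delta>(1) by (intro real_less_rsqrt) auto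
  moreover have r'R: "r' \<le> R" unfolding r'_def using r \<delta> by (intro real_le_lsqrt) auto
  moreover have "u x = 0" if "x \<in> ball q r'" for x
  proof (rule zero')
    have n: "norm (x - q) < r'" using that by (simp add: dist_norm norm_minus_commute)
    then show "x \<in> \<Omega>" using r'R R by (auto simp: subset_iff dist_norm norm_minus_commute)
    have "(norm (x - q))\<^sup>2 < r'\<^sup>2" using n by (intro power_strict_mono) auto
    also have "r'\<^sup>2 = r\<^sup>2 + 2 * \<delta>" using \<delta>(1) by (simp add: r'_def)
    finally show "s x > 2 * \<delta>" unfolding s_eq by argo
  qed
  ultimately show ?thesis by blast
qed

text \<open>
  The supremum of the radii of balls of zeros is attained, and \<open>zero_ball_enlarge\<close> excludes that it
  is smaller than \<open>R\<close>.
\<close>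

theorem unique_continuation_ball:
  assumes R: "cball q R \<subseteq> \<Omega>" and r: "0 < r"
    and u: "Ck_on 2 \<Omega> u" and L: "L \<ge> 0" "\<And>x. x \<in> \<Omega> \<Longrightarrow> norm (symb x (\<lambda>j. pd u j x)) \<le> L * norm (u x)"
    and zero: "\<And>x. x \<in> ball q r \<Longrightarrow> u x = 0"
    and x: "x \<in> ball q R"
  shows "u x = 0"
proof (cases "r < R")
  case True
  define S where "S = {t. r \<le> t \<and> t \<le> R \<and> (\<forall>x\<in>ball q t. u x = 0)}"
  have S: "r \<in> S" "bdd_above S" using True zero by (auto simp: S_def intro: bdd_aboveI)
  define t where "t = Sup S"
  have rt: "r \<le> t" unfolding t_def by (rule cSup_upper[OF S])
  have tR: "t \<le> R" unfolding t_def using S by (intro cSup_least) (auto simp: S_def)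
  have zt: "u y = 0" if "y \<in> ball q t" for y
  proof -
    have "dist q y < Sup S" using that by (simp add: t_def)
    then obtain t' where "t' \<in> S" "dist q y < t'" using S by (metis less_cSup_iff empty_iff)
    then show ?thesis by (simp add: S_def)
  qed
  have "t = R"
  proof (rule ccontr)
    assume "t \<noteq> R"
    then have "t < R" using tR by simp
    then obtain t' where t': "t' > t" "t' \<le> R" "\<forall>x\<in>ball q t'. u x = 0"
      using zero_ball_enlarge[OF R _ _ u L zt] r rt by (meson less_le_trans)
    then have "t' \<in> S" using rt by (simp add: S_def)
    then have "t' \<le> t" unfolding t_def by (rule cSup_upper[OF _ S(2)])
    with t'(1) show False by simp
  qed
  with zt x show ?thesis by simp
qed (use zero x in auto)

end

section \<open>Relations in the Clifford algebra\<close>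

lemma monomial_carrier: "set w \<subseteq> V \<Longrightarrow> monomial a w \<in> carrier (free_algebra V)"
  by (auto simp: monomial_def free_algebra_def split: if_splits)

lemma free_algebra_mult_monomial:
  "monomial a v \<otimes>\<^bsub>free_algebra V\<^esub> monomial b w = monomial (a * b) (v @ w)"
proof
  fix u :: "'a list"
  have "(\<Sum>k\<le>length u. monomial a v (take k u) * monomial b w (drop k u)) =
        (\<Sum>k\<le>length u. if k = length v then (if u = v @ w then a * b else 0) else 0)"
  proof (rule sum.cong[OF refl])
    fix k assume k: "k \<in> {..length u}"
    then show "monomial a v (take k u) * monomial b w (drop k u) =
      (if k = length v then (if u = v @ w then a * b else 0) else 0)"
    proof (cases "k = length v")
      case True
      then show ?thesis
        using append_eq_conv_conj[of v w u] by (auto simp: monomial_def)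
    next
      case False
      then have "take k u \<noteq> v" using k by auto
      then show ?thesis using False by (simp add: monomial_def)
    qed
  qed
  also have "\<dots> = monomial (a * b) (v @ w) u" by (simp add: monomial_def)
  finally show "(monomial a v \<otimes>\<^bsub>free_algebra V\<^esub> monomial b w) u = monomial (a * b) (v @ w) u"
    by (simp add: free_algebra_def)
qed

locale clifford_data =
  fixes pl :: "'t \<Rightarrow> 't \<Rightarrow> 't" and sc :: "real \<Rightarrow> 't \<Rightarrow> 't" and V :: "'t set" and q :: "'t \<Rightarrow> 't \<Rightarrow> real"
  assumes pl_closed: "\<And>v w. v \<in> V \<Longrightarrow> w \<in> V \<Longrightarrow> pl v w \<in> V"
    and sc_closed: "\<And>a v. v \<in> V \<Longrightarrow> sc a v \<in> V"
begin

abbreviation (input) "CA \<equiv> clifford_algebra pl sc V q"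
abbreviation (input) "CP \<equiv> clifford_product pl sc V q"

lemma relations_carrier: "clifford_relations pl sc V q \<subseteq> carrier (free_algebra V)"
proof -
  interpret ring "free_algebra V" by (rule ring_free_algebra)
  have fin: "finite {u. f u - g u \<noteq> 0}" if "finite {u. f u \<noteq> 0}" "finite {u. g u \<noteq> 0}" for f g :: "'t list \<Rightarrow> real"
    by (rule finite_subset[OF _ finite_UnI[OF that]]) auto
  have fin': "finite {u. f u + g u \<noteq> 0}" if "finite {u. f u \<noteq> 0}" "finite {u. g u \<noteq> 0}" for f g :: "'t list \<Rightarrow> real"
    by (rule finite_subset[OF _ finite_UnI[OF that]]) auto
  have m: "finite {u. monomial a w u \<noteq> 0}" for a and w :: "'t list"
    by (rule finite_subset[of _ "{w}"]) (auto simp: monomial_def)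
  have z: "monomial a w u = 0" if "set w \<subseteq> V" "\<not> set u \<subseteq> V" for a and w u :: "'t list"
    using that by (auto simp: monomial_def)
  show ?thesis
    unfolding clifford_relations_def free_algebra_def
    by (auto simp del: monomial_def intro!: fin fin' m) (fastforce simp: monomial_def pl_closed sc_closed split: if_splits)+
qed

lemma ideal_clifford: "ideal (clifford_ideal pl sc V q) (free_algebra V)"
  unfolding clifford_ideal_def
  by (rule ring.genideal_ideal[OF ring_free_algebra relations_carrier])

text \<open>
  The generators of the ideal are given as pointwise differences, and a coset is determined by any
  of its members; in this form a defining relation becomes an equation without additive inverses.
\<close>

lemma coset_eqI:
  assumes "x \<in> carrier (free_algebra V)" "(\<lambda>u. y u - x u) \<in> clifford_relations pl sc V q"
  shows "clifford_ideal pl sc V q +>\<^bsub>free_algebra V\<^esub> x = clifford_ideal pl sc V q +>\<^bsub>free_algebra V\<^esub> y"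
proof -
  interpret ideal "clifford_ideal pl sc V q" "free_algebra V" by (rule ideal_clifford)
  have "(\<lambda>u. y u - x u) \<in> clifford_ideal pl sc V q"
    using ring.genideal_self[OF ring_free_algebra relations_carrier] assms(2) unfolding clifford_ideal_def by blast
  moreover have "y = (\<lambda>u. y u - x u) \<oplus>\<^bsub>free_algebra V\<^esub> x" by (simp add: free_algebra_def)
  ultimately have "y \<in> clifford_ideal pl sc V q +>\<^bsub>free_algebra V\<^esub> x"
    unfolding a_r_coset_def' by blast
  then show ?thesis using assms(1) by (intro a_repr_independence a_subgroup)
qed

lemma clifford_product_carrier: "set w \<subseteq> V \<Longrightarrow> CP a w \<in> carrier CA"
proof -
  assume "set w \<subseteq> V"
  interpret ideal "clifford_ideal pl sc V q" "free_algebra V" by (rule ideal_clifford)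
  show ?thesis
    unfolding clifford_product_def clifford_algebra_def FactRing_def
    using a_rcosetsI[OF a_subset monomial_carrier[OF \<open>set w \<subseteq> V\<close>]] by simp
qed

lemma clifford_product_mult:
  assumes "set v \<subseteq> V" "set w \<subseteq> V"
  shows "CP a v \<otimes>\<^bsub>CA\<^esub> CP b w = CP (a * b) (v @ w)"
proof -
  interpret ideal "clifford_ideal pl sc V q" "free_algebra V" by (rule ideal_clifford)
  show ?thesis
    unfolding clifford_product_def clifford_algebra_def FactRing_def
    by (simp add: rcoset_mult_add monomial_carrier assms free_algebra_mult_monomial)
qed

lemma clifford_product_add:
  assumes "v \<in> V" "w \<in> V"
  shows "CP 1 [pl v w] = CP 1 [v] \<oplus>\<^bsub>CA\<^esub> CP 1 [w]"
proof -
  interpret ideal "clifford_ideal pl sc V q" "free_algebra V" by (rule ideal_clifford)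
  let ?s = "monomial 1 [v] \<oplus>\<^bsub>free_algebra V\<^esub> monomial 1 [w]"
  have c: "monomial 1 [v] \<in> carrier (free_algebra V)" "monomial 1 [w] \<in> carrier (free_algebra V)"
    using assms by (auto intro!: monomial_carrier)
  have "CP 1 [v] \<oplus>\<^bsub>CA\<^esub> CP 1 [w] = clifford_ideal pl sc V q +>\<^bsub>free_algebra V\<^esub> ?s"
    unfolding clifford_product_def clifford_algebra_def FactRing_def using c by (simp add: a_rcos_sum)
  also have "\<dots> = CP 1 [pl v w]"
    unfolding clifford_product_def
  proof (rule coset_eqI)
    show "?s \<in> carrier (free_algebra V)" using c by (rule a_closed)
    have "(\<lambda>u. monomial 1 [pl v w] u - ?s u) = (\<lambda>u. monomial 1 [pl v w] u - monomial 1 [v] u - monomial 1 [w] u)"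
      by (auto simp: free_algebra_def)
    also have "\<dots> \<in> clifford_relations pl sc V q" using assms by (auto simp: clifford_relations_def)
    finally show "(\<lambda>u. monomial 1 [pl v w] u - ?s u) \<in> clifford_relations pl sc V q" .
  qed
  finally show ?thesis ..
qed

lemma clifford_product_scale:
  assumes "v \<in> V"
  shows "CP 1 [sc a v] = CP a [] \<otimes>\<^bsub>CA\<^esub> CP 1 [v]"
proof -
  have "CP a [v] = CP 1 [sc a v]"
    unfolding clifford_product_def
    by (rule coset_eqI) (use assms in \<open>auto intro!: monomial_carrier simp: clifford_relations_def\<close>)
  then show ?thesis using clifford_product_mult[of "[]" "[v]" a 1] assms by simp
qed

lemma clifford_product_square:
  assumes "v \<in> V"
  shows "CP 1 [v] \<otimes>\<^bsub>CA\<^esub> CP 1 [v] = CP (- q v v) []"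
proof -
  have "CP (- q v v) [] = CP 1 [v, v]"
    unfolding clifford_product_def
  proof (rule coset_eqI)
    have "(\<lambda>u. monomial 1 [v, v] u - monomial (- q v v) [] u) = (\<lambda>u. monomial 1 [v, v] u + monomial (q v v) [] u)"
      by (auto simp: monomial_def)
    also have "\<dots> \<in> clifford_relations pl sc V q" using assms by (auto simp: clifford_relations_def)
    finally show "(\<lambda>u. monomial 1 [v, v] u - monomial (- q v v) [] u) \<in> clifford_relations pl sc V q" .
  qed (simp add: monomial_carrier)
  then show ?thesis using clifford_product_mult[of "[v]" "[v]" 1 1] assms by simp
qed

end


section \<open>Charts, coordinate fields and cutoff functions\<close>

context smooth_manifold
begin

lemma chart_open: "\<kappa> \<in> \<A> \<Longrightarrow> open (chart_dom \<kappa>)" "\<kappa> \<in> \<A> \<Longrightarrow> open (chart_map \<kappa> ` chart_dom \<kappa>)"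
  using atlas_homeo by auto

lemma chart_inv_map [simp]: "\<kappa> \<in> \<A> \<Longrightarrow> x \<in> chart_dom \<kappa> \<Longrightarrow> chart_inv \<kappa> (chart_map \<kappa> x) = x"
  using atlas_homeo by (meson homeomorphism_apply1)

lemma chart_cont: "\<kappa> \<in> \<A> \<Longrightarrow> continuous_on (chart_dom \<kappa>) (chart_map \<kappa>)"
  "\<kappa> \<in> \<A> \<Longrightarrow> continuous_on (chart_map \<kappa> ` chart_dom \<kappa>) (chart_inv \<kappa>)"
  using atlas_homeo by (meson homeomorphism_cont1, meson homeomorphism_cont2)

lemma chart_image_eq:
  assumes "\<kappa> \<in> \<A>"
  shows "chart_map \<kappa> ` (U \<inter> chart_dom \<kappa>) = {y \<in> chart_map \<kappa> ` chart_dom \<kappa>. chart_inv \<kappa> y \<in> U}"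
proof (rule equalityI; rule subsetI)
  fix y assume "y \<in> {y \<in> chart_map \<kappa> ` chart_dom \<kappa>. chart_inv \<kappa> y \<in> U}"
  then show "y \<in> chart_map \<kappa> ` (U \<inter> chart_dom \<kappa>)"
    using assms by (intro image_eqI[of _ _ "chart_inv \<kappa> y"]) auto
qed (use assms in auto)

lemma chart_image_open:
  assumes "\<kappa> \<in> \<A>" "open U"
  shows "open (chart_map \<kappa> ` (U \<inter> chart_dom \<kappa>))"
proof -
  have "open (chart_map \<kappa> ` chart_dom \<kappa> \<inter> chart_inv \<kappa> -` U)"
    by (intro continuous_open_preimage chart_cont chart_open assms)
  then show ?thesis unfolding chart_image_eq[OF assms(1)] by (simp add: vimage_def Int_def)
qed

lemma transition_Ck:
  assumes "\<kappa> \<in> \<A>" "\<kappa>' \<in> \<A>"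
  shows "Ck_on k (chart_map \<kappa> ` (chart_dom \<kappa> \<inter> chart_dom \<kappa>')) (\<lambda>y. chart_map \<kappa>' (chart_inv \<kappa> y))"
  using atlas_compatible[OF assms] by (auto simp: smooth_on_def o_def)

lemma smooth_map_on_Ck:
  "smooth_map_on U f \<longleftrightarrow> (\<forall>\<kappa>\<in>\<A>. \<forall>k. Ck_on k (chart_map \<kappa> ` (U \<inter> chart_dom \<kappa>)) (\<lambda>y. f (chart_inv \<kappa> y)))"
  by (simp add: smooth_map_on_def smooth_on_def o_def)

lemma smooth_map_onD:
  "smooth_map_on U f \<Longrightarrow> \<kappa> \<in> \<A> \<Longrightarrow> Ck_on k (chart_map \<kappa> ` (U \<inter> chart_dom \<kappa>)) (\<lambda>y. f (chart_inv \<kappa> y))"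
  by (auto simp: smooth_map_on_Ck)

lemma smooth_map_on_subset: "smooth_map_on U f \<Longrightarrow> V \<subseteq> U \<Longrightarrow> smooth_map_on V f"
  unfolding smooth_map_on_Ck by (blast intro: Ck_on_subset)

lemma smooth_map_on_cong:
  assumes "open U" "\<And>x. x \<in> U \<Longrightarrow> f x = g x" "smooth_map_on U f"
  shows "smooth_map_on U g"
  unfolding smooth_map_on_Ck
proof (intro ballI allI)
  fix \<kappa> k assume \<kappa>: "\<kappa> \<in> \<A>"
  show "Ck_on k (chart_map \<kappa> ` (U \<inter> chart_dom \<kappa>)) (\<lambda>y. g (chart_inv \<kappa> y))"
    by (subst Ck_on_cong[OF chart_image_open[OF \<kappa> assms(1)], of _ "\<lambda>y. f (chart_inv \<kappa> y)"])
       (use assms smooth_map_onD[OF assms(3) \<kappa>] \<kappa> in auto)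
qed

lemma smooth_map_on_Un:
  assumes "open U" "open V" "smooth_map_on U f" "smooth_map_on V f"
  shows "smooth_map_on (U \<union> V) f"
  unfolding smooth_map_on_Ck Int_Un_distrib2 image_Un
  by (intro ballI allI Ck_on_Un chart_image_open assms smooth_map_onD)

lemma smooth_map_on_const: "smooth_map_on U (\<lambda>x. c)"
  by (simp add: smooth_map_on_Ck)

lemma smooth_map_on_bilinear:
  assumes "open U" "bounded_bilinear pr" "smooth_map_on U f" "smooth_map_on U g"
  shows "smooth_map_on U (\<lambda>x. pr (f x) (g x))"
  unfolding smooth_map_on_Ck
  by (intro ballI allI Ck_on_bilinear[OF _ assms(2)] chart_image_open assms smooth_map_onD)

lemma smooth_map_on_linear:
  assumes "open U" "bounded_linear L" "smooth_map_on U f"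
  shows "smooth_map_on U (\<lambda>x. L (f x))"
  unfolding smooth_map_on_Ck
  by (intro ballI allI Ck_on_bounded_linear[OF _ assms(2)] chart_image_open assms smooth_map_onD)

lemma smooth_map_on_extend_zero:
  assumes "open V" "closed K" "K \<subseteq> V" "smooth_map_on V f" "\<And>x. x \<notin> K \<Longrightarrow> f x = 0"
  shows "smooth_map_on UNIV f"
proof -
  have "smooth_map_on (- K) f"
    by (rule smooth_map_on_cong[OF _ _ smooth_map_on_const[of _ 0]]) (use assms in auto)
  then have "smooth_map_on (V \<union> - K) f" by (intro smooth_map_on_Un assms) (use assms in auto)
  then show ?thesis by (rule smooth_map_on_subset) (use assms(3) in auto)
qed

text \<open>By compatibility of the atlas, smoothness may be tested in a single chart.\<close>

lemma smooth_map_on_one_chart: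
  assumes \<kappa>: "\<kappa> \<in> \<A>" and U: "open U" "U \<subseteq> chart_dom \<kappa>"
    and f: "\<And>k. Ck_on k (chart_map \<kappa> ` U) (\<lambda>y. f (chart_inv \<kappa> y))"
  shows "smooth_map_on U f"
  unfolding smooth_map_on_Ck
proof (intro ballI allI)
  fix \<kappa>' k assume \<kappa>': "\<kappa>' \<in> \<A>"
  let ?S = "chart_map \<kappa>' ` (U \<inter> chart_dom \<kappa>')"
  have o: "open ?S" by (rule chart_image_open[OF \<kappa>' U(1)])
  have oU: "open (chart_map \<kappa> ` U)" using chart_image_open[OF \<kappa> U(1)] U(2) by (simp add: Int_absorb2)
  have t: "Ck_on k ?S (\<lambda>y. chart_map \<kappa> (chart_inv \<kappa>' y))"
    by (rule Ck_on_subset[OF transition_Ck[OF \<kappa>' \<kappa>]]) (use U(2) in auto)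
  have "Ck_on k ?S (\<lambda>y. f (chart_inv \<kappa> (chart_map \<kappa> (chart_inv \<kappa>' y))))"
    by (rule Ck_on_compose[OF o oU f t]) (use \<kappa>' in auto)
  then show "Ck_on k ?S (\<lambda>y. f (chart_inv \<kappa>' y))"
    by (subst (asm) Ck_on_cong[OF o, where g = "\<lambda>y. f (chart_inv \<kappa>' y)"]) (use \<kappa> \<kappa>' U(2) in auto)
qed

text \<open>
  The vector field with constant components \<open>a\<close> in the chart \<open>\<kappa>\<close>, that is \<open>\<Sum>\<^sub>i a\<^sub>i \<partial>\<^sub>i\<close>. Every tangent
  vector at a point of the chart is a value of such a field.
\<close>

definition coord_vec :: "('m, 'n) chart \<Rightarrow> real^'n \<Rightarrow> 'm \<Rightarrow> ('m, 'n) tangent" where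
  "coord_vec \<kappa> a x = (\<lambda>\<kappa>'. if \<kappa>' \<in> \<A> \<and> x \<in> chart_dom \<kappa>'
     then pd (\<lambda>y. chart_map \<kappa>' (chart_inv \<kappa> y)) a (chart_map \<kappa> x) else 0)"

lemma transition_derivative:
  assumes "\<kappa> \<in> \<A>" "\<kappa>' \<in> \<A>" "x \<in> chart_dom \<kappa>" "x \<in> chart_dom \<kappa>'"
  shows "((\<lambda>y. chart_map \<kappa>' (chart_inv \<kappa> y)) has_derivative
     (\<lambda>a. pd (\<lambda>y. chart_map \<kappa>' (chart_inv \<kappa> y)) a (chart_map \<kappa> x))) (at (chart_map \<kappa> x))"
  by (rule Ck_on_has_derivative[OF transition_Ck[OF assms(1,2), of "Suc 0"]]) (use assms in auto)

lemma coord_vec_self: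
  assumes "\<kappa> \<in> \<A>" "x \<in> chart_dom \<kappa>"
  shows "coord_vec \<kappa> a x \<kappa> = a"
proof -
  have "((\<lambda>y. chart_map \<kappa> (chart_inv \<kappa> y)) has_derivative (\<lambda>a. a)) (at (chart_map \<kappa> x))"
    by (rule has_derivative_transform_within_open[OF has_derivative_ident chart_open(2)[OF assms(1)]])
       (use assms in auto)
  from pd_eqI[OF this] show ?thesis using assms by (simp add: coord_vec_def)
qed

text \<open>
  The chain rule for the transition maps.
\<close>

lemma coord_vec_tangent:
  assumes \<kappa>: "\<kappa> \<in> \<A>" and x: "x \<in> chart_dom \<kappa>"
  shows "coord_vec \<kappa> a x \<in> tangent_space x"
proof -
  have "coord_vec \<kappa> a x \<kappa>'' = pd (\<lambda>y. chart_map \<kappa>'' (chart_inv \<kappa>' y)) (coord_vec \<kappa> a x \<kappa>') (chart_map \<kappa>' x)"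
    if k: "\<kappa>' \<in> \<A>" "\<kappa>'' \<in> \<A>" "x \<in> chart_dom \<kappa>'" "x \<in> chart_dom \<kappa>''" for \<kappa>' \<kappa>''
  proof -
    have "((\<lambda>y. chart_map \<kappa>'' (chart_inv \<kappa>' (chart_map \<kappa>' (chart_inv \<kappa> y)))) has_derivative
       (\<lambda>a. pd (\<lambda>y. chart_map \<kappa>'' (chart_inv \<kappa>' y)) (pd (\<lambda>y. chart_map \<kappa>' (chart_inv \<kappa> y)) a (chart_map \<kappa> x)) (chart_map \<kappa>' x)))
       (at (chart_map \<kappa> x))"
      by (rule has_derivative_compose[OF transition_derivative[OF \<kappa> k(1) x k(3)]])
         (use transition_derivative[OF k] \<kappa> x in simp)
    then have "((\<lambda>y. chart_map \<kappa>'' (chart_inv \<kappa> y)) has_derivative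
       (\<lambda>a. pd (\<lambda>y. chart_map \<kappa>'' (chart_inv \<kappa>' y)) (pd (\<lambda>y. chart_map \<kappa>' (chart_inv \<kappa> y)) a (chart_map \<kappa> x)) (chart_map \<kappa>' x)))
       (at (chart_map \<kappa> x))"
      by (rule has_derivative_transform_within_open[OF _ chart_image_open[OF \<kappa> chart_open(1)[OF k(1)]]])
         (use \<kappa> x k in auto)
    from pd_eqI[OF this] k show ?thesis by (simp add: coord_vec_def)
  qed
  note trans = this
  show ?thesis
    unfolding tangent_space_def mem_Collect_eq o_def
  proof (intro conjI ballI allI impI)
    show "coord_vec \<kappa> a x \<kappa>' = 0" if "\<not> (\<kappa>' \<in> \<A> \<and> x \<in> chart_dom \<kappa>')" for \<kappa>'
      using that by (auto simp: coord_vec_def)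
  qed (rule trans; simp)
qed

lemma tangent_eq_coord_vec:
  assumes "\<kappa> \<in> \<A>" "x \<in> chart_dom \<kappa>" "v \<in> tangent_space x"
  shows "v = coord_vec \<kappa> (v \<kappa>) x"
proof
  fix \<kappa>' show "v \<kappa>' = coord_vec \<kappa> (v \<kappa>) x \<kappa>'"
  proof (cases "\<kappa>' \<in> \<A> \<and> x \<in> chart_dom \<kappa>'")
    case True
    then have "v \<kappa>' = frechet_derivative (chart_map \<kappa>' \<circ> chart_inv \<kappa>) (at (chart_map \<kappa> x)) (v \<kappa>)"
      using assms unfolding tangent_space_def by blast
    with True show ?thesis by (simp add: coord_vec_def o_def)
  next
    case False
    then have "v \<kappa>' = 0" using assms(3) unfolding tangent_space_def by blast
    with False show ?thesis by (auto simp: coord_vec_def)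
  qed
qed

lemma coord_vec_add:
  assumes "\<kappa> \<in> \<A>" "x \<in> chart_dom \<kappa>"
  shows "tadd (coord_vec \<kappa> a x) (coord_vec \<kappa> b x) = coord_vec \<kappa> (a + b) x"
proof
  fix \<kappa>'
  show "tadd (coord_vec \<kappa> a x) (coord_vec \<kappa> b x) \<kappa>' = coord_vec \<kappa> (a + b) x \<kappa>'"
  proof (cases "\<kappa>' \<in> \<A> \<and> x \<in> chart_dom \<kappa>'")
    case True
    then interpret bounded_linear "\<lambda>a. pd (\<lambda>y. chart_map \<kappa>' (chart_inv \<kappa> y)) a (chart_map \<kappa> x)"
      using has_derivative_bounded_linear[OF transition_derivative[OF assms(1) _ assms(2), of \<kappa>']] by blast
    show ?thesis using True by (simp add: tadd_def coord_vec_def add)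
  qed (auto simp: tadd_def coord_vec_def)
qed

lemma coord_vec_scale:
  assumes "\<kappa> \<in> \<A>" "x \<in> chart_dom \<kappa>"
  shows "tscale t (coord_vec \<kappa> a x) = coord_vec \<kappa> (t *\<^sub>R a) x"
proof
  fix \<kappa>'
  show "tscale t (coord_vec \<kappa> a x) \<kappa>' = coord_vec \<kappa> (t *\<^sub>R a) x \<kappa>'"
  proof (cases "\<kappa>' \<in> \<A> \<and> x \<in> chart_dom \<kappa>'")
    case True
    then interpret bounded_linear "\<lambda>a. pd (\<lambda>y. chart_map \<kappa>' (chart_inv \<kappa> y)) a (chart_map \<kappa> x)"
      using has_derivative_bounded_linear[OF transition_derivative[OF assms(1) _ assms(2), of \<kappa>']] by blast
    show ?thesis using True by (simp add: tscale_def coord_vec_def scaleR)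
  qed (auto simp: tscale_def coord_vec_def)
qed

lemma chart_exists: "\<exists>\<kappa>\<in>\<A>. x \<in> chart_dom \<kappa>"
  using atlas_covers by auto

lemma tangent_closed:
  assumes "v \<in> tangent_space x" "w \<in> tangent_space x"
  shows "tadd v w \<in> tangent_space x" "tscale t v \<in> tangent_space x"
proof -
  obtain \<kappa> where \<kappa>: "\<kappa> \<in> \<A>" "x \<in> chart_dom \<kappa>" using chart_exists by blast
  have v: "v = coord_vec \<kappa> (v \<kappa>) x" and w: "w = coord_vec \<kappa> (w \<kappa>) x"
    using tangent_eq_coord_vec[OF \<kappa>] assms by auto
  show "tadd v w \<in> tangent_space x"
    by (subst v, subst w) (simp add: coord_vec_add[OF \<kappa>] coord_vec_tangent[OF \<kappa>])
  show "tscale t v \<in> tangent_space x"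
    by (subst v) (simp add: coord_vec_scale[OF \<kappa>] coord_vec_tangent[OF \<kappa>])
qed

lemma coord_vec_smooth:
  assumes \<kappa>: "\<kappa> \<in> \<A>" and U: "open U" "U \<subseteq> chart_dom \<kappa>"
  shows "smooth_vector_field_on U (coord_vec \<kappa> a)"
  unfolding smooth_vector_field_on_def
proof (intro conjI ballI)
  show "coord_vec \<kappa> a x \<in> tangent_space x" if "x \<in> U" for x
    using coord_vec_tangent[OF \<kappa>] that U by auto
  fix \<kappa>' assume \<kappa>': "\<kappa>' \<in> \<A>"
  let ?V = "U \<inter> chart_dom \<kappa>'"
  show "smooth_map_on ?V (\<lambda>x. coord_vec \<kappa> a x \<kappa>')"
  proof (rule smooth_map_on_one_chart[OF \<kappa>])
    show V: "open ?V" using U chart_open[OF \<kappa>'] by auto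
    show "?V \<subseteq> chart_dom \<kappa>" using U by auto
    fix k
    have o: "open (chart_map \<kappa> ` ?V)"
      using chart_image_open[OF \<kappa> V] Int_absorb2[of ?V "chart_dom \<kappa>"] U(2) by (simp add: le_infI1)
    have "Ck_on (Suc k) (chart_map \<kappa> ` ?V) (\<lambda>y. chart_map \<kappa>' (chart_inv \<kappa> y))"
      by (rule Ck_on_subset[OF transition_Ck[OF \<kappa> \<kappa>']]) (use U(2) in auto)
    then have "Ck_on k (chart_map \<kappa> ` ?V) (pd (\<lambda>y. chart_map \<kappa>' (chart_inv \<kappa> y)) a)"
      by (rule Ck_on_pd)
    then show "Ck_on k (chart_map \<kappa> ` ?V) (\<lambda>y. coord_vec \<kappa> a (chart_inv \<kappa> y) \<kappa>')"
      by (subst Ck_on_cong[OF o, where g = "pd (\<lambda>y. chart_map \<kappa>' (chart_inv \<kappa> y)) a"])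
         (use \<kappa> \<kappa>' U(2) in \<open>auto simp: coord_vec_def\<close>)
  qed
qed

text \<open>
  The chart picture of a closed ball is compact, hence closed in the manifold; this is the place
  where the Hausdorff property enters.
\<close>

lemma cutoff_exists:
  assumes \<kappa>: "\<kappa> \<in> \<A>" and V: "open V" and r: "r > 0" "cball p r \<subseteq> chart_map \<kappa> ` (V \<inter> chart_dom \<kappa>)"
  obtains \<theta> :: "'m \<Rightarrow> real" and K where "smooth_map_on UNIV \<theta>" "closed K" "K \<subseteq> V \<inter> chart_dom \<kappa>"
    "\<And>x. x \<notin> K \<Longrightarrow> \<theta> x = 0" "\<And>y. y \<in> ball p r \<Longrightarrow> \<theta> (chart_inv \<kappa> y) > 0"
proof -
  define K where "K = chart_inv \<kappa> ` cball p r"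
  have sub: "cball p r \<subseteq> chart_map \<kappa> ` chart_dom \<kappa>" using r(2) by auto
  have "compact K" unfolding K_def
    by (rule compact_continuous_image[OF continuous_on_subset[OF chart_cont(2)[OF \<kappa>] sub]]) simp
  then have K: "closed K" by (rule compact_imp_closed)
  have KV: "K \<subseteq> V \<inter> chart_dom \<kappa>"
    using r(2) \<kappa> by (auto simp: K_def chart_image_eq[OF \<kappa>])
  have oV: "open (V \<inter> chart_dom \<kappa>)" using V chart_open[OF \<kappa>] by auto
  define \<theta> where "\<theta> x = (if x \<in> chart_dom \<kappa> then flat_fun 0 (r\<^sup>2 - (chart_map \<kappa> x - p) \<bullet> (chart_map \<kappa> x - p)) else 0)" for x
  have chi0: "\<theta> x = 0" if "x \<notin> K" for x
  proof (cases "x \<in> chart_dom \<kappa>")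
    case True
    then have "chart_map \<kappa> x \<notin> cball p r" using that \<kappa> by (auto simp: K_def image_iff) (metis chart_inv_map mem_cball)
    then have "r \<le> norm (chart_map \<kappa> x - p)" by (simp add: dist_norm norm_minus_commute)
    then have "r\<^sup>2 \<le> (norm (chart_map \<kappa> x - p))\<^sup>2" using r(1) by (intro power_mono) auto
    then show ?thesis by (simp add: \<theta>_def flat_fun_def power2_norm_eq_inner)
  qed (simp add: \<theta>_def)
  have "smooth_map_on (V \<inter> chart_dom \<kappa>) \<theta>"
  proof (rule smooth_map_on_one_chart[OF \<kappa> oV])
    fix k
    let ?S = "chart_map \<kappa> ` (V \<inter> chart_dom \<kappa>)"
    have o: "open ?S" by (rule chart_image_open[OF \<kappa> V])
    have "Ck_on k ?S (\<lambda>y. flat_fun 0 (r\<^sup>2 - (y - p) \<bullet> (y - p)))"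
      by (rule Ck_on_compose[OF o open_UNIV Ck_on_flat_fun])
         (intro Ck_on_diff Ck_on_inner Ck_on_linear[OF _ bounded_linear_ident] Ck_on_const o, simp)
    then show "Ck_on k ?S (\<lambda>y. \<theta> (chart_inv \<kappa> y))"
      by (subst Ck_on_cong[OF o, where g = "\<lambda>y. flat_fun 0 (r\<^sup>2 - (y - p) \<bullet> (y - p))"])
         (use \<kappa> in \<open>auto simp: \<theta>_def\<close>)
  qed auto
  then have "smooth_map_on UNIV \<theta>" by (rule smooth_map_on_extend_zero[OF oV K KV _ chi0])
  moreover have "\<theta> (chart_inv \<kappa> y) > 0" if y: "y \<in> ball p r" for y
  proof -
    have "(norm (y - p))\<^sup>2 < r\<^sup>2" using y r(1) by (intro power_strict_mono) (auto simp: dist_norm norm_minus_commute)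
    moreover have "y \<in> chart_map \<kappa> ` chart_dom \<kappa>" using y sub by auto
    ultimately show ?thesis using \<kappa> by (auto simp: \<theta>_def flat_fun_def power2_norm_eq_inner)
  qed
  ultimately show ?thesis using that K KV chi0 by blast
qed

end

section \<open>Local form of a connection\<close>

lemma of_real_smult: "complex_of_real a *s (z :: complex^'r) = a *\<^sub>R z"
  by (simp add: vec_eq_iff) (simp add: scaleR_conv_of_real)

lemma Ck_on_empty: "Ck_on k {} f"
  by (induction k arbitrary: f) auto

lemma norm_smult_complex: "norm (a *s (z :: complex^'r)) = norm a * norm z"
  by (simp add: norm_vec_def norm_mult L2_set_right_distrib)

lemma bounded_bilinear_smult: "bounded_bilinear (\<lambda>a (z :: complex^'r). a *s z)"
proof
  show "\<exists>K. \<forall>a z. norm (a *s (z :: complex^'r)) \<le> norm a * norm z * K"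
    by (intro exI[of _ 1]) (simp add: norm_smult_complex)
qed (auto simp: vec_eq_iff algebra_simps)

context smooth_manifold
begin

lemma smooth_map_on_add:
  assumes "open U" "smooth_map_on U f" "smooth_map_on U g"
  shows "smooth_map_on U (\<lambda>x. f x + g x)"
  unfolding smooth_map_on_Ck
  by (intro ballI allI Ck_on_add chart_image_open assms smooth_map_onD)

end

context complex_vector_bundle
begin

text \<open>
  The inverse trivialization: the local section with constant components \<open>z\<close>.
\<close>

definition lift :: "('m \<Rightarrow> 'v \<Rightarrow> complex^'r) \<Rightarrow> complex^'r \<Rightarrow> 'm \<Rightarrow> 'v" where
  "lift \<phi> z x = inv_into (E x) (\<phi> x) z"

context
  fixes U :: "'m set" and \<phi> :: "'m \<Rightarrow> 'v \<Rightarrow> complex^'r"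
  assumes triv: "(U, \<phi>) \<in> \<T>"
begin

lemma lift_in: "x \<in> U \<Longrightarrow> lift \<phi> z x \<in> E x"
  unfolding lift_def using triv_bij[OF triv] by (metis UNIV_I bij_betw_imp_surj_on inv_into_into)

lemma triv_lift: "x \<in> U \<Longrightarrow> \<phi> x (lift \<phi> z x) = z"
  unfolding lift_def using triv_bij[OF triv] by (metis UNIV_I bij_betw_imp_surj_on f_inv_into_f)

lemma lift_triv: "x \<in> U \<Longrightarrow> s \<in> E x \<Longrightarrow> lift \<phi> (\<phi> x s) x = s"
  unfolding lift_def using triv_bij[OF triv] by (metis bij_betw_imp_inj_on inv_into_f_f)

lemma triv_inj: "x \<in> U \<Longrightarrow> s \<in> E x \<Longrightarrow> t \<in> E x \<Longrightarrow> \<phi> x s = \<phi> x t \<Longrightarrow> s = t"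
  by (metis lift_triv)

lemma triv_add: "x \<in> U \<Longrightarrow> s \<in> E x \<Longrightarrow> t \<in> E x \<Longrightarrow> \<phi> x (s + t) = \<phi> x s + \<phi> x t"
  using triv_linear[OF triv, of x s t 1 1] by simp

lemma triv_scale: "x \<in> U \<Longrightarrow> s \<in> E x \<Longrightarrow> \<phi> x (a \<cdot> s) = a *s \<phi> x s"
  using triv_linear[OF triv, of x s s a 0] by simp

lemma triv_zero: "x \<in> U \<Longrightarrow> \<phi> x 0 = 0"
  using triv_scale[of x 0 0] subspace_0[OF fibre_subspace[of x]] by simp

lemma triv_sum: "x \<in> U \<Longrightarrow> (\<And>i. i \<in> I \<Longrightarrow> s i \<in> E x) \<Longrightarrow> \<phi> x (\<Sum>i\<in>I. s i) = (\<Sum>i\<in>I. \<phi> x (s i))"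
  by (induction I rule: infinite_finite_induct)
     (auto simp: triv_zero triv_add subspace_sum[OF fibre_subspace])

lemma triv_eq_0_iff: "x \<in> U \<Longrightarrow> s \<in> E x \<Longrightarrow> \<phi> x s = 0 \<longleftrightarrow> s = 0"
  using triv_inj[of x s 0] triv_zero[of x] subspace_0[OF fibre_subspace[of x]] by auto

lemma lift_add: "x \<in> U \<Longrightarrow> lift \<phi> (a + b) x = lift \<phi> a x + lift \<phi> b x"
  by (rule triv_inj) (auto simp: triv_lift triv_add lift_in subspace_add[OF fibre_subspace])

lemma lift_scale: "x \<in> U \<Longrightarrow> lift \<phi> (c *s a) x = c \<cdot> lift \<phi> a x"
  by (rule triv_inj) (auto simp: triv_lift triv_scale lift_in subspace_scale[OF fibre_subspace])

lemma lift_expansion: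
  assumes x: "x \<in> U" and s: "s \<in> E x"
  shows "s = (\<Sum>b\<in>UNIV. (\<phi> x s $ b) \<cdot> lift \<phi> (axis b 1) x)"
proof (rule triv_inj[OF x s])
  have "\<phi> x (\<Sum>b\<in>UNIV. (\<phi> x s $ b) \<cdot> lift \<phi> (axis b 1) x) = (\<Sum>b\<in>UNIV. (\<phi> x s $ b) *s axis b 1)"
    using x by (subst triv_sum)
      (auto intro!: subspace_scale[OF fibre_subspace] lift_in simp: triv_scale lift_in triv_lift)
  then show "\<phi> x s = \<phi> x (\<Sum>b\<in>UNIV. (\<phi> x s $ b) \<cdot> lift \<phi> (axis b 1) x)"
    by (simp add: basis_expansion)
qed (use x in \<open>auto intro!: subspace_sum[OF fibre_subspace] subspace_scale[OF fibre_subspace] lift_in\<close>)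

lemma smooth_lift: "smooth_section_on U (lift \<phi> z)"
  unfolding smooth_section_on_def
  using triv_compatible[OF triv] lift_in by (auto simp: lift_def)

lemma smooth_section_triv: "smooth_section_on V s \<Longrightarrow> smooth_map_on (V \<inter> U) (\<lambda>x. \<phi> x (s x))"
  unfolding smooth_section_on_def using triv by fast

end

lemma smooth_section_on_in: "smooth_section_on V s \<Longrightarrow> x \<in> V \<Longrightarrow> s x \<in> E x"
  by (simp add: smooth_section_on_def)

lemma smooth_section_on_subset: "smooth_section_on V s \<Longrightarrow> W \<subseteq> V \<Longrightarrow> smooth_section_on W s"
  unfolding smooth_section_on_def by (auto intro: smooth_map_on_subset)

lemma smooth_section_onI:
  assumes "\<And>x. x \<in> V \<Longrightarrow> s x \<in> E x"
    and "\<And>U \<phi>. (U, \<phi>) \<in> \<T> \<Longrightarrow> smooth_map_on (V \<inter> U) (\<lambda>x. \<phi> x (s x))"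
  shows "smooth_section_on V s"
  using assms unfolding smooth_section_on_def by auto

lemma smooth_section_on_add:
  assumes "open V" "smooth_section_on V s" "smooth_section_on V t"
  shows "smooth_section_on V (\<lambda>x. s x + t x)"
proof (rule smooth_section_onI)
  show "s x + t x \<in> E x" if "x \<in> V" for x
    using smooth_section_on_in[OF assms(2) that] smooth_section_on_in[OF assms(3) that]
    by (rule subspace_add[OF fibre_subspace])
  fix U \<phi> assume triv: "(U, \<phi>) \<in> \<T>"
  have o: "open (V \<inter> U)" using assms(1) triv_open[OF triv] by auto
  show "smooth_map_on (V \<inter> U) (\<lambda>x. \<phi> x (s x + t x))"
    by (rule smooth_map_on_cong[OF o _ smooth_map_on_add[OF o smooth_section_triv[OF triv assms(2)] smooth_section_triv[OF triv assms(3)]]])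
       (use assms smooth_section_on_in in \<open>auto simp: triv_add[OF triv]\<close>)
qed

lemma smooth_section_on_scale:
  assumes "open V" "smooth_map_on V f" "smooth_section_on V s"
  shows "smooth_section_on V (\<lambda>x. f x \<cdot> s x)"
proof (rule smooth_section_onI)
  show "f x \<cdot> s x \<in> E x" if "x \<in> V" for x
    using smooth_section_on_in[OF assms(3) that] by (rule subspace_scale[OF fibre_subspace])
  fix U \<phi> assume triv: "(U, \<phi>) \<in> \<T>"
  have o: "open (V \<inter> U)" using assms(1) triv_open[OF triv] by auto
  show "smooth_map_on (V \<inter> U) (\<lambda>x. \<phi> x (f x \<cdot> s x))"
    by (rule smooth_map_on_cong[OF o _ smooth_map_on_bilinear[OF o bounded_bilinear_smult
            smooth_map_on_subset[OF assms(2)] smooth_section_triv[OF triv assms(3)]]])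
       (use assms smooth_section_on_in in \<open>auto simp: triv_scale[OF triv]\<close>)
qed

lemma smooth_section_extend_zero:
  assumes "open V" "closed K" "K \<subseteq> V" "smooth_section_on V s" "\<And>x. x \<notin> K \<Longrightarrow> s x = 0"
  shows "smooth_section s"
proof (rule smooth_section_onI)
  show "s x \<in> E x" for x
    using smooth_section_on_in[OF assms(4)] assms(3,5) subspace_0[OF fibre_subspace] by (metis subsetD)
  fix U \<phi> assume triv: "(U, \<phi>) \<in> \<T>"
  have "smooth_map_on (- K \<inter> U) (\<lambda>x. \<phi> x (s x))"
    by (rule smooth_map_on_cong[OF _ _ smooth_map_on_const[of _ 0]])
       (use assms(2,5) triv_open[OF triv] in \<open>auto simp: triv_zero[OF triv]\<close>)
  then have "smooth_map_on ((V \<inter> U) \<union> (- K \<inter> U)) (\<lambda>x. \<phi> x (s x))"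
    using assms(1,2) triv_open[OF triv]
    by (intro smooth_map_on_Un smooth_section_triv[OF triv assms(4)]) auto
  then show "smooth_map_on (UNIV \<inter> U) (\<lambda>x. \<phi> x (s x))"
    by (rule smooth_map_on_subset) (use assms(3) in auto)
qed

lemma smooth_section_zero: "smooth_section (\<lambda>_. 0)"
  by (rule smooth_section_extend_zero[of "{}" "{}"])
     (auto simp: smooth_section_on_def smooth_map_on_Ck Ck_on_empty)

context
  fixes nabla :: "('m \<Rightarrow> 'v) \<Rightarrow> 'm \<Rightarrow> ('m, 'n) tangent \<Rightarrow> 'v"
  assumes nabla: "connection nabla"
begin

lemma connection_in: "smooth_section s \<Longrightarrow> v \<in> tangent_space x \<Longrightarrow> nabla s x v \<in> E x"
  using nabla[unfolded connection_def, THEN conjunct1, THEN spec, THEN mp, THEN conjunct1] by blast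

lemma connection_tadd:
  "smooth_section s \<Longrightarrow> v \<in> tangent_space x \<Longrightarrow> w \<in> tangent_space x \<Longrightarrow>
    nabla s x (tadd v w) = nabla s x v + nabla s x w"
  using nabla[unfolded connection_def, THEN conjunct1, THEN spec, THEN mp, THEN conjunct2, THEN conjunct1] by blast

lemma connection_tscale:
  "smooth_section s \<Longrightarrow> v \<in> tangent_space x \<Longrightarrow> nabla s x (tscale a v) = complex_of_real a \<cdot> nabla s x v"
  using nabla[unfolded connection_def, THEN conjunct1, THEN spec, THEN mp, THEN conjunct2, THEN conjunct2,
    THEN conjunct1] by blast

lemma connection_smooth:
  "smooth_section s \<Longrightarrow> open V \<Longrightarrow> smooth_vector_field_on V X \<Longrightarrow> smooth_section_on V (\<lambda>x. nabla s x (X x))"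
  using nabla[unfolded connection_def, THEN conjunct1, THEN spec, THEN mp, THEN conjunct2, THEN conjunct2,
    THEN conjunct2] by blast

lemma connection_add:
  "smooth_section s \<Longrightarrow> smooth_section t \<Longrightarrow> v \<in> tangent_space x \<Longrightarrow>
    nabla (\<lambda>y. s y + t y) x v = nabla s x v + nabla t x v"
  using nabla[unfolded connection_def, THEN conjunct2, THEN conjunct1] by blast

lemma connection_leibniz:
  fixes f :: "'m \<Rightarrow> complex"
  shows "smooth_map_on UNIV f \<Longrightarrow> smooth_section s \<Longrightarrow> \<kappa> \<in> \<A> \<Longrightarrow> x \<in> chart_dom \<kappa> \<Longrightarrow>
    v \<in> tangent_space x \<Longrightarrow>
    nabla (\<lambda>y. f y \<cdot> s y) x v = differential \<kappa> f x v \<cdot> s x + f x \<cdot> nabla s x v"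
  using nabla[unfolded connection_def, THEN conjunct2, THEN conjunct2] by blast

end

lemma connection_sum:
  assumes nabla: "connection nabla" and s: "\<And>i. i \<in> I \<Longrightarrow> smooth_section (s i)"
    and v: "v \<in> tangent_space x" and I: "finite I"
  shows "smooth_section (\<lambda>y. \<Sum>i\<in>I. s i y) \<and> nabla (\<lambda>y. \<Sum>i\<in>I. s i y) x v = (\<Sum>i\<in>I. nabla (s i) x v)"
  using I s
proof (induction I)
  case empty
  have "nabla (\<lambda>y. 0 + 0) x v = nabla (\<lambda>y. 0) x v + nabla (\<lambda>y. 0) x v"
    by (rule connection_add[OF nabla smooth_section_zero smooth_section_zero v])
  then show ?case using smooth_section_zero by simp
next
  case (insert i I)
  have "nabla (\<lambda>y. s i y + (\<Sum>i\<in>I. s i y)) x v = nabla (s i) x v + nabla (\<lambda>y. \<Sum>i\<in>I. s i y) x v"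
    by (rule connection_add[OF nabla _ _ v]) (use insert in auto)
  then show ?case using insert smooth_section_on_add[OF open_UNIV, of "s i"] by simp
qed

text \<open>
  A connection acts only on global sections, so a local section is reached through a cutoff
  function \<open>\<theta>\<close>. With \<open>s b\<close> the truncated frame, \<open>\<theta>\<^sup>2 u\<close> is a combination of the global sections
  \<open>s b\<close> with the global coefficients \<open>\<theta> u\<^sub>b\<close>; comparing the Leibniz rule on both sides and
  dividing by \<open>\<theta>\<^sup>2\<close> gives the covariant derivative of \<open>u\<close> wherever \<open>\<theta> \<noteq> 0\<close>.
\<close>

lemma connection_local:
  fixes u :: "'m \<Rightarrow> 'v" and \<theta> :: "'m \<Rightarrow> real"
  assumes nabla: "connection nabla" and u: "smooth_section u"
    and \<kappa>: "\<kappa> \<in> \<A>" and triv: "(U, \<phi>) \<in> \<T>"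
    and \<theta>: "smooth_map_on UNIV \<theta>" "closed K" "K \<subseteq> U \<inter> chart_dom \<kappa>" "\<And>x. x \<notin> K \<Longrightarrow> \<theta> x = 0"
    and x: "x \<in> U" "x \<in> chart_dom \<kappa>" "\<theta> x \<noteq> 0" and v: "v \<in> tangent_space x"
  defines "s \<equiv> \<lambda>b x. complex_of_real (\<theta> x) \<cdot> lift \<phi> (axis b 1) x"
  defines "u' \<equiv> \<lambda>y. \<phi> (chart_inv \<kappa> y) (u (chart_inv \<kappa> y))"
  shows "smooth_section (s b)"
    and "\<phi> x (nabla u x v) = pd u' (v \<kappa>) (chart_map \<kappa> x) + (1 / \<theta> x) *\<^sub>R
      ((\<Sum>b\<in>UNIV. (\<phi> x (u x) $ b) *s \<phi> x (nabla (s b) x v))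
        - pd (\<lambda>y. \<theta> (chart_inv \<kappa> y)) (v \<kappa>) (chart_map \<kappa> x) *\<^sub>R \<phi> x (u x))"
proof -
  let ?t = "\<lambda>x. complex_of_real (\<theta> x)"
  have oU: "open U" by (rule triv_open[OF triv])
  have KU: "K \<subseteq> U" using \<theta>(3) by auto
  have t: "smooth_map_on V ?t" if "open V" for V
    using smooth_map_on_linear[OF that bounded_linear_of_real smooth_map_on_subset[OF \<theta>(1)]] by simp
  show ss: "smooth_section (s b)" for b
    unfolding s_def
    by (rule smooth_section_extend_zero[OF oU \<theta>(2) KU smooth_section_on_scale[OF oU t[OF oU] smooth_lift[OF triv]]])
       (simp add: \<theta>(4))
  have uE: "u x \<in> E x" for x using smooth_section_on_in[OF u] by simp
  define f where "f b x = ?t x * (\<phi> x (u x) $ b)" for b x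
  have usm: "smooth_map_on U (\<lambda>x. \<phi> x (u x))"
    using smooth_section_triv[OF triv u] by simp
  have fs: "smooth_map_on UNIV (f b)" for b
  proof (rule smooth_map_on_extend_zero[OF oU \<theta>(2) KU])
    show "smooth_map_on U (f b)" unfolding f_def[abs_def]
      by (intro smooth_map_on_bilinear[OF oU bounded_bilinear_mult] t oU
          smooth_map_on_linear[OF oU bounded_linear_vec_nth usm])
  qed (simp add: f_def \<theta>(4))
  have eq: "(\<lambda>x. (?t x * ?t x) \<cdot> u x) = (\<lambda>x. \<Sum>b\<in>UNIV. f b x \<cdot> s b x)"
  proof
    fix x show "(?t x * ?t x) \<cdot> u x = (\<Sum>b\<in>UNIV. f b x \<cdot> s b x)"
    proof (cases "x \<in> U")
      case True
      have "(?t x * ?t x) \<cdot> u x = (?t x * ?t x) \<cdot> (\<Sum>b\<in>UNIV. (\<phi> x (u x) $ b) \<cdot> lift \<phi> (axis b 1) x)"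
        by (subst lift_expansion[OF triv True uE]) simp
      then show ?thesis by (simp add: f_def s_def scale_sum_right mult_ac)
    next
      case False
      then have "\<theta> x = 0" using \<theta>(4) KU by auto
      then show ?thesis by (simp add: f_def)
    qed
  qed
  let ?y = "chart_map \<kappa> x"
  let ?S = "chart_map \<kappa> ` (U \<inter> chart_dom \<kappa>)"
  have yS: "?y \<in> ?S" using x by auto
  define d where "d = pd (\<lambda>y. \<theta> (chart_inv \<kappa> y)) (v \<kappa>) ?y"
  have d\<theta>: "((\<lambda>y. \<theta> (chart_inv \<kappa> y)) has_derivative (\<lambda>a. pd (\<lambda>y. \<theta> (chart_inv \<kappa> y)) a ?y)) (at ?y)"
    by (rule Ck_on_has_derivative[OF smooth_map_onD[OF \<theta>(1) \<kappa>, of "Suc 0"]]) (use x in auto)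
  have du: "(u' has_derivative (\<lambda>a. pd u' a ?y)) (at ?y)"
    unfolding u'_def by (rule Ck_on_has_derivative[OF smooth_map_onD[OF usm \<kappa>, of "Suc 0"] yS])
  have dt: "((\<lambda>y. ?t (chart_inv \<kappa> y)) has_derivative (\<lambda>a. of_real (pd (\<lambda>y. \<theta> (chart_inv \<kappa> y)) a ?y))) (at ?y)"
    by (rule bounded_linear.has_derivative[OF bounded_linear_of_real d\<theta>])
  have d1: "differential \<kappa> (\<lambda>x. ?t x * ?t x) x v = of_real (2 * \<theta> x * d)"
  proof -
    have "((\<lambda>y. ?t (chart_inv \<kappa> y) * ?t (chart_inv \<kappa> y)) has_derivative
       (\<lambda>a. ?t (chart_inv \<kappa> ?y) * of_real (pd (\<lambda>y. \<theta> (chart_inv \<kappa> y)) a ?y) +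
            of_real (pd (\<lambda>y. \<theta> (chart_inv \<kappa> y)) a ?y) * ?t (chart_inv \<kappa> ?y))) (at ?y)"
      by (rule has_derivative_mult[OF dt dt])
    from pd_eqI[OF this, where j = "v \<kappa>"] show ?thesis
      using \<kappa> x by (simp add: differential_def o_def d_def)
  qed
  have d2: "differential \<kappa> (f b) x v = of_real (\<theta> x) * (pd u' (v \<kappa>) ?y $ b) + of_real d * (\<phi> x (u x) $ b)" for b
  proof -
    have "((\<lambda>y. ?t (chart_inv \<kappa> y) * (u' y $ b)) has_derivative
       (\<lambda>a. ?t (chart_inv \<kappa> ?y) * (pd u' a ?y $ b) +
            of_real (pd (\<lambda>y. \<theta> (chart_inv \<kappa> y)) a ?y) * (u' ?y $ b))) (at ?y)"
      by (rule has_derivative_mult[OF dt bounded_linear.has_derivative[OF bounded_linear_vec_nth du]])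
    from pd_eqI[OF this, where j = "v \<kappa>"] show ?thesis
      using \<kappa> x by (simp add: differential_def o_def d_def f_def u'_def)
  qed
  have leib: "nabla (\<lambda>y. F y \<cdot> w y) x v = differential \<kappa> F x v \<cdot> w x + F x \<cdot> nabla w x v"
    if "smooth_map_on UNIV F" "smooth_section w" for F w
    by (rule connection_leibniz[OF nabla that \<kappa> x(2) v])
  have nE: "nabla w x v \<in> E x" if "smooth_section w" for w
    by (rule connection_in[OF nabla that v])
  have fss: "smooth_section (\<lambda>x. f b x \<cdot> s b x)" for b
    by (rule smooth_section_on_scale[OF open_UNIV fs ss])
  have "nabla (\<lambda>x. (?t x * ?t x) \<cdot> u x) x v = of_real (2 * \<theta> x * d) \<cdot> u x + (?t x * ?t x) \<cdot> nabla u x v"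
    by (subst leib[OF smooth_map_on_bilinear[OF open_UNIV bounded_bilinear_mult t t] u]) (simp_all add: d1)
  moreover have "nabla (\<lambda>x. \<Sum>b\<in>UNIV. f b x \<cdot> s b x) x v = (\<Sum>b\<in>UNIV. nabla (\<lambda>x. f b x \<cdot> s b x) x v)"
    by (rule conjunct2[OF connection_sum[OF nabla fss v finite_class.finite_UNIV]])
  moreover have "nabla (\<lambda>x. f b x \<cdot> s b x) x v = (of_real (\<theta> x) * (pd u' (v \<kappa>) ?y $ b) + of_real d * (\<phi> x (u x) $ b)) \<cdot> s b x
      + f b x \<cdot> nabla (s b) x v" for b
    by (simp add: leib[OF fs ss] d2)
  ultimately have "of_real (2 * \<theta> x * d) \<cdot> u x + (?t x * ?t x) \<cdot> nabla u x v =
      (\<Sum>b\<in>UNIV. (of_real (\<theta> x) * (pd u' (v \<kappa>) ?y $ b) + of_real d * (\<phi> x (u x) $ b)) \<cdot> s b x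
      + f b x \<cdot> nabla (s b) x v)"
    unfolding eq by simp
  then have "\<phi> x (of_real (2 * \<theta> x * d) \<cdot> u x + (?t x * ?t x) \<cdot> nabla u x v) =
      \<phi> x (\<Sum>b\<in>UNIV. (of_real (\<theta> x) * (pd u' (v \<kappa>) ?y $ b) + of_real d * (\<phi> x (u x) $ b)) \<cdot> s b x
      + f b x \<cdot> nabla (s b) x v)" by simp
  moreover have sE: "s b x \<in> E x" for b using smooth_section_on_in[OF ss] by simp
  note cl = subspace_scale[OF fibre_subspace] subspace_add[OF fibre_subspace]
  have "\<phi> x (s b x) = \<theta> x *\<^sub>R axis b 1" for b
    using x by (simp add: s_def triv_scale[OF triv] lift_in[OF triv] triv_lift[OF triv] of_real_smult)
  ultimately have "(2 * \<theta> x * d) *\<^sub>R \<phi> x (u x) + (\<theta> x * \<theta> x) *\<^sub>R \<phi> x (nabla u x v) =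
     (\<Sum>b\<in>UNIV. (of_real (\<theta> x) * (pd u' (v \<kappa>) ?y $ b) + of_real d * (\<phi> x (u x) $ b)) *s (\<theta> x *\<^sub>R axis b 1)
      + f b x *s \<phi> x (nabla (s b) x v))"
    using x(1) uE nE[OF u] nE[OF ss] sE
    by (simp add: triv_add[OF triv] triv_scale[OF triv] triv_sum[OF triv] cl of_real_smult
        flip: of_real_mult)
  also have "\<dots> = (\<Sum>b\<in>UNIV. (\<theta> x * \<theta> x) *\<^sub>R ((pd u' (v \<kappa>) ?y $ b) *s axis b 1) +
     (\<theta> x * d) *\<^sub>R ((\<phi> x (u x) $ b) *s axis b 1) + \<theta> x *\<^sub>R ((\<phi> x (u x) $ b) *s \<phi> x (nabla (s b) x v)))"
    by (intro sum.cong refl)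
       (simp add: f_def of_real_smult[symmetric] vector_smult_assoc vector_sadd_rdistrib distrib_left mult_ac)
  also have "\<dots> = (\<theta> x * \<theta> x) *\<^sub>R pd u' (v \<kappa>) ?y + (\<theta> x * d) *\<^sub>R \<phi> x (u x) +
     \<theta> x *\<^sub>R (\<Sum>b\<in>UNIV. (\<phi> x (u x) $ b) *s \<phi> x (nabla (s b) x v))"
    by (simp add: sum.distrib basis_expansion flip: scaleR_sum_right)
  finally have "(\<theta> x * \<theta> x) *\<^sub>R \<phi> x (nabla u x v) = (\<theta> x * \<theta> x) *\<^sub>R (pd u' (v \<kappa>) ?y + (1 / \<theta> x) *\<^sub>R
      ((\<Sum>b\<in>UNIV. (\<phi> x (u x) $ b) *s \<phi> x (nabla (s b) x v)) - d *\<^sub>R \<phi> x (u x)))"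
  proof -
    assume a: "(2 * \<theta> x * d) *\<^sub>R \<phi> x (u x) + (\<theta> x * \<theta> x) *\<^sub>R \<phi> x (nabla u x v) =
      (\<theta> x * \<theta> x) *\<^sub>R pd u' (v \<kappa>) ?y + (\<theta> x * d) *\<^sub>R \<phi> x (u x) +
     \<theta> x *\<^sub>R (\<Sum>b\<in>UNIV. (\<phi> x (u x) $ b) *s \<phi> x (nabla (s b) x v))" (is "?a + ?b = ?c + ?e + ?f")
    have "?a = ?e + ?e" by (simp flip: scaleR_add_left)
    with a have "?e + (?e + ?b) = ?e + (?c + ?f)" by (simp only: ac_simps)
    then have "?e + ?b = ?c + ?f" by (rule add_left_imp_eq)
    then have "?b = ?c + (?f - ?e)" by (simp only: add_diff_eq eq_diff_eq ac_simps)
    also have "?f - ?e = (\<theta> x * \<theta> x) *\<^sub>R ((1 / \<theta> x) *\<^sub>R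
      ((\<Sum>b\<in>UNIV. (\<phi> x (u x) $ b) *s \<phi> x (nabla (s b) x v)) - d *\<^sub>R \<phi> x (u x)))"
      using x(3) by (simp add: scaleR_diff_right)
    finally show ?thesis by (simp only: scaleR_add_right)
  qed
  then show "\<phi> x (nabla u x v) = pd u' (v \<kappa>) (chart_map \<kappa> x) + (1 / \<theta> x) *\<^sub>R
      ((\<Sum>b\<in>UNIV. (\<phi> x (u x) $ b) *s \<phi> x (nabla (s b) x v))
        - pd (\<lambda>y. \<theta> (chart_inv \<kappa> y)) (v \<kappa>) (chart_map \<kappa> x) *\<^sub>R \<phi> x (u x))"
    using x(3) by (simp add: d_def)
qed

text \<open>
  The covariant derivative is the coordinate derivative up to a zero order term, by
  \<open>connection_local\<close>. On the smaller ball the cutoff function is bounded away from zero, so that all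
  coefficients of this term are continuous on a compact set.
\<close>

lemma connection_local_bound:
  fixes u :: "'m \<Rightarrow> 'v"
  assumes nabla: "connection nabla" and u: "smooth_section u"
    and \<kappa>: "\<kappa> \<in> \<A>" and triv: "(U, \<phi>) \<in> \<T>"
    and r: "r > 0" "cball p r \<subseteq> chart_map \<kappa> ` (U \<inter> chart_dom \<kappa>)"
  defines "u' \<equiv> \<lambda>y. \<phi> (chart_inv \<kappa> y) (u (chart_inv \<kappa> y))"
  shows "\<exists>C\<ge>0. \<forall>y\<in>cball p (r / 2). \<forall>j\<in>Basis.
    norm (\<phi> (chart_inv \<kappa> y) (nabla u (chart_inv \<kappa> y) (coord_vec \<kappa> j (chart_inv \<kappa> y))) - pd u' j y) \<le> C * norm (u' y)"
proof -
  let ?V = "U \<inter> chart_dom \<kappa>"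
  let ?S = "chart_map \<kappa> ` ?V"
  have oU: "open U" by (rule triv_open[OF triv])
  have oV: "open ?V" using oU chart_open[OF \<kappa>] by auto
  obtain \<theta> :: "'m \<Rightarrow> real" and K where \<theta>: "smooth_map_on UNIV \<theta>" "closed K" "K \<subseteq> U \<inter> chart_dom \<kappa>"
    "\<And>x. x \<notin> K \<Longrightarrow> \<theta> x = 0" "\<And>y. y \<in> ball p r \<Longrightarrow> \<theta> (chart_inv \<kappa> y) > 0"
    using cutoff_exists[OF \<kappa> oU r] by metis
  define s where "s b x = complex_of_real (\<theta> x) \<cdot> lift \<phi> (axis b 1) x" for b x
  have inB: "chart_inv \<kappa> y \<in> U" "chart_inv \<kappa> y \<in> chart_dom \<kappa>" "chart_map \<kappa> (chart_inv \<kappa> y) = y" "y \<in> ?S"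
    if "y \<in> cball p r" for y using r(2) that \<kappa> by (auto simp: chart_image_eq[OF \<kappa>])
  have p: "p \<in> ball p r" "p \<in> cball p r" using r(1) by auto
  have ss: "smooth_section (s b)" for b
    unfolding s_def
    by (rule connection_local(1)[OF nabla u \<kappa> triv \<theta>(1-4) inB(1,2)[OF p(2)] _
          coord_vec_tangent[OF \<kappa> inB(2)[OF p(2)]]])
       (assumption | rule less_imp_neq[OF \<theta>(5)[OF p(1)], symmetric])+
  have loc: "\<phi> x (nabla u x v) = pd u' (v \<kappa>) (chart_map \<kappa> x) + (1 / \<theta> x) *\<^sub>R
      ((\<Sum>b\<in>UNIV. (\<phi> x (u x) $ b) *s \<phi> x (nabla (s b) x v))
        - pd (\<lambda>y. \<theta> (chart_inv \<kappa> y)) (v \<kappa>) (chart_map \<kappa> x) *\<^sub>R \<phi> x (u x))"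
    if "x \<in> U" "x \<in> chart_dom \<kappa>" "\<theta> x \<noteq> 0" "v \<in> tangent_space x" for x v
    unfolding s_def u'_def by (rule connection_local(2)[OF nabla u \<kappa> triv \<theta>(1-4) that])
  define X where "X b j y = \<phi> (chart_inv \<kappa> y) (nabla (s b) (chart_inv \<kappa> y) (coord_vec \<kappa> j (chart_inv \<kappa> y)))" for b j y
  have Xc: "continuous_on ?S (X b j)" for b j
  proof -
    have "smooth_section_on ?V (\<lambda>x. nabla (s b) x (coord_vec \<kappa> j x))"
      by (rule connection_smooth[OF nabla ss oV coord_vec_smooth[OF \<kappa> oV]]) simp
    from smooth_section_triv[OF triv this]
    have "smooth_map_on (?V \<inter> U) (\<lambda>x. \<phi> x (nabla (s b) x (coord_vec \<kappa> j x)))" .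
    from smooth_map_onD[OF this \<kappa>, of 0] have "continuous_on (chart_map \<kappa> ` (?V \<inter> U \<inter> chart_dom \<kappa>)) (X b j)"
      by (simp add: X_def[abs_def])
    moreover have "?V \<inter> U \<inter> chart_dom \<kappa> = ?V" by auto
    ultimately show ?thesis by simp
  qed
  define D where "D j = pd (\<lambda>y. \<theta> (chart_inv \<kappa> y)) j" for j
  have Dc: "continuous_on ?S (D j)" and tc: "continuous_on ?S (\<lambda>y. \<theta> (chart_inv \<kappa> y))" for j
  proof -
    have C1: "Ck_on (Suc 0) ?S (\<lambda>y. \<theta> (chart_inv \<kappa> y))"
      by (rule Ck_on_subset[OF smooth_map_onD[OF \<theta>(1) \<kappa>]]) auto
    show "continuous_on ?S (D j)" "continuous_on ?S (\<lambda>y. \<theta> (chart_inv \<kappa> y))"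
      unfolding D_def by (rule Ck_on_continuous[OF Ck_on_pd[OF C1]], rule Ck_on_continuous[OF C1])
  qed
  define F where "F y = inverse (\<theta> (chart_inv \<kappa> y)) * (\<Sum>j\<in>Basis. (\<Sum>b\<in>UNIV. norm (X b j y)) + \<bar>D j y\<bar>)" for y
  have sub: "cball p (r / 2) \<subseteq> ball p r" "cball p (r / 2) \<subseteq> ?S" using r by (auto simp: subset_iff)
  have "\<theta> (chart_inv \<kappa> y) \<noteq> 0" if "y \<in> cball p (r / 2)" for y
    using \<theta>(5)[of y] sub(1) that by (metis less_irrefl subsetD)
  then have "continuous_on (cball p (r / 2)) F" unfolding F_def
    using sub(2) by (auto intro!: continuous_intros intro: continuous_on_subset[OF Xc] continuous_on_subset[OF Dc] continuous_on_subset[OF tc])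
  from continuous_bounded_above[OF compact_cball this]
  obtain C where C: "\<And>y. y \<in> cball p (r / 2) \<Longrightarrow> F y \<le> C" by blast
  show ?thesis
  proof (intro exI[of _ "max C 0"] conjI ballI)
    fix y j :: "real^'n" assume y: "y \<in> cball p (r / 2)" and j: "j \<in> Basis"
    let ?x = "chart_inv \<kappa> y"
    have yr: "y \<in> cball p r" "y \<in> ball p r" using y sub r by auto
    have t: "\<theta> ?x > 0" by (rule \<theta>(5)[OF yr(2)])
    have "\<phi> ?x (nabla u ?x (coord_vec \<kappa> j ?x)) - pd u' j y =
      inverse (\<theta> ?x) *\<^sub>R ((\<Sum>b\<in>UNIV. (u' y $ b) *s X b j y) - D j y *\<^sub>R u' y)"
      using loc[OF inB(1,2)[OF yr(1)] _ coord_vec_tangent[OF \<kappa> inB(2)[OF yr(1)]], of j] t inB[OF yr(1)] \<kappa>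
      by (simp add: coord_vec_self X_def D_def u'_def inverse_eq_divide)
    also have "norm \<dots> \<le> inverse (\<theta> ?x) * ((\<Sum>b\<in>UNIV. norm (X b j y)) + \<bar>D j y\<bar>) * norm (u' y)"
    proof -
      have "norm (\<Sum>b\<in>UNIV. (u' y $ b) *s X b j y) \<le> (\<Sum>b\<in>UNIV. norm (u' y) * norm (X b j y))"
        by (rule sum_norm_le) (simp add: norm_smult_complex mult_right_mono Finite_Cartesian_Product.norm_nth_le)
      then have "norm ((\<Sum>b\<in>UNIV. (u' y $ b) *s X b j y) - D j y *\<^sub>R u' y) \<le>
         ((\<Sum>b\<in>UNIV. norm (X b j y)) + \<bar>D j y\<bar>) * norm (u' y)"
        by (intro norm_triangle_le_diff) (simp add: distrib_left mult.commute[of _ "norm (u' y)"] flip: sum_distrib_left)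
      then show ?thesis using t by (simp add: mult.assoc)
    qed
    also have "\<dots> \<le> F y * norm (u' y)"
    proof (intro mult_right_mono)
      show "inverse (\<theta> ?x) * ((\<Sum>b\<in>UNIV. norm (X b j y)) + \<bar>D j y\<bar>) \<le> F y"
        unfolding F_def using t j
        by (intro mult_left_mono member_le_sum[of j Basis "\<lambda>j. (\<Sum>b\<in>UNIV. norm (X b j y)) + \<bar>D j y\<bar>"])
           (auto intro!: add_nonneg_nonneg sum_nonneg)
    qed simp
    also have "\<dots> \<le> max C 0 * norm (u' y)" using C[OF y] by (intro mult_right_mono) auto
    finally show "norm (\<phi> ?x (nabla u ?x (coord_vec \<kappa> j ?x)) - pd u' j y) \<le> max C 0 * norm (u' y)" .
  qed simp
qed

end

section \<open>Orthonormal frames\<close>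

lemma sum_Basis_vec: "(\<Sum>j\<in>(Basis :: (real^'n) set). f j) = (\<Sum>i\<in>UNIV. f (axis i 1))"
proof -
  have B: "(Basis :: (real^'n) set) = range (\<lambda>i. axis i 1)" by (auto simp: Basis_vec_def)
  have "inj (\<lambda>i. axis i 1 :: real^'n)" by (auto simp: inj_def axis_eq_axis)
  from sum.reindex[OF this, of f] show ?thesis unfolding B by (simp add: o_def)
qed

text \<open>
  An inner product on \<open>\<real>\<^sup>n\<close>, in the role of the Riemannian metric at one point of a chart.
\<close>

locale inner_form =
  fixes G :: "real^'n \<Rightarrow> real^'n \<Rightarrow> real"
  assumes G_add: "\<And>a b z. G (a + b) z = G a z + G b z"
    and G_scale: "\<And>t a z. G (t *\<^sub>R a) z = t * G a z"
    and G_sym: "\<And>a b. G a b = G b a"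
    and G_pos: "\<And>a. a \<noteq> 0 \<Longrightarrow> G a a > 0"
begin

lemma G_zero: "G 0 z = 0"
  using G_scale[of 0 0 z] by simp

lemma G_sum: "G (\<Sum>i\<in>I. f i) z = (\<Sum>i\<in>I. G (f i) z)"
  by (induction I rule: infinite_finite_induct) (auto simp: G_zero G_add)

lemma G_diff: "G (a - b) z = G a z - G b z"
  using G_add[of "a - b" b z] by simp

lemma G_scale_right: "G z (t *\<^sub>R a) = t * G z a"
  using G_scale G_sym by metis

lemma G_sum_right: "G z (\<Sum>i\<in>I. f i) = (\<Sum>i\<in>I. G z (f i))"
  using G_sum[of f I z] by (simp add: G_sym)

text \<open>
  Gram-Schmidt, adding one index at a time: a family with fewer than \<open>n\<close> members does not span.
\<close>

lemma orthonormal_family_extend: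
  fixes I :: "'n set"
  shows "\<exists>a. \<forall>i\<in>I. \<forall>j\<in>I. G (a i) (a j) = (if i = j then 1 else 0)"
proof -
  have "finite I" by simp
  then show ?thesis
  proof (induction I)
    case (insert i0 I)
    then obtain a where a: "\<And>i j. i \<in> I \<Longrightarrow> j \<in> I \<Longrightarrow> G (a i) (a j) = (if i = j then 1 else 0)" by blast
    have "card I < card (UNIV :: 'n set)"
      using insert by (intro psubset_card_mono) auto
    then have "dim (a ` I) < DIM(real^'n)"
      using dim_le_card'[of "a ` I"] card_image_le[of I a] by simp
    then have "span (a ` I) \<noteq> UNIV" using dim_UNIV dim_span by (metis less_irrefl)
    then obtain z where z: "z \<notin> span (a ` I)" by blast
    define w where "w = z - (\<Sum>i\<in>I. G z (a i) *\<^sub>R a i)"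
    have "w \<noteq> 0"
    proof
      assume "w = 0"
      then have "z = (\<Sum>i\<in>I. G z (a i) *\<^sub>R a i)" by (simp add: w_def)
      also have "\<dots> \<in> span (a ` I)" by (intro span_sum span_scale span_base) auto
      finally show False using z by simp
    qed
    then have pw: "G w w > 0" by (rule G_pos)
    have wa: "G w (a j) = 0" if j: "j \<in> I" for j
    proof -
      have "(\<Sum>i\<in>I. G z (a i) * G (a i) (a j)) = (\<Sum>i\<in>I. if i = j then G z (a j) else 0)"
        by (rule sum.cong) (use a j in auto)
      then show ?thesis using j insert.hyps by (simp add: w_def G_diff G_sum G_scale)
    qed
    define e where "e = (1 / sqrt (G w w)) *\<^sub>R w"
    have ee: "G e e = 1" using pw by (simp add: e_def G_scale G_scale_right field_simps)
    have ea: "G e (a j) = 0" "G (a j) e = 0" if "j \<in> I" for j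
      using wa[OF that] by (simp_all add: e_def G_scale G_sym[of "a j" ])
    have "\<forall>i\<in>insert i0 I. \<forall>j\<in>insert i0 I. G ((a(i0 := e)) i) ((a(i0 := e)) j) = (if i = j then 1 else 0)"
      using a ee ea insert.hyps by auto
    then show ?case by blast
  qed auto
qed

definition frame :: "'n \<Rightarrow> real^'n" where
  "frame = (SOME a. \<forall>i j. G (a i) (a j) = (if i = j then 1 else 0))"

lemma frame: "G (frame i) (frame j) = (if i = j then 1 else 0)"
proof -
  have "\<exists>a :: 'n \<Rightarrow> real^'n. \<forall>i j. G (a i) (a j) = (if i = j then 1 else 0)"
    using orthonormal_family_extend[of UNIV] by blast
  from someI_ex[OF this] show ?thesis unfolding frame_def by blast
qed

text \<open>An orthonormal family of full length is a basis, since its synthesis map is injective.\<close>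

lemma frame_expansion: "w = (\<Sum>i\<in>UNIV. G w (frame i) *\<^sub>R frame i)"
proof -
  define T where "T c = (\<Sum>i\<in>UNIV. (c $ i) *\<^sub>R frame i)" for c :: "real^'n"
  have lin: "linear T"
    by (rule linearI) (auto simp: T_def scaleR_add_left sum.distrib scaleR_sum_right)
  have GT: "G (T c) (frame j) = c $ j" for c j
  proof -
    have "G (T c) (frame j) = (\<Sum>i\<in>UNIV. if i = j then c $ j else 0)"
      unfolding T_def G_sum by (rule sum.cong) (auto simp: G_scale frame)
    then show ?thesis by simp
  qed
  have "inj T" by (rule injI) (metis GT vec_eq_iff)
  with lin have "surj T" by (rule linear_injective_imp_surjective) (rule refl)
  then obtain c where c: "w = T c" by (metis surjD)
  show ?thesis by (subst c, subst T_def) (simp add: c GT)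
qed

text \<open>
  The inner product on covectors, here identified with vectors by the standard inner product,
  and the isomorphism \<open>sharp\<close> from covectors to vectors.
\<close>

definition dual_form :: "real^'n \<Rightarrow> real^'n \<Rightarrow> real" where
  "dual_form j k = (\<Sum>i\<in>UNIV. (frame i \<bullet> j) * (frame i \<bullet> k))"

definition sharp :: "real^'n \<Rightarrow> real^'n" where
  "sharp k = (\<Sum>i\<in>UNIV. (frame i \<bullet> k) *\<^sub>R frame i)"

lemma dual_form_sym: "dual_form j k = dual_form k j"
  by (simp add: dual_form_def mult.commute)

lemma sharp_inner: "sharp k \<bullet> j = dual_form j k"
  by (simp add: sharp_def dual_form_def inner_sum_left mult.commute)

lemma sharp_expansion: "sharp k = (\<Sum>j\<in>Basis. dual_form j k *\<^sub>R j)"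
  by (subst euclidean_representation[symmetric, of "sharp k"]) (simp add: sharp_inner)

lemma G_frame_sharp: "G (frame i) (sharp k) = frame i \<bullet> k"
proof -
  have "G (frame i) (sharp k) = (\<Sum>l\<in>UNIV. if i = l then frame i \<bullet> k else 0)"
    unfolding sharp_def G_sum_right by (rule sum.cong) (auto simp: G_scale_right frame)
  then show ?thesis by simp
qed

lemma G_sharp: "G j (sharp k) = j \<bullet> k"
proof -
  have "G j (sharp k) = (\<Sum>i\<in>UNIV. G j (frame i) * (frame i \<bullet> k))"
    by (subst frame_expansion[of j]) (simp add: G_sum G_scale G_frame_sharp)
  also have "\<dots> = (\<Sum>i\<in>UNIV. G j (frame i) *\<^sub>R frame i) \<bullet> k" by (simp add: inner_sum_left)
  finally show ?thesis by (simp flip: frame_expansion)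
qed

lemma G_sharp_sharp: "G (sharp j) (sharp k) = dual_form j k"
  by (simp add: G_sharp sharp_inner dual_form_sym)

text \<open>
  The dual form is the inverse matrix, and Cramer's rule exhibits its entries as rational
  functions of those of \<open>G\<close>; the orthonormal frame itself may depend wildly on parameters.
\<close>

definition gram :: "real^'n^'n" where
  "gram = (\<chi> i j. G (axis i 1) (axis j 1))"

lemma gram_dual_form: "gram *v (\<chi> k. dual_form (axis k 1) (axis l 1)) = axis l 1"
proof -
  have "(\<Sum>k\<in>UNIV. G (axis i 1) (axis k 1) * dual_form (axis k 1) (axis l 1)) = axis l 1 $ i" for i
  proof -
    have "(\<Sum>k\<in>UNIV. G (axis i 1) (axis k 1) * dual_form (axis k 1) (axis l 1)) = G (axis i 1) (sharp (axis l 1))"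
      by (subst sharp_expansion) (simp add: sum_Basis_vec G_sum_right G_scale_right mult.commute)
    moreover have "axis l 1 $ i = (if i = l then 1 else 0 :: real)" by (simp add: axis_def)
    ultimately show ?thesis by (simp add: G_sharp inner_axis_axis)
  qed
  then show ?thesis by (simp add: vec_eq_iff matrix_vector_mult_def gram_def)
qed

lemma det_gram: "det gram \<noteq> 0"
proof -
  define B :: "real^'n^'n" where "B = (\<chi> k l. dual_form (axis k 1) (axis l 1))"
  have "gram ** B = mat 1"
  proof -
    have "(gram ** B) $ i $ l = (gram *v (\<chi> k. dual_form (axis k 1) (axis l 1))) $ i" for i l
      by (simp add: matrix_matrix_mult_def matrix_vector_mult_def B_def)
    then have "(gram ** B) $ i $ l = axis l 1 $ i" for i l by (simp only: gram_dual_form)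
    then show ?thesis by (simp add: vec_eq_iff mat_def axis_def)
  qed
  then have "det gram * det B = 1" by (metis det_mul det_I)
  then show ?thesis by auto
qed

lemma dual_form_cramer:
  "dual_form (axis k 1) (axis l 1) = det (\<chi> i j. if j = k then axis l 1 $ i else gram $ i $ j) / det gram"
proof -
  have "(\<chi> k. dual_form (axis k 1) (axis l 1)) =
      (\<chi> k. det (\<chi> i j. if j = k then axis l 1 $ i else gram $ i $ j) / det gram)"
    using gram_dual_form[of l] unfolding cramer[OF det_gram] .
  then show ?thesis by (simp add: vec_eq_iff)
qed

text \<open>
  In the frame, the double sum over \<open>dual_form\<close> is the sum of the \<open>h (W i) (W i)\<close>, where \<open>W\<close> collects the
  derivatives along the frame. Conversely \<open>w k = \<Sum>\<^sub>i G k (e i) W i\<close>, and Parseval gives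
  \<open>\<Sum>\<^sub>i G k (e i)\<^sup>2 = G k k\<close>; so the constant involves the trace of \<open>G\<close> only, which is continuous in
  parameters while the frame need not be.
\<close>

lemma dual_form_lower_bound:
  fixes w :: "real^'n \<Rightarrow> 'b::real_inner" and h :: "'b \<Rightarrow> 'b \<Rightarrow> real"
  assumes h: "bilinear h" and c: "c \<ge> 0" "\<And>z. h z z \<ge> c * (norm z)\<^sup>2"
  shows "c * (\<Sum>j\<in>Basis. (norm (w j))\<^sup>2) \<le>
    (\<Sum>k\<in>Basis. G k k) * (\<Sum>j\<in>Basis. \<Sum>k\<in>Basis. dual_form j k * h (w j) (w k))"
proof -
  define W where "W i = (\<Sum>j\<in>Basis. (frame i \<bullet> j) *\<^sub>R w j)" for i
  define N where "N = (\<Sum>i\<in>UNIV. (norm (W i))\<^sup>2)"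
  have l1: "linear (\<lambda>x. h x z)" and l2: "linear (h z)" for z
    using h by (auto simp: bilinear_def)
  have hs1: "h (\<Sum>j\<in>J. t j *\<^sub>R w j) z = (\<Sum>j\<in>J. t j * h (w j) z)" for J t z
    using linear_sum[OF l1[of z], of "\<lambda>j. t j *\<^sub>R w j" J] linear_scale[OF l1[of z]] by simp
  have hs2: "h z (\<Sum>j\<in>J. t j *\<^sub>R w j) = (\<Sum>j\<in>J. t j * h z (w j))" for J t z
    using linear_sum[OF l2[of z], of "\<lambda>j. t j *\<^sub>R w j" J] linear_scale[OF l2[of z]] by simp
  have "(\<Sum>j\<in>Basis. \<Sum>k\<in>Basis. dual_form j k * h (w j) (w k)) = (\<Sum>i\<in>UNIV. h (W i) (W i))"
  proof -
    have "(\<Sum>i\<in>UNIV. h (W i) (W i)) =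
      (\<Sum>i\<in>UNIV. \<Sum>j\<in>Basis. \<Sum>k\<in>Basis. (frame i \<bullet> j) * (frame i \<bullet> k) * h (w j) (w k))"
      unfolding W_def hs1 unfolding hs2 by (simp add: sum_distrib_left mult.assoc)
    also have "\<dots> = (\<Sum>j\<in>Basis. \<Sum>k\<in>Basis. dual_form j k * h (w j) (w k))"
      unfolding dual_form_def sum_distrib_right
      by (subst sum.swap) (intro sum.cong refl, rule sum.swap)
    finally show ?thesis ..
  qed
  moreover have "c * N \<le> (\<Sum>i\<in>UNIV. h (W i) (W i))"
    unfolding N_def sum_distrib_left by (intro sum_mono c(2))
  ultimately have 1: "c * N \<le> (\<Sum>j\<in>Basis. \<Sum>k\<in>Basis. dual_form j k * h (w j) (w k))" by simp
  have 2: "(norm (w k))\<^sup>2 \<le> G k k * N" if k: "k \<in> Basis" for k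
  proof -
    have "(\<Sum>i\<in>UNIV. G k (frame i) *\<^sub>R W i) = (\<Sum>j\<in>Basis. (\<Sum>i\<in>UNIV. G k (frame i) * (frame i \<bullet> j)) *\<^sub>R w j)"
      unfolding W_def scaleR_sum_right scaleR_scaleR scaleR_sum_left by (rule sum.swap)
    also have "\<dots> = (\<Sum>j\<in>Basis. ((\<Sum>i\<in>UNIV. G k (frame i) *\<^sub>R frame i) \<bullet> j) *\<^sub>R w j)"
      by (simp add: inner_sum_left)
    also have "\<dots> = (\<Sum>j\<in>Basis. (if j = k then w k else 0))"
      unfolding frame_expansion[symmetric] using k by (intro sum.cong refl) (auto simp: inner_Basis)
    finally have e: "(\<Sum>i\<in>UNIV. G k (frame i) *\<^sub>R W i) = w k" using k by simp
    have "norm (w k) \<le> (\<Sum>i\<in>UNIV. \<bar>G k (frame i)\<bar> * norm (W i))"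
      by (subst e[symmetric]) (rule sum_norm_le, simp)
    then have "(norm (w k))\<^sup>2 \<le> (\<Sum>i\<in>UNIV. \<bar>G k (frame i)\<bar> * norm (W i))\<^sup>2"
      by (intro power_mono) auto
    also have "\<dots> \<le> (\<Sum>i\<in>UNIV. \<bar>G k (frame i)\<bar>\<^sup>2) * N"
      unfolding N_def by (rule Cauchy_Schwarz_ineq_sum)
    also have "(\<Sum>i\<in>UNIV. \<bar>G k (frame i)\<bar>\<^sup>2) = G k k"
    proof -
      have "G k k = G k (\<Sum>i\<in>UNIV. G k (frame i) *\<^sub>R frame i)" by (simp flip: frame_expansion)
      then show ?thesis by (simp add: G_sum_right G_scale_right power2_eq_square)
    qed
    finally show ?thesis .
  qed
  have "c * (\<Sum>j\<in>Basis. (norm (w j))\<^sup>2) \<le> c * (\<Sum>k\<in>Basis. G k k * N)"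
    by (intro mult_left_mono sum_mono 2 c)
  also have "\<dots> = (\<Sum>k\<in>Basis. G k k) * (c * N)" unfolding sum_distrib_right[symmetric] by (simp only: mult_ac)
  also have "\<dots> \<le> (\<Sum>k\<in>Basis. G k k) * (\<Sum>j\<in>Basis. \<Sum>k\<in>Basis. dual_form j k * h (w j) (w k))"
  proof (intro mult_left_mono 1 sum_nonneg)
    fix k :: "real^'n" show "0 \<le> G k k" using G_pos[of k] G_zero by (cases "k = 0") auto
  qed
  finally show ?thesis .
qed

end

lemma Ck_on_det:
  fixes M :: "'a::euclidean_space \<Rightarrow> real^'n^'n"
  assumes "open S" "\<And>i j. Ck_on k S (\<lambda>x. M x $ i $ j)"
  shows "Ck_on k S (\<lambda>x. det (M x))"
  unfolding det_def by (intro Ck_on_sum Ck_on_mult Ck_on_prod Ck_on_const assms)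


section \<open>The local symbol of an operator of Dirac type\<close>

context clifford_module_bundle
begin

definition cl :: "'m \<Rightarrow> ('m, 'n) tangent \<Rightarrow> 'v \<Rightarrow> 'v" where
  "cl x v s = c x (Cl_product x 1 [v]) s"

lemma clifford_data: "clifford_data tadd tscale (tangent_space x)"
  by unfold_locales (auto intro: tangent_closed)

lemma Cl_product_carrier: "set w \<subseteq> tangent_space x \<Longrightarrow> Cl_product x a w \<in> carrier (Cl x)"
  by (rule clifford_data.clifford_product_carrier[OF clifford_data])

lemma cl_in: "v \<in> tangent_space x \<Longrightarrow> s \<in> E x \<Longrightarrow> cl x v s \<in> E x"
  unfolding cl_def by (intro clifford_closed Cl_product_carrier) auto

lemma cl_linear:
  "v \<in> tangent_space x \<Longrightarrow> s \<in> E x \<Longrightarrow> t \<in> E x \<Longrightarrow> cl x v (a \<cdot> s + b \<cdot> t) = a \<cdot> cl x v s + b \<cdot> cl x v t"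
  unfolding cl_def by (intro clifford_linear Cl_product_carrier) auto

lemma cl_add: "v \<in> tangent_space x \<Longrightarrow> s \<in> E x \<Longrightarrow> t \<in> E x \<Longrightarrow> cl x v (s + t) = cl x v s + cl x v t"
  using cl_linear[of v x s t 1 1] by simp

lemma cl_scale: "v \<in> tangent_space x \<Longrightarrow> s \<in> E x \<Longrightarrow> cl x v (a \<cdot> s) = a \<cdot> cl x v s"
  using cl_linear[of v x s s a 0] by simp

lemma cl_tadd:
  assumes "v \<in> tangent_space x" "w \<in> tangent_space x" "s \<in> E x"
  shows "cl x (tadd v w) s = cl x v s + cl x w s"
  unfolding cl_def clifford_data.clifford_product_add[OF clifford_data assms(1,2)]
  by (intro clifford_add Cl_product_carrier) (use assms in auto)

lemma cl_tscale:
  assumes "v \<in> tangent_space x" "s \<in> E x"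
  shows "cl x (tscale a v) s = complex_of_real a \<cdot> cl x v s"
proof -
  have "cl x (tscale a v) s = c x (Cl_product x a []) (cl x v s)"
    unfolding cl_def clifford_data.clifford_product_scale[OF clifford_data assms(1)]
    by (intro clifford_mult Cl_product_carrier) (use assms in auto)
  then show ?thesis using clifford_scalar cl_in[OF assms] by simp
qed

lemma cl_square:
  assumes "v \<in> tangent_space x" "s \<in> E x"
  shows "cl x v (cl x v s) = complex_of_real (- g x v v) \<cdot> s"
proof -
  have "cl x v (cl x v s) = c x (Cl_product x 1 [v] \<otimes>\<^bsub>Cl x\<^esub> Cl_product x 1 [v]) s"
    unfolding cl_def by (intro clifford_mult[symmetric] Cl_product_carrier) (use assms in auto)
  then show ?thesis
    unfolding clifford_data.clifford_product_square[OF clifford_data assms(1)]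
    using clifford_scalar[OF assms(2)] by simp
qed

text \<open>
  Polarization of \<open>cl_square\<close>.
\<close>

lemma cl_anticommute:
  assumes v: "v \<in> tangent_space x" and w: "w \<in> tangent_space x" and s: "s \<in> E x"
  shows "cl x v (cl x w s) + cl x w (cl x v s) = complex_of_real (- 2 * g x v w) \<cdot> s"
proof -
  let ?z = "tadd v w"
  have z: "?z \<in> tangent_space x" by (rule tangent_closed[OF v w])
  have i: "cl x v s \<in> E x" "cl x w s \<in> E x" using cl_in v w s by auto
  have "g x ?z ?z = g x v v + 2 * g x v w + g x w w"
    using metric_add[OF v w z] metric_add[OF v w v] metric_add[OF v w w]
      metric_sym[OF v z] metric_sym[OF w z] metric_sym[OF w v] by simp
  moreover have "cl x ?z (cl x ?z s) = cl x v (cl x v s) + cl x w (cl x v s) + (cl x v (cl x w s) + cl x w (cl x w s))"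
    using i by (simp add: cl_tadd[OF v w] s cl_add[OF z] cl_add[OF v] cl_add[OF w] algebra_simps)
  ultimately have "cl x v (cl x w s) + cl x w (cl x v s) =
     complex_of_real (- (g x v v + 2 * g x v w + g x w w)) \<cdot> s - complex_of_real (- g x v v) \<cdot> s - complex_of_real (- g x w w) \<cdot> s"
    using cl_square[OF z s] cl_square[OF v s] cl_square[OF w s] by (simp add: algebra_simps)
  also have "\<dots> = complex_of_real (- 2 * g x v w) \<cdot> s"
    unfolding scale_left_diff_distrib[symmetric] by (rule arg_cong[where f = "\<lambda>a. a \<cdot> s"]) simp
  finally show ?thesis .
qed

end

text \<open>
  A chart together with a trivialization. All objects are transported to the open set \<open>Dom\<close> of
  \<open>\<real>\<^sup>n\<close>, where \<open>y\<close> denotes the coordinates of the point \<open>pt y\<close>.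
\<close>

locale clifford_chart =
  clifford_module_bundle \<A> g scaleC E \<T> c herm
  for \<A> :: "('m::{t2_space, second_countable_topology}, 'n::finite) chart set"
    and g :: "'m \<Rightarrow> ('m, 'n) tangent \<Rightarrow> ('m, 'n) tangent \<Rightarrow> real"
    and scaleC :: "complex \<Rightarrow> 'v::ab_group_add \<Rightarrow> 'v"  (infixr \<open>\<cdot>\<close> 75)
    and E :: "'m \<Rightarrow> 'v set"
    and \<T> :: "('m, 'v, 'r::finite) triv set"
    and c :: "'m \<Rightarrow> (('m, 'n) tangent list \<Rightarrow> real) set \<Rightarrow> 'v \<Rightarrow> 'v"
    and herm :: "'m \<Rightarrow> 'v \<Rightarrow> 'v \<Rightarrow> complex" +
  fixes \<kappa> :: "('m, 'n) chart" and U :: "'m set" and \<phi> :: "'m \<Rightarrow> 'v \<Rightarrow> complex^'r"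
  assumes \<kappa>: "\<kappa> \<in> \<A>" and triv: "(U, \<phi>) \<in> \<T>"
begin

abbreviation "pt \<equiv> chart_inv \<kappa>"

definition Dom :: "(real^'n) set" where
  "Dom = chart_map \<kappa> ` (U \<inter> chart_dom \<kappa>)"

lemma open_Dom: "open Dom"
  unfolding Dom_def by (rule chart_image_open[OF \<kappa> triv_open[OF triv]])

lemma pt: assumes "y \<in> Dom" shows "pt y \<in> U" "pt y \<in> chart_dom \<kappa>" "chart_map \<kappa> (pt y) = y"
  using assms \<kappa> by (auto simp: Dom_def)

lemma open_V: "open (U \<inter> chart_dom \<kappa>)"
  using triv_open[OF triv] chart_open[OF \<kappa>] by auto

lemma Dom_Ck:
  assumes "smooth_map_on (U \<inter> chart_dom \<kappa>) f"
  shows "Ck_on k Dom (\<lambda>y. f (pt y))"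
  using smooth_map_onD[OF assms \<kappa>] by (simp add: Dom_def Int_assoc)

definition cv :: "real^'n \<Rightarrow> real^'n \<Rightarrow> ('m, 'n) tangent" where
  "cv a y = coord_vec \<kappa> a (pt y)"

lemma cv_tangent: "y \<in> Dom \<Longrightarrow> cv a y \<in> tangent_space (pt y)"
  unfolding cv_def by (rule coord_vec_tangent[OF \<kappa> pt(2)])

lemma cv_add: "y \<in> Dom \<Longrightarrow> cv (a + b) y = tadd (cv a y) (cv b y)"
  unfolding cv_def by (simp add: coord_vec_add[OF \<kappa> pt(2)])

lemma cv_scale: "y \<in> Dom \<Longrightarrow> cv (t *\<^sub>R a) y = tscale t (cv a y)"
  unfolding cv_def by (simp add: coord_vec_scale[OF \<kappa> pt(2)])

definition Gy :: "real^'n \<Rightarrow> real^'n \<Rightarrow> real^'n \<Rightarrow> real" where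
  "Gy y a b = g (pt y) (cv a y) (cv b y)"

lemma inner_form_Gy: assumes y: "y \<in> Dom" shows "inner_form (Gy y)"
proof
  show "Gy y (a + b) z = Gy y a z + Gy y b z" for a b z
    unfolding Gy_def cv_add[OF y] by (intro metric_add cv_tangent y)
  show "Gy y (t *\<^sub>R a) z = t * Gy y a z" for t a z
    unfolding Gy_def cv_scale[OF y] by (intro metric_scale cv_tangent y)
  show "Gy y a b = Gy y b a" for a b
    unfolding Gy_def by (intro metric_sym cv_tangent y)
  show "Gy y a a > 0" if "a \<noteq> 0" for a
  proof -
    have "cv a y \<kappa> = a" unfolding cv_def by (rule coord_vec_self[OF \<kappa> pt(2)[OF y]])
    then have "cv a y \<noteq> tzero" using that by (auto simp: tzero_def)
    then show ?thesis unfolding Gy_def by (intro metric_pos cv_tangent y)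
  qed
qed

lemma Gy_Ck: "Ck_on k Dom (\<lambda>y. Gy y a b)"
proof -
  have "smooth_map_on (U \<inter> chart_dom \<kappa>) (\<lambda>x. g x (coord_vec \<kappa> a x) (coord_vec \<kappa> b x))"
    by (intro metric_smooth[OF open_V] coord_vec_smooth[OF \<kappa> open_V]) auto
  from Dom_Ck[OF this] show ?thesis by (simp add: Gy_def cv_def)
qed

abbreviation "fr y \<equiv> inner_form.frame (Gy y)"
abbreviation "sharpy y \<equiv> inner_form.sharp (Gy y)"

definition \<gamma>y :: "real^'n \<Rightarrow> real^'n \<Rightarrow> real^'n \<Rightarrow> real" where
  "\<gamma>y j k y = inner_form.dual_form (Gy y) j k"

lemma \<gamma>y_Ck:
  assumes "j \<in> Basis" "k \<in> Basis"
  shows "Ck_on n Dom (\<gamma>y j k)"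
proof -
  obtain j' k' where jk: "j = axis j' 1" "k = axis k' 1" using assms by (auto simp: Basis_vec_def)
  have gr: "Ck_on n Dom (\<lambda>y. inner_form.gram (Gy y) $ i $ l)" for i l
    by (subst Ck_on_cong[OF open_Dom, where g = "\<lambda>y. Gy y (axis i 1) (axis l 1)"])
       (auto simp: inner_form.gram_def[OF inner_form_Gy] Gy_Ck)
  have "Ck_on n Dom (\<lambda>y. det (\<chi> i l. if l = j' then axis k' 1 $ i else inner_form.gram (Gy y) $ i $ l) /
      det (inner_form.gram (Gy y)))"
  proof (rule Ck_on_real_divide[OF open_Dom Ck_on_det[OF open_Dom] Ck_on_det[OF open_Dom gr]])
    show "Ck_on n Dom (\<lambda>y. (\<chi> i l. if l = j' then axis k' 1 $ i else inner_form.gram (Gy y) $ i $ l) $ i $ l)" for i l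
      by (cases "l = j'") (use gr in auto)
    show "det (inner_form.gram (Gy y)) \<noteq> 0" if "y \<in> Dom" for y
      by (rule inner_form.det_gram[OF inner_form_Gy[OF that]])
  qed
  then show ?thesis
    by (subst Ck_on_cong[OF open_Dom, where g = "\<lambda>y. det (\<chi> i l. if l = j' then axis k' 1 $ i else inner_form.gram (Gy y) $ i $ l) /
      det (inner_form.gram (Gy y))"]) (auto simp: \<gamma>y_def jk inner_form.dual_form_cramer[OF inner_form_Gy])
qed

definition CL :: "real^'n \<Rightarrow> real^'n \<Rightarrow> complex^'r \<Rightarrow> complex^'r" where
  "CL y a z = \<phi> (pt y) (cl (pt y) (cv a y) (lift \<phi> z (pt y)))"

definition hy :: "real^'n \<Rightarrow> complex^'r \<Rightarrow> complex^'r \<Rightarrow> real" where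
  "hy y z z' = Re (herm (pt y) (lift \<phi> z (pt y)) (lift \<phi> z' (pt y)))"

context
  fixes y assumes y: "y \<in> Dom"
begin

lemma lift_pt: "lift \<phi> z (pt y) \<in> E (pt y)"
  by (rule lift_in[OF triv pt(1)[OF y]])

lemma cl_pt: "s \<in> E (pt y) \<Longrightarrow> cl (pt y) (cv a y) s \<in> E (pt y)"
  by (intro cl_in cv_tangent y)

lemma CL_add: "CL y a (z + z') = CL y a z + CL y a z'"
  by (simp add: CL_def lift_add[OF triv pt(1)[OF y]] cl_add[OF cv_tangent[OF y]] lift_pt
      triv_add[OF triv pt(1)[OF y]] cl_pt)

lemma CL_scale: "CL y a (t *\<^sub>R z) = t *\<^sub>R CL y a z"
  by (simp add: CL_def lift_scale[OF triv pt(1)[OF y]] cl_scale[OF cv_tangent[OF y]] lift_pt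
      triv_scale[OF triv pt(1)[OF y]] cl_pt flip: of_real_smult)

lemma CL_linear: "linear (CL y a)"
  by (rule linearI) (simp_all add: CL_add CL_scale)

lemma CL_add_left: "CL y (a + b) z = CL y a z + CL y b z"
  by (simp add: CL_def cv_add[OF y] cl_tadd[OF cv_tangent[OF y] cv_tangent[OF y]] lift_pt
      triv_add[OF triv pt(1)[OF y]] cl_pt)

lemma CL_scale_left: "CL y (t *\<^sub>R a) z = t *\<^sub>R CL y a z"
  by (simp add: CL_def cv_scale[OF y] cl_tscale[OF cv_tangent[OF y]] lift_pt
      triv_scale[OF triv pt(1)[OF y]] cl_pt flip: of_real_smult)

lemma CL_linear_left: "linear (\<lambda>a. CL y a z)"
  by (rule linearI) (simp_all add: CL_add_left CL_scale_left)

lemma CL_triv: "s \<in> E (pt y) \<Longrightarrow> CL y a (\<phi> (pt y) s) = \<phi> (pt y) (cl (pt y) (cv a y) s)"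
  by (simp add: CL_def lift_triv[OF triv pt(1)[OF y]])

lemma lift_CL: "lift \<phi> (CL y a z) (pt y) = cl (pt y) (cv a y) (lift \<phi> z (pt y))"
  by (simp add: CL_def lift_triv[OF triv pt(1)[OF y]] cl_pt lift_pt)

lemma CL_anticommute: "CL y a (CL y b z) + CL y b (CL y a z) = (- 2 * Gy y a b) *\<^sub>R z"
proof -
  have "CL y a (CL y b z) + CL y b (CL y a z) =
    \<phi> (pt y) (cl (pt y) (cv a y) (cl (pt y) (cv b y) (lift \<phi> z (pt y))) +
              cl (pt y) (cv b y) (cl (pt y) (cv a y) (lift \<phi> z (pt y))))"
    by (subst triv_add[OF triv pt(1)[OF y]]) (simp_all add: cl_pt lift_pt CL_def[of y _ "CL y _ _"] lift_CL)
  also have "\<dots> = complex_of_real (- 2 * Gy y a b) *s z"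
    unfolding cl_anticommute[OF cv_tangent[OF y] cv_tangent[OF y] lift_pt]
    by (subst triv_scale[OF triv pt(1)[OF y] lift_pt]) (simp add: Gy_def triv_lift[OF triv pt(1)[OF y]])
  finally show ?thesis by (simp only: of_real_smult)
qed

lemma hy_linear: "linear (\<lambda>z. hy y z z')"
proof (rule linearI)
  show "hy y (a + b) z' = hy y a z' + hy y b z'" for a b
    using herm_linear[OF lift_pt lift_pt lift_pt, of 1 a 1 b z']
    by (simp add: hy_def lift_add[OF triv pt(1)[OF y]])
  show "hy y (t *\<^sub>R a) z' = t *\<^sub>R hy y a z'" for t a
    using herm_linear[OF lift_pt lift_pt lift_pt, of "complex_of_real t" a 0 a z']
    by (simp add: hy_def lift_scale[OF triv pt(1)[OF y]] flip: of_real_smult)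
qed

lemma hy_sym: "hy y z z' = hy y z' z"
  unfolding hy_def by (subst herm_sym[OF lift_pt lift_pt]) simp

lemma hy_bilinear: "bilinear (hy y)"
  unfolding bilinear_def using hy_linear hy_sym by (metis (no_types, lifting) ext)

lemma hy_pos: "z \<noteq> 0 \<Longrightarrow> hy y z z > 0"
  unfolding hy_def
  by (intro herm_pos lift_pt) (metis triv_lift[OF triv pt(1)[OF y]] triv_zero[OF triv pt(1)[OF y]])

lemma hy_skew: "hy y (CL y a z) z' = - hy y z (CL y a z')"
  unfolding hy_def lift_CL using clifford_skew[OF cv_tangent[OF y] lift_pt lift_pt] by (simp add: cl_def)

lemma hy_triv: "s \<in> E (pt y) \<Longrightarrow> hy y (\<phi> (pt y) s) (\<phi> (pt y) s) = Re (herm (pt y) s s)"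
  by (simp add: hy_def lift_triv[OF triv pt(1)[OF y]])

end

lemma CL_Ck: "Ck_on k Dom (\<lambda>y. CL y a z)"
proof -
  have "smooth_section_on (U \<inter> chart_dom \<kappa>) (\<lambda>x. c x (Cl_product x 1 (map (\<lambda>X. X x) [coord_vec \<kappa> a])) (lift \<phi> z x))"
    by (intro clifford_smooth[OF open_V] smooth_section_on_subset[OF smooth_lift[OF triv]])
       (auto intro: coord_vec_smooth[OF \<kappa> open_V])
  then have "smooth_section_on (U \<inter> chart_dom \<kappa>) (\<lambda>x. cl x (coord_vec \<kappa> a x) (lift \<phi> z x))"
    by (simp add: cl_def)
  from smooth_section_triv[OF triv this]
  have "smooth_map_on (U \<inter> chart_dom \<kappa>) (\<lambda>x. \<phi> x (cl x (coord_vec \<kappa> a x) (lift \<phi> z x)))"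
    by (rule smooth_map_on_subset) auto
  from Dom_Ck[OF this] show ?thesis by (simp add: CL_def cv_def)
qed

lemma hy_Ck: "Ck_on k Dom (\<lambda>y. hy y z z')"
proof -
  have "smooth_map_on (U \<inter> chart_dom \<kappa>) (\<lambda>x. herm x (lift \<phi> z x) (lift \<phi> z' x))"
    by (intro herm_smooth[OF open_V] smooth_section_on_subset[OF smooth_lift[OF triv]]) auto
  from Ck_on_bounded_linear[OF open_Dom bounded_linear_Re Dom_Ck[OF this]]
  show ?thesis by (simp add: hy_def)
qed

text \<open>
  The coefficients of the Dirac operator: Clifford multiplication by the covectors \<open>dx\<^sub>k\<close>. The frame
  enters \<open>sharp\<close>, but \<open>Ay_expansion\<close> shows that \<open>Ay\<close> is smooth.
\<close>

definition Ay :: "real^'n \<Rightarrow> real^'n \<Rightarrow> (complex^'r) \<Rightarrow>\<^sub>L (complex^'r)" where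
  "Ay k y = Blinfun (CL y (sharpy y k))"

definition Hy :: "real^'n \<Rightarrow> (complex^'r) \<Rightarrow>\<^sub>L (complex^'r)" where
  "Hy y = Blinfun (\<lambda>z. \<Sum>b\<in>Basis. hy y z b *\<^sub>R b)"

lemma Ay_apply: "y \<in> Dom \<Longrightarrow> Ay k y z = CL y (sharpy y k) z"
  unfolding Ay_def using CL_linear by (subst bounded_linear_Blinfun_apply) (auto simp: linear_conv_bounded_linear)

lemma Hy_apply: assumes y: "y \<in> Dom" shows "Hy y z = (\<Sum>b\<in>Basis. hy y z b *\<^sub>R b)"
proof -
  have "linear (\<lambda>z. \<Sum>b\<in>Basis. hy y z b *\<^sub>R b)"
    by (intro linearI)
      (simp_all add: linear_add[OF hy_linear[OF y]] linear_scale[OF hy_linear[OF y]] scaleR_add_left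
        sum.distrib scaleR_sum_right)
  then show ?thesis unfolding Hy_def
    by (subst bounded_linear_Blinfun_apply) (auto simp: linear_conv_bounded_linear)
qed

lemma Hy_inner: assumes y: "y \<in> Dom" shows "Hy y z \<bullet> z' = hy y z z'"
proof -
  have l: "linear (hy y z)" using hy_bilinear[OF y] by (auto simp: bilinear_def)
  have "hy y z z' = hy y z (\<Sum>b\<in>Basis. (z' \<bullet> b) *\<^sub>R b)" by (simp add: euclidean_representation)
  also have "\<dots> = (\<Sum>b\<in>Basis. (z' \<bullet> b) * hy y z b)" using l by (simp add: linear_sum linear_scale)
  finally show ?thesis by (simp add: Hy_apply[OF y] inner_sum_left inner_commute[of z'] mult.commute)
qed

lemma Ay_expansion:
  assumes y: "y \<in> Dom"
  shows "Ay k y z = (\<Sum>j\<in>Basis. \<gamma>y j k y *\<^sub>R CL y j z)"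
  unfolding Ay_apply[OF y] inner_form.sharp_expansion[OF inner_form_Gy[OF y]]
  by (simp add: linear_sum[OF CL_linear_left[OF y]] linear_scale[OF CL_linear_left[OF y]] \<gamma>y_def)

lemma Ay_Ck: assumes k: "k \<in> Basis" shows "Ck_on n Dom (Ay k)"
proof (rule Ck_on_blinfun[OF open_Dom])
  fix b :: "complex^'r"
  have "Ck_on n Dom (\<lambda>y. \<Sum>j\<in>Basis. \<gamma>y j k y *\<^sub>R CL y j b)"
    by (intro Ck_on_sum Ck_on_scaleR open_Dom \<gamma>y_Ck CL_Ck k)
  then show "Ck_on n Dom (\<lambda>y. Ay k y b)"
    by (subst Ck_on_cong[OF open_Dom]) (auto simp: Ay_expansion)
qed

lemma Hy_Ck: "Ck_on n Dom Hy"
proof (rule Ck_on_blinfun[OF open_Dom])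
  fix b :: "complex^'r"
  have "Ck_on n Dom (\<lambda>y. \<Sum>b'\<in>Basis. hy y b b' *\<^sub>R b')"
    by (intro Ck_on_sum Ck_on_scaleR open_Dom hy_Ck Ck_on_const)
  then show "Ck_on n Dom (\<lambda>y. Hy y b)"
    by (subst Ck_on_cong[OF open_Dom]) (auto simp: Hy_apply)
qed

text \<open>
  The minimum of a continuous positive function on the product of \<open>K\<close> and the unit sphere.
\<close>

lemma Hy_lower_bound:
  assumes K: "compact K" "K \<subseteq> Dom"
  shows "\<exists>m>0. \<forall>y\<in>K. \<forall>z. Hy y z \<bullet> z \<ge> m * (norm z)\<^sup>2"
proof (cases "K = {}")
  case False
  let ?S = "K \<times> sphere (0::complex^'r) 1"
  let ?f = "\<lambda>(y, z). Hy y z \<bullet> z"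
  obtain b :: "complex^'r" where "b \<in> Basis" using nonempty_Basis by blast
  then have "b \<in> sphere 0 1" by simp
  then have ne: "?S \<noteq> {}" using False by blast
  have "continuous_on ?S (\<lambda>p. Hy (fst p) (snd p) \<bullet> snd p)"
    by (intro continuous_intros continuous_on_compose2[OF Ck_on_continuous[OF Hy_Ck[of 0]]]) (use K in auto)
  then have "continuous_on ?S ?f" by (simp add: case_prod_beta)
  from continuous_attains_inf[OF compact_Times[OF K(1) compact_sphere] ne this] obtain p where p: "p \<in> ?S" "\<And>q. q \<in> ?S \<Longrightarrow> ?f p \<le> ?f q"
    by blast
  obtain y0 z0 where yz: "p = (y0, z0)" "y0 \<in> K" "norm z0 = 1" using p(1) by (cases p) auto
  define m where "m = Hy y0 z0 \<bullet> z0"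
  have "m > 0" unfolding m_def using yz K(2) Hy_inner hy_pos by (metis norm_zero subsetD zero_neq_one)
  moreover have "Hy y z \<bullet> z \<ge> m * (norm z)\<^sup>2" if y: "y \<in> K" for y z
  proof (cases "z = 0")
    case False
    let ?z = "(1 / norm z) *\<^sub>R z"
    have "m \<le> Hy y ?z \<bullet> ?z" using p(2)[of "(y, ?z)"] y False yz by (simp add: m_def)
    also have "\<dots> = (Hy y z \<bullet> z) / (norm z)\<^sup>2" by (simp add: blinfun.scaleR_right power2_eq_square)
    finally show ?thesis using False by (simp add: field_simps)
  qed simp
  ultimately show ?thesis by blast
qed (auto intro: exI[of _ 1])

lemma clifford_symbol_local:
  assumes K: "compact K" "K \<subseteq> Dom" and \<Omega>: "open \<Omega>" "\<Omega> \<subseteq> K"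
  shows "\<exists>c0. clifford_symbol \<Omega> Ay Hy \<gamma>y c0"
proof -
  obtain m where m: "m > 0" "\<And>y z. y \<in> K \<Longrightarrow> Hy y z \<bullet> z \<ge> m * (norm z)\<^sup>2"
    using Hy_lower_bound[OF K] by blast
  have "continuous_on K (\<lambda>y. \<Sum>k\<in>Basis. Gy y k k)"
    by (intro continuous_intros continuous_on_subset[OF Ck_on_continuous[OF Gy_Ck[of 0]] K(2)])
  from continuous_bounded_above[OF K(1) this]
  obtain B where B: "\<And>y. y \<in> K \<Longrightarrow> (\<Sum>k\<in>Basis. Gy y k k) \<le> B" by blast
  define B' where "B' = max B 1"
  have B': "B' \<ge> 1" "\<And>y. y \<in> K \<Longrightarrow> (\<Sum>k\<in>Basis. Gy y k k) \<le> B'" using B by (force simp: B'_def)+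
  define c0 where "c0 = m / B'"
  have c0: "c0 > 0" "c0 \<le> m" using m B' by (auto simp: c0_def field_simps)
  have D: "y \<in> Dom" "y \<in> K" if "y \<in> \<Omega>" for y using that \<Omega> K by auto
  have sub: "\<Omega> \<subseteq> Dom" using D by auto
  have "clifford_symbol \<Omega> Ay Hy \<gamma>y c0"
  proof
    show "open \<Omega>" "c0 > 0" by (fact \<Omega>(1), fact c0(1))
    show "Ck_on (Suc 0) \<Omega> Hy" by (rule Ck_on_subset[OF Hy_Ck sub])
    show "Ck_on (Suc 0) \<Omega> (Ay j)" if "j \<in> Basis" for j by (rule Ck_on_subset[OF Ay_Ck[OF that] sub])
    show "Ck_on (Suc 0) \<Omega> (\<gamma>y j k)" if "j \<in> Basis" "k \<in> Basis" for j k
      by (rule Ck_on_subset[OF \<gamma>y_Ck[OF that] sub])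
    fix y assume "y \<in> \<Omega>"
    note y = D[OF this]
    note G = inner_form_Gy[OF y(1)]
    show "Hy y a \<bullet> b = Hy y b \<bullet> a" for a b unfolding Hy_inner[OF y(1)] by (rule hy_sym[OF y(1)])
    show "c0 * (norm a)\<^sup>2 \<le> Hy y a \<bullet> a" for a
      using m(2)[OF y(2), of a] c0(2) by (meson mult_right_mono order_trans zero_le_power2)
    show "\<gamma>y j k y = \<gamma>y k j y" for j k unfolding \<gamma>y_def by (rule inner_form.dual_form_sym[OF G])
    show "Ay j y (Ay k y a) + Ay k y (Ay j y a) = (- 2 * \<gamma>y j k y) *\<^sub>R a" for j k a
      unfolding Ay_apply[OF y(1)] CL_anticommute[OF y(1)] \<gamma>y_def inner_form.G_sharp_sharp[OF G] ..
    show "Hy y (Ay j y a) \<bullet> b = - (Hy y a \<bullet> Ay j y b)" for j a b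
      unfolding Ay_apply[OF y(1)] Hy_inner[OF y(1)] by (rule hy_skew[OF y(1)])
    fix w :: "real^'n \<Rightarrow> complex^'r"
    let ?Q = "\<Sum>j\<in>Basis. \<Sum>k\<in>Basis. \<gamma>y j k y * (Hy y (w j) \<bullet> w k)"
    have *: "m * (\<Sum>j\<in>Basis. (norm (w j))\<^sup>2) \<le> (\<Sum>k\<in>Basis. Gy y k k) * ?Q"
      unfolding Hy_inner[OF y(1)] \<gamma>y_def
      by (rule inner_form.dual_form_lower_bound[OF G hy_bilinear[OF y(1)]])
        (use m y in \<open>auto simp flip: Hy_inner\<close>)
    have Gn: "(\<Sum>k\<in>Basis. Gy y k k) \<ge> 0"
      using inner_form.G_pos[OF G] by (intro sum_nonneg) (metis less_imp_le nonzero_Basis)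
    have "m * (\<Sum>j\<in>Basis. (norm (w j))\<^sup>2) \<le> B' * ?Q"
    proof (cases "?Q \<ge> 0")
      case True
      then show ?thesis using * B'(2)[OF y(2)] by (meson mult_right_mono order_trans)
    next
      case False
      then have "(\<Sum>k\<in>Basis. Gy y k k) * ?Q \<le> 0" using Gn by (simp add: mult_nonneg_nonpos)
      then have "(\<Sum>j\<in>Basis. (norm (w j))\<^sup>2) \<le> 0" using * m(1) by (smt (verit, best) mult_pos_pos)
      then have "(\<Sum>j\<in>Basis. (norm (w j))\<^sup>2) = 0" by (simp add: sum_nonneg order_antisym)
      then have "w j = 0" if "j \<in> Basis" for j using that by (subst (asm) sum_nonneg_eq_0_iff) auto
      then have "?Q = 0" by simp
      then show ?thesis using False by simp
    qed
    then show "c0 * (\<Sum>j\<in>Basis. (norm (w j))\<^sup>2) \<le> ?Q"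
      using B'(1) by (simp add: c0_def field_simps)
  qed
  then show ?thesis ..
qed

end

context clifford_chart
begin

text \<open>
  Expanding the orthonormal frame in coordinate vectors turns \<open>\<Sum>\<^sub>i c(e\<^sub>i) \<nabla>\<^sub>e\<^sub>i\<close> into
  \<open>\<Sum>\<^sub>k c(dx\<^sub>k) \<nabla>\<^sub>k\<close>, which is independent of the frame; so a frame may be chosen at each point
  separately.
\<close>

lemma dirac_local:
  assumes nabla: "connection nabla" and u: "smooth_section u" and y: "y \<in> Dom"
    and D: "\<And>e. orthonormal_frame_at (pt y) e \<Longrightarrow>
      Du = (\<Sum>j\<in>UNIV. c (pt y) (Cl_product (pt y) 1 [e j]) (nabla u (pt y) (e j)))"
  shows "\<phi> (pt y) Du = (\<Sum>k\<in>Basis. Ay k y (\<phi> (pt y) (nabla u (pt y) (cv k y))))"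
proof -
  let ?x = "pt y"
  define N where "N a = \<phi> ?x (nabla u ?x (cv a y))" for a
  note G = inner_form_Gy[OF y]
  note tr = triv_add[OF triv pt(1)[OF y]] triv_scale[OF triv pt(1)[OF y]]
  note cin = connection_in[OF nabla u cv_tangent[OF y]]
  have N: "linear N"
  proof (rule linearI)
    show "N (a + b) = N a + N b" for a b
      unfolding N_def cv_add[OF y]
      by (simp add: connection_tadd[OF nabla u cv_tangent[OF y] cv_tangent[OF y]] tr cin)
    show "N (t *\<^sub>R a) = t *\<^sub>R N a" for t a
      unfolding N_def cv_scale[OF y]
      by (simp add: connection_tscale[OF nabla u cv_tangent[OF y]] tr cin of_real_smult)
  qed
  have "orthonormal_frame_at ?x (\<lambda>i. cv (fr y i) y)"
    unfolding orthonormal_frame_at_def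
    using cv_tangent[OF y] inner_form.frame[OF G] by (simp add: Gy_def)
  from D[OF this] have "\<phi> ?x Du = \<phi> ?x (\<Sum>i\<in>UNIV. cl ?x (cv (fr y i) y) (nabla u ?x (cv (fr y i) y)))"
    by (simp add: cl_def)
  also have "\<dots> = (\<Sum>i\<in>UNIV. CL y (fr y i) (N (fr y i)))"
    by (subst triv_sum[OF triv pt(1)[OF y]]) (simp_all add: cl_pt[OF y] cin CL_triv[OF y] N_def)
  also have "\<dots> = (\<Sum>i\<in>UNIV. \<Sum>k\<in>Basis. (fr y i \<bullet> k) *\<^sub>R CL y (fr y i) (N k))"
  proof (rule sum.cong[OF refl])
    fix i
    have "N (fr y i) = N (\<Sum>k\<in>Basis. (fr y i \<bullet> k) *\<^sub>R k)" by (simp add: euclidean_representation)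
    also have "\<dots> = (\<Sum>k\<in>Basis. (fr y i \<bullet> k) *\<^sub>R N k)" by (simp add: linear_sum[OF N] linear_scale[OF N])
    finally show "CL y (fr y i) (N (fr y i)) = (\<Sum>k\<in>Basis. (fr y i \<bullet> k) *\<^sub>R CL y (fr y i) (N k))"
      by (simp add: linear_sum[OF CL_linear[OF y]] CL_scale[OF y])
  qed
  also have "\<dots> = (\<Sum>k\<in>Basis. \<Sum>i\<in>UNIV. (fr y i \<bullet> k) *\<^sub>R CL y (fr y i) (N k))" by (rule sum.swap)
  also have "\<dots> = (\<Sum>k\<in>Basis. Ay k y (N k))"
    unfolding Ay_apply[OF y] inner_form.sharp_def[OF G]
    by (simp add: linear_sum[OF CL_linear_left[OF y]] CL_scale_left[OF y])
  finally show ?thesis by (simp add: N_def)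
qed

lemma herm_nonneg: assumes s: "s \<in> E x" shows "0 \<le> Re (herm x s s)"
proof -
  have "herm x 0 0 = 0" using herm_linear[of 0 x 0 0 0 0] subspace_0[OF fibre_subspace[of x]] by simp
  then show ?thesis using herm_pos[OF s] by (cases "s = 0") auto
qed

lemma fibre_norm_nonneg: "s \<in> E x \<Longrightarrow> 0 \<le> fibre_norm x s"
  by (simp add: fibre_norm_def herm_nonneg)

lemma fibre_norm_square: "s \<in> E x \<Longrightarrow> (fibre_norm x s)\<^sup>2 = Re (herm x s s)"
  by (simp add: fibre_norm_def herm_nonneg)

text \<open>
  The fibre norm of \<open>D u\<close> is that of the perturbation, hence at most \<open>B |u|\<close>; comparison of the
  fibre metric with the Euclidean norm costs the factor \<open>sqrt (h / m)\<close>. The difference between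
  covariant and coordinate derivatives contributes \<open>a C |u|\<close>.
\<close>

lemma dirac_inequality:
  assumes nabla: "connection nabla" and u: "smooth_section u"
    and D: "\<And>x e. orthonormal_frame_at x e \<Longrightarrow>
      Du x = (\<Sum>j\<in>UNIV. c x (Cl_product x 1 [e j]) (nabla u x (e j)))"
    and eq: "\<And>x. Du x + Pu x = 0" and PE: "\<And>x. Pu x \<in> E x"
    and r: "r > 0" "cball p r \<subseteq> Dom"
    and P: "\<And>y. y \<in> cball p (r / 2) \<Longrightarrow> fibre_norm (pt y) (Pu (pt y)) \<le> B * fibre_norm (pt y) (u (pt y))"
  defines "u' \<equiv> \<lambda>y. \<phi> (pt y) (u (pt y))"
  shows "\<exists>L\<ge>0. \<forall>y\<in>cball p (r / 2). norm (\<Sum>k\<in>Basis. Ay k y (pd u' k y)) \<le> L * norm (u' y)"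
proof -
  let ?K = "cball p (r / 2)"
  have K: "compact ?K" "?K \<subseteq> Dom" using r by (auto simp: subset_iff)
  obtain C where C: "C \<ge> 0" "\<And>y j. y \<in> ?K \<Longrightarrow> j \<in> Basis \<Longrightarrow>
      norm (\<phi> (pt y) (nabla u (pt y) (cv j y)) - pd u' j y) \<le> C * norm (u' y)"
    using connection_local_bound[OF nabla u \<kappa> triv r[unfolded Dom_def]] unfolding u'_def cv_def by blast
  obtain m where m: "m > 0" "\<And>y z. y \<in> ?K \<Longrightarrow> Hy y z \<bullet> z \<ge> m * (norm z)\<^sup>2"
    using Hy_lower_bound[OF K] by blast
  have "continuous_on ?K (\<lambda>y. norm (Hy y))"
    by (intro continuous_intros continuous_on_subset[OF Ck_on_continuous[OF Hy_Ck[of 0]] K(2)])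
  from continuous_bounded_above[OF K(1) this] obtain h where h: "\<And>y. y \<in> ?K \<Longrightarrow> norm (Hy y) \<le> h" by blast
  have "continuous_on ?K (\<lambda>y. \<Sum>k\<in>Basis. norm (Ay k y))"
    by (intro continuous_intros continuous_on_subset[OF Ck_on_continuous[OF Ay_Ck[of _ 0]] K(2)])
  from continuous_bounded_above[OF K(1) this] obtain a where a: "\<And>y. y \<in> ?K \<Longrightarrow> (\<Sum>k\<in>Basis. norm (Ay k y)) \<le> a" by blast
  define L1 where "L1 = \<bar>B\<bar> * sqrt (h / m)"
  have "p \<in> ?K" using r(1) by simp
  then have h0: "h \<ge> 0" using h[of p] norm_ge_zero order_trans by blast
  have a0: "a \<ge> 0" using a[OF \<open>p \<in> ?K\<close>] by (meson norm_ge_zero order_trans sum_nonneg)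
  have uE: "u x \<in> E x" for x using smooth_section_on_in[OF u] by simp
  show ?thesis
  proof (intro exI[of _ "L1 + a * C"] conjI ballI)
    show "0 \<le> L1 + a * C" using m h0 a0 C(1) by (auto simp: L1_def)
    fix y assume yK: "y \<in> ?K"
    then have y: "y \<in> Dom" using K by auto
    let ?x = "pt y"
    define N where "N k = \<phi> ?x (nabla u ?x (cv k y))" for k
    have Du: "\<phi> ?x (Du ?x) = (\<Sum>k\<in>Basis. Ay k y (N k))"
      unfolding N_def by (rule dirac_local[OF nabla u y D])
    have DE: "Du ?x = - Pu ?x" using eq[of ?x] by (simp add: add_eq_0_iff2)
    have DuE: "Du ?x \<in> E ?x" unfolding DE by (rule subspace_neg[OF fibre_subspace PE])
    have 1: "norm (\<phi> ?x (Du ?x)) \<le> L1 * norm (u' y)"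
    proof -
      have hn: "herm ?x (- s) t = - herm ?x s t" if "s \<in> E ?x" "t \<in> E ?x" for s t
        using herm_linear[OF that(1) that(1) that(2), of "-1" 0] by simp
      have "herm ?x (Du ?x) (Du ?x) = herm ?x (Pu ?x) (Pu ?x)"
        unfolding DE using PE[of ?x] subspace_neg[OF fibre_subspace PE[of ?x]] hn herm_sym
        by (metis (no_types, lifting) complex_cnj_minus minus_minus)
      then have "m * (norm (\<phi> ?x (Du ?x)))\<^sup>2 \<le> (fibre_norm ?x (Pu ?x))\<^sup>2"
        using m(2)[OF yK, of "\<phi> ?x (Du ?x)"] hy_triv[OF y DuE] fibre_norm_square[OF PE] by (simp add: Hy_inner[OF y])
      also have "\<dots> \<le> (B * fibre_norm ?x (u ?x))\<^sup>2"
        using P[OF yK] by (intro power_mono fibre_norm_nonneg PE)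
      also have "\<dots> = B\<^sup>2 * (Hy y (u' y) \<bullet> u' y)"
        using hy_triv[OF y uE] by (simp add: power_mult_distrib fibre_norm_square[OF uE] Hy_inner[OF y] u'_def)
      also have "\<dots> \<le> B\<^sup>2 * (h * (norm (u' y))\<^sup>2)"
      proof (intro mult_left_mono)
        have "Hy y (u' y) \<bullet> u' y \<le> norm (Hy y (u' y)) * norm (u' y)" by (rule norm_cauchy_schwarz)
        also have "\<dots> \<le> (h * norm (u' y)) * norm (u' y)"
          by (intro mult_right_mono order_trans[OF norm_blinfun] h yK) auto
        finally show "Hy y (u' y) \<bullet> u' y \<le> h * (norm (u' y))\<^sup>2" by (simp add: power2_eq_square mult_ac)
      qed simp
      finally have "(norm (\<phi> ?x (Du ?x)))\<^sup>2 \<le> B\<^sup>2 * (h / m) * (norm (u' y))\<^sup>2"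
        using m(1) by (simp add: field_simps)
      also have "\<dots> = (L1 * norm (u' y))\<^sup>2"
        using h0 m(1) by (simp add: L1_def power_mult_distrib)
      finally show ?thesis
        by (rule power2_le_imp_le) (use h0 m(1) in \<open>simp add: L1_def\<close>)
    qed
    have 2: "norm (\<Sum>k\<in>Basis. Ay k y (pd u' k y - N k)) \<le> a * C * norm (u' y)"
    proof -
      have "norm (\<Sum>k\<in>Basis. Ay k y (pd u' k y - N k)) \<le> (\<Sum>k\<in>Basis. norm (Ay k y) * (C * norm (u' y)))"
      proof (rule sum_norm_le)
        fix k :: "real^'n" assume k: "k \<in> Basis"
        show "norm (Ay k y (pd u' k y - N k)) \<le> norm (Ay k y) * (C * norm (u' y))"
          using C(2)[OF yK k]
          by (intro order_trans[OF norm_blinfun] mult_left_mono) (auto simp: N_def norm_minus_commute)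
      qed
      also have "\<dots> \<le> a * (C * norm (u' y))"
        unfolding sum_distrib_right[symmetric] using a[OF yK] C(1) by (intro mult_right_mono) auto
      finally show ?thesis by (simp add: mult.assoc)
    qed
    have "(\<Sum>k\<in>Basis. Ay k y (pd u' k y)) = \<phi> ?x (Du ?x) + (\<Sum>k\<in>Basis. Ay k y (pd u' k y - N k))"
      by (simp add: Du blinfun.diff_right sum_subtractf)
    then show "norm (\<Sum>k\<in>Basis. Ay k y (pd u' k y)) \<le> (L1 + a * C) * norm (u' y)"
      using norm_triangle_le[OF add_mono[OF 1 2]] by (simp add: distrib_right)
  qed
qed

end

section \<open>The zero set\<close>

context clifford_module_bundle
begin

text \<open>
  Since \<open>x0\<close> is a limit of interior zeros, there is an interior zero, with coordinates \<open>q\<close>, so close to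
  it that a ball around \<open>q\<close> inside the chart contains \<open>x0\<close>; the vanishing of \<open>u\<close> spreads from a
  neighbourhood of \<open>q\<close> over this ball.
\<close>

lemma zero_set_interior_closed:
  assumes D: "dirac_type D" and PP: "admissible_perturbation \<PP>" and u: "smooth_section u"
    and eq: "\<And>x. D u x + \<PP> u x = 0"
    and x0: "x0 \<in> closure (interior {x. u x = 0})"
  shows "x0 \<in> interior {x. u x = 0}"
proof -
  let ?Z = "interior {x. u x = 0}"
  obtain \<kappa> where chart0: "\<kappa> \<in> \<A>" "x0 \<in> chart_dom \<kappa>" using chart_exists by blast
  obtain U \<phi> where triv0: "(U, \<phi>) \<in> \<T>" "x0 \<in> U" using triv_covers by fastforce
  interpret clifford_chart \<A> g scaleC E \<T> c herm \<kappa> U \<phi> by unfold_locales (fact chart0(1), fact triv0(1))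
  obtain nabla where nabla: "connection nabla" and Dn: "\<And>x e. orthonormal_frame_at x e \<Longrightarrow>
      D u x = (\<Sum>j\<in>UNIV. c x (Cl_product x 1 [e j]) (nabla u x (e j)))"
    using D u unfolding dirac_type_def by blast
  note adm = PP[unfolded admissible_perturbation_def, THEN spec, THEN mp, OF u]
  have PE: "\<PP> u x \<in> E x" for x using adm by blast
  from conjunct2[OF adm] obtain P :: "'m \<Rightarrow> real" where Pb: "\<And>x. \<exists>V. open V \<and> x \<in> V \<and> bounded (P ` V)"
    and P: "\<And>x. fibre_norm x (\<PP> u x) \<le> P x * fibre_norm x (u x)"
    by metis
  obtain V where V: "open V" "x0 \<in> V" "bounded (P ` V)" using Pb by blast
  obtain B where "\<And>x. x \<in> V \<Longrightarrow> norm (P x) \<le> B" using V(3) unfolding bounded_iff by blast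
  then have B: "\<And>x. x \<in> V \<Longrightarrow> P x \<le> B" by fastforce
  define p where "p = chart_map \<kappa> x0"
  let ?S = "chart_map \<kappa> ` ((U \<inter> V) \<inter> chart_dom \<kappa>)"
  have "open ?S" by (intro chart_image_open[OF chart0(1)] open_Int triv_open[OF triv0(1)] V(1))
  moreover have "p \<in> ?S" unfolding p_def by (intro imageI IntI chart0 triv0 V)
  ultimately obtain r where r: "r > 0" "cball p r \<subseteq> ?S" by (meson open_contains_cball)
  have rD: "cball p r \<subseteq> Dom" using r(2) by (auto simp: Dom_def)
  have ptV: "pt y \<in> V" if "y \<in> cball p r" for y using r(2) that chart0(1) by auto
  define u' where "u' y = \<phi> (pt y) (u (pt y))" for y
  have "\<exists>L\<ge>0. \<forall>y\<in>cball p (r / 2). norm (\<Sum>k\<in>Basis. Ay k y (pd u' k y)) \<le> L * norm (u' y)"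
    unfolding u'_def
  proof (rule dirac_inequality[where Du = "D u" and Pu = "\<PP> u", OF nabla u Dn eq PE r(1) rD])
    fix y assume "y \<in> cball p (r / 2)"
    then have "P (pt y) \<le> B" using r(1) by (intro B ptV) auto
    then show "fibre_norm (pt y) (\<PP> u (pt y)) \<le> B * fibre_norm (pt y) (u (pt y))"
      by (intro order_trans[OF P] mult_right_mono fibre_norm_nonneg smooth_section_on_in[OF u]) auto
  qed
  then obtain L where L: "L \<ge> 0" "\<And>y. y \<in> cball p (r / 2) \<Longrightarrow>
      norm (\<Sum>k\<in>Basis. Ay k y (pd u' k y)) \<le> L * norm (u' y)" by blast
  let ?\<Omega> = "ball p (r / 2)"
  have K: "compact (cball p (r / 2))" "cball p (r / 2) \<subseteq> Dom" using rD r(1) by (auto simp: subset_iff)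
  obtain c0 where "clifford_symbol ?\<Omega> Ay Hy \<gamma>y c0"
    using clifford_symbol_local[OF K open_ball ball_subset_cball] by blast
  then interpret S: clifford_symbol ?\<Omega> Ay Hy \<gamma>y c0 .
  have "smooth_map_on U (\<lambda>x. \<phi> x (u x))" using smooth_section_triv[OF triv0(1) u] by simp
  then have "Ck_on 2 Dom u'" unfolding u'_def by (intro Dom_Ck) (rule smooth_map_on_subset, auto)
  then have u'C: "Ck_on 2 ?\<Omega> u'" by (rule Ck_on_subset) (use K in auto)
  let ?O = "chart_dom \<kappa> \<inter> chart_map \<kappa> -` ball p (r / 8)"
  have "open ?O" by (intro continuous_open_preimage chart_cont chart_open chart0 open_ball)
  moreover have "x0 \<in> ?O" using chart0 r(1) by (simp add: p_def)
  ultimately have "?O \<inter> ?Z \<noteq> {}" using x0 by (meson disjoint_iff open_Int_closure_eq_empty)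
  then obtain z where z: "z \<in> chart_dom \<kappa>" "dist p (chart_map \<kappa> z) < r / 8" "z \<in> ?Z" by auto
  define q where "q = chart_map \<kappa> z"
  have "open (chart_map \<kappa> ` (?Z \<inter> chart_dom \<kappa>))" by (intro chart_image_open[OF chart0(1)]) simp
  moreover have "q \<in> chart_map \<kappa> ` (?Z \<inter> chart_dom \<kappa>)" using z by (auto simp: q_def)
  ultimately obtain r0 where r0: "r0 > 0" "ball q r0 \<subseteq> chart_map \<kappa> ` (?Z \<inter> chart_dom \<kappa>)"
    by (meson open_contains_ball)
  define r1 where "r1 = min r0 (r / 8)"
  have "p \<in> cball p (r / 2)" using r(1) by simp
  have qp: "dist p q < r / 8" using z(2) by (simp add: q_def)
  have sub: "cball q (r / 4) \<subseteq> ?\<Omega>"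
  proof
    fix y assume "y \<in> cball q (r / 4)"
    then have "dist p y < r / 8 + r / 4" using dist_triangle[of p y q] qp by simp
    then show "y \<in> ?\<Omega>" using r(1) by simp
  qed
  have z0: "u' y = 0" if "y \<in> ball q r1" for y
  proof -
    have "y \<in> ball q r0" using that by (simp add: r1_def)
    then have "pt y \<in> ?Z" using r0(2) chart0(1) by auto
    then have "u (pt y) = 0" using interior_subset by blast
    moreover have "y \<in> cball q (r / 4)" using that r(1) by (simp add: r1_def)
    then have "y \<in> Dom" using sub K(2) ball_subset_cball by blast
    ultimately show ?thesis by (simp add: u'_def triv_zero[OF triv0(1) pt(1)])
  qed
  have zero: "u' y = 0" if "y \<in> ball q (r / 4)" for y
  proof (rule S.unique_continuation_ball[OF sub _ u'C L(1) _ z0 that])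
    show "r1 > 0" using r0(1) r(1) by (simp add: r1_def)
    show "norm (S.symb x (\<lambda>j. pd u' j x)) \<le> L * norm (u' x)" if "x \<in> ?\<Omega>" for x
      unfolding S.symb_def using L(2)[of x] that by simp
  qed
  let ?N = "chart_dom \<kappa> \<inter> chart_map \<kappa> -` ball q (r / 4)"
  have "open ?N" by (intro continuous_open_preimage chart_cont chart_open chart0 open_ball)
  moreover have "x0 \<in> ?N"
  proof -
    have "dist q p < r / 4" using qp r(1) by (simp add: dist_commute)
    then show ?thesis using chart0 by (simp add: p_def)
  qed
  moreover have "?N \<subseteq> {x. u x = 0}"
  proof
    fix x assume x: "x \<in> ?N"
    then have "chart_map \<kappa> x \<in> Dom" using sub K ball_subset_cball by blast
    moreover have "pt (chart_map \<kappa> x) = x" using x chart0(1) by simp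
    ultimately have "x \<in> U" using pt(1) by metis
    have "u' (chart_map \<kappa> x) = 0" using x by (intro zero) auto
    then have "\<phi> x (u x) = 0" using \<open>pt (chart_map \<kappa> x) = x\<close> by (simp add: u'_def)
    then show "x \<in> {x. u x = 0}"
      using triv_eq_0_iff[OF triv0(1) \<open>x \<in> U\<close>] smooth_section_on_in[OF u] by simp
  qed
  ultimately show ?thesis by (rule interiorI)
qed

end

theorem theorem2p7:
  fixes \<A> :: "('m::{t2_space, second_countable_topology}, 'n::finite) chart set"
    and g :: "'m \<Rightarrow> ('m, 'n) tangent \<Rightarrow> ('m, 'n) tangent \<Rightarrow> real"
    and scaleC :: "complex \<Rightarrow> 'v::ab_group_add \<Rightarrow> 'v"
    and E :: "'m \<Rightarrow> 'v set"
    and \<T> :: "('m, 'v, 'r::finite) triv set"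
    and c :: "'m \<Rightarrow> (('m, 'n) tangent list \<Rightarrow> real) set \<Rightarrow> 'v \<Rightarrow> 'v"
    and herm :: "'m \<Rightarrow> 'v \<Rightarrow> 'v \<Rightarrow> complex"
    and D \<PP> :: "('m \<Rightarrow> 'v) \<Rightarrow> 'm \<Rightarrow> 'v"
    and u :: "'m \<Rightarrow> 'v"
    and C W :: "'m set"
  assumes "clifford_module_bundle \<A> g scaleC E \<T> c herm"
    and "clifford_module_bundle.dirac_type \<A> g scaleC E \<T> c D"
    and "clifford_module_bundle.admissible_perturbation \<A> E \<T> herm \<PP>"
    and "complex_vector_bundle.smooth_section_on \<A> E \<T> UNIV u"
    and "\<forall>x. D u x + \<PP> u x = 0"
    and "C \<in> components UNIV"
    and "W \<subseteq> C" and "open W" and "W \<noteq> {}" and "\<forall>x\<in>W. u x = 0"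
  shows "\<forall>x\<in>C. u x = 0"
proof -
  interpret clifford_module_bundle \<A> g scaleC E \<T> c herm by (fact assms(1))
  let ?Z = "interior {x. u x = 0}"
  have cl: "closure ?Z \<subseteq> ?Z"
    using zero_set_interior_closed[OF assms(2-4)] assms(5) by blast
  have "W \<subseteq> ?Z" using assms(8,10) by (intro interior_maximal) auto
  then have meet: "?Z \<inter> C \<noteq> {}" using assms(7,9) by blast
  have "connected C" by (rule in_components_connected[OF assms(6)])
  moreover have "open (- closure ?Z)" by (simp add: open_Compl)
  moreover have "?Z \<inter> - closure ?Z \<inter> C = {}" using closure_subset by blast
  moreover have "C \<subseteq> ?Z \<union> - closure ?Z" using cl by blast
  ultimately have "- closure ?Z \<inter> C = {}" using meet connectedD[of C ?Z "- closure ?Z"] by blast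
  then have "C \<subseteq> ?Z" using cl by blast
  then show ?thesis using interior_subset by blast
qed

end
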